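(* Let $\mathcal C=(\mathcal A,\Sigma^{sys},\Sigma^{env},\{\mathcal B_p\}_{p\in\mathscr P})$ be a control game with safety objective and let $\mathcal G_{\mathcal C}$ be the Petri game constructed from it as described in the context. Assume that only strategies for $\mathcal G_{\mathcal C}$ that always commit are considered, i.e., strategies $\sigma=(\mathcal N^\sigma,\lambda)$ in which every place $q$ with $\lambda(q)$ a system place has an outgoing transition in $\mathcal N^\sigma$. Then $\mathcal C$ and $\mathcal G_{\mathcal C}$ are strategy-equivalent.
   Context: Control games. $\mathscr P$ is a finite set of processes, $(\Sigma,\mathit{dom})$ a distributed alphabet with $\mathit{dom}:\Sigma\to 2^{\mathscr P}\setminus\{\emptyset\}$, $\Sigma_p=\{a\mid p\in\mathit{dom}(a)\}$. $\mathcal A=(\{S_p\}_{p},s_{in},\{\delta_a\}_{a})$ is an asynchronous automaton: finite pairwise disjoint local state sets $S_p$, initial global state $s_{in}$, partial functions $\delta_a:\prod_{p\in\mathit{dom}(a)}S_p\rightharpoonup\prod_{p\in\mathit{dom}(a)}S_p$; global step $s\xrightarrow{a}s'$ iff $\delta_a(s_{\mathit{dom}(a)})=s'_{\mathit{dom}(a)}$ and $s,s'$ agree outside $\mathit{dom}(a)$; a global state is final if no action is possible. Plays are executable action sequences up to trace equivalence (commuting adjacent actions of disjoint domain); $\mathit{view}_p(u)$ is the shortest trace $v$ with $u\sim vw$ where $w$ has no action of $\Sigma_p$. $\Sigma=\Sigma^{sys}\uplus\Sigma^{env}$ (controllable/uncontrollable), $\mathcal B_p\subseteq S_p$ losing states.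 A controller $\varrho=\{f_p\}$ maps $p$-views to subsets of $\Sigma^{sys}\cap\Sigma_p$; $\mathit{Plays}(\mathcal C,\varrho)$ is the smallest set containing the empty play, closed under appending an executable uncontrollable action, or an executable controllable action $a$ with $a\in f_p(\mathit{view}_p(u))$ for all $p\in\mathit{dom}(a)$. $\varrho$ is deadlock-avoiding if every finite non-extendable play of $\mathit{Plays}(\mathcal C,\varrho)$ ends in a final global state; $\varrho$ is winning (safety) if it is deadlock-avoiding and no play in $\mathit{Plays}(\mathcal C,\varrho)$ visits a state of $\bigcup_p\mathcal B_p$. Petri games. A Petri game $(\mathcal P_S,\mathcal P_E,\mathcal T,\mathcal F,\mathit{In},\mathcal B)$ is a finite Petri net with places partitioned into system places $\mathcal P_S$ and environment places $\mathcal P_E$ and bad places $\mathcal B$. A strategy is a branching process $\sigma=(\mathcal N^\sigma,\lambda)$ satisfying justified refusal: whenever $C$ is a set of pairwise concurrent places of $\mathcal N^\sigma$ and $t$ a transition with $\lambda[C]={}^\bullet t$, either some $t'$ with $\lambda(t')=t$, ${}^\bullet t'=C$ exists, or some $q\in C$ with $\lambda(q)\in\mathcal P_S$ has $t\notin\lambda[q^\bullet]$. $\sigma$ is deadlock-avoiding if for every final reachable marking $M$ of $\mathcal N^\sigma$, $\lambda[M]$ is final; $\sigma$ is winning (safety) if it is deadlock-avoiding and no reachable marking contains a place labelled in $\mathcal B$. Construction of $\mathcal G_{\mathcal C}$. For a local state $s$, $\mathit{en}(s)$ is the set of actions $a$ such that some tuple in the domain of $\delta_a$ contains $s$. System places: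 $\bigcup_p S_p$. Environment places: $(s,A)$ for each local state $s$ and $A\subseteq\mathit{en}(s)\cap\Sigma^{sys}$, plus one place $\bot^p_{DL}$ per process. Transitions: (1) $(a,B,\{A_s\}_{s\in B})$ for $a\in\Sigma^{env}$, $B$ in the domain of $\delta_a$ (viewed as a set of local states), $A_s\subseteq\mathit{en}(s)\cap\Sigma^{sys}$; (2) $(a,B,\{A_s\}_{s\in B})$ for $a\in\Sigma^{sys}$, $B$ in the domain of $\delta_a$, $A_s\subseteq\mathit{en}(s)\cap\Sigma^{sys}$ with $a\in A_s$ for all $s\in B$; (3) $\tau_{(s,A)}$ for each environment place $(s,A)$; (4) $t^M_{DL}$ for each $M\in\mathfrak D_{DL}$. Flow: ${}^\bullet(a,B,\{A_s\})=\{(s,A_s)\mid s\in B\}$ and $(a,B,\{A_s\})^\bullet=\delta_a(B)$ (as a set of local states); ${}^\bullet\tau_{(s,A)}=\{s\}$, $\tau_{(s,A)}^\bullet=\{(s,A)\}$; ${}^\bullet t^M_{DL}=M$, $(t^M_{DL})^\bullet=\{\bot^p_{DL}\mid p\in\mathscr P\}$. Initial marking: the local states of $s_{in}$. Bad places: $\bigcup_p\mathcal B_p\cup\{\bot^p_{DL}\mid p\in\mathscr P\}$. Here, with $\zeta(s)=\zeta((s,A))=s$ extended pointwise to markings, $\mathfrak D_{DL}$ is the set of markings $M$ reachable in the game without the $t_{DL}$-transitions and $\bot_{DL}$-places such that $M$ consists only of environment places, $M$ is final, and the global state $\zeta(M)$ is not final in $\mathcal A$. Strategy-equivalence. Each action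 $a\in\Sigma$ is observable and corresponds to all transitions $(a,B,\{A_s\})$; transitions $\tau_{(s,A)}$ and $t^M_{DL}$ are internal ($\tau$); transitions of $\mathcal N^\sigma$ are identified with their labels. A strategy $\sigma$ and a controller $\varrho$ are bisimilar if there is a relation $\approx$ between reachable markings of $\mathcal N^\sigma$ and finite plays of $\mathit{Plays}(\mathcal C,\varrho)$ with $\mathit{In}^\sigma\approx\epsilon$ such that: if $M\approx u$ and $M\xrightarrow{a}M'$ ($a$ observable) then some $u'=u\tau^*a\tau^*\in\mathit{Plays}(\mathcal C,\varrho)$ has $M'\approx u'$; if $M\approx u$ and $M\xrightarrow{\tau}M'$ then some $u'=u\tau^*\in\mathit{Plays}(\mathcal C,\varrho)$ has $M'\approx u'$; if $M\approx u$ and $ua\in\mathit{Plays}(\mathcal C,\varrho)$ ($a$ observable) then some $M'$ with $M\xrightarrow{\tau^*a\tau^*}M'$ has $M'\approx ua$; if $M\approx u$ and $u\tau\in\mathit{Plays}(\mathcal C,\varrho)$ then some $M'$ with $M\xrightarrow{\tau^*}M'$ has $M'\approx u\tau$. $\mathcal C$ and $\mathcal G_{\mathcal C}$ are strategy-equivalent if every winning strategy for $\mathcal G_{\mathcal C}$ has a bisimilar winning controller for $\mathcal C$ and every winning controller for $\mathcal C$ has a bisimilar winning strategy for $\mathcal G_{\mathcal C}$.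
   Formalization: "Always commit" is read as: every place labelled by a system place has exactly one outgoing transition; with merely at least one the claim fails (one process, one state, two controllable self-loops a and b, a strategy offering both {a} and {b} has no bisimilar controller). *)

theory Defs
  imports Main "HOL-Library.FuncSet"
begin

section \<open>Control games\<close>

text \<open>A tuple in the product of the \<open>S\<^sub>p\<close> for \<open>p\<close> in a set \<open>D\<close> of processes is an extensional function
  in \<open>PiE D S\<close>; \<open>s\<close> restricted to \<open>dom(a)\<close> is \<open>restrict s (dmn C a)\<close>.\<close>

record ('p, 'a, 's) control_game =
  procs :: "'p set"
  acts :: "'a set"
  dmn :: "'a \<Rightarrow> 'p set"
  lstates :: "'p \<Rightarrow> 's set"
  init_state :: "'p \<Rightarrow> 's"
  delta :: "'a \<Rightarrow> ('p \<Rightarrow> 's) \<Rightarrow> ('p \<Rightarrow> 's) option"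
  sys_acts :: "'a set"
  env_acts :: "'a set"
  losing :: "'p \<Rightarrow> 's set"

definition global_states :: "('p, 'a, 's) control_game \<Rightarrow> ('p \<Rightarrow> 's) set" where
  "global_states C = PiE (procs C) (lstates C)"

definition acts_of :: "('p, 'a, 's) control_game \<Rightarrow> 'p \<Rightarrow> 'a set" where
  "acts_of C p = {a \<in> acts C. p \<in> dmn C a}"

locale control_game =
  fixes C :: "('p, 'a, 's) control_game"
  assumes finite_procs: "finite (procs C)"
    and finite_acts: "finite (acts C)"
    and dmn_subset: "a \<in> acts C \<Longrightarrow> dmn C a \<subseteq> procs C"
    and dmn_nonempty: "a \<in> acts C \<Longrightarrow> dmn C a \<noteq> {}"
    and finite_lstates: "p \<in> procs C \<Longrightarrow> finite (lstates C p)"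
    and lstates_disjoint:
      "p \<in> procs C \<Longrightarrow> p' \<in> procs C \<Longrightarrow> p \<noteq> p' \<Longrightarrow> lstates C p \<inter> lstates C p' = {}"
    and init_state: "init_state C \<in> global_states C"
    and delta_dom: "a \<in> acts C \<Longrightarrow> delta C a B = Some B' \<Longrightarrow> B \<in> PiE (dmn C a) (lstates C)"
    and delta_ran: "a \<in> acts C \<Longrightarrow> delta C a B = Some B' \<Longrightarrow> B' \<in> PiE (dmn C a) (lstates C)"
    and acts_union: "acts C = sys_acts C \<union> env_acts C"
    and acts_disjoint: "sys_acts C \<inter> env_acts C = {}"
    and losing_subset: "p \<in> procs C \<Longrightarrow> losing C p \<subseteq> lstates C p"

definition step :: "('p, 'a, 's) control_game \<Rightarrow> ('p \<Rightarrow> 's) \<Rightarrow> 'a \<Rightarrow> ('p \<Rightarrow> 's) \<Rightarrow> bool" where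
  "step C s a s' \<longleftrightarrow> s \<in> global_states C \<and> s' \<in> global_states C \<and> a \<in> acts C
     \<and> delta C a (restrict s (dmn C a)) = Some (restrict s' (dmn C a))
     \<and> (\<forall>p \<in> procs C - dmn C a. s' p = s p)"

definition final_state :: "('p, 'a, 's) control_game \<Rightarrow> ('p \<Rightarrow> 's) \<Rightarrow> bool" where
  "final_state C s \<longleftrightarrow> \<not> (\<exists>a s'. step C s a s')"

inductive exec :: "('p, 'a, 's) control_game \<Rightarrow> 'a list \<Rightarrow> ('p \<Rightarrow> 's) \<Rightarrow> bool" for C where
  exec_Nil: "exec C [] (init_state C)"
| exec_snoc: "exec C u s \<Longrightarrow> step C s a s' \<Longrightarrow> exec C (u @ [a]) s'"

subsection \<open>Traces and views\<close>

inductive commute :: "('p, 'a, 's) control_game \<Rightarrow> 'a list \<Rightarrow> 'a list \<Rightarrow> bool" for C where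
  "dmn C a \<inter> dmn C b = {} \<Longrightarrow> commute C (u @ [a, b] @ v) (u @ [b, a] @ v)"

definition trace_eq :: "('p, 'a, 's) control_game \<Rightarrow> 'a list \<Rightarrow> 'a list \<Rightarrow> bool" where
  "trace_eq C = (commute C)\<^sup>*\<^sup>*"

text \<open>A trace is an equivalence class of action sequences.\<close>

type_synonym 'a trace = "'a list set"

definition trace :: "('p, 'a, 's) control_game \<Rightarrow> 'a list \<Rightarrow> 'a trace" where
  "trace C u = {v. trace_eq C u v}"

definition snoc :: "('p, 'a, 's) control_game \<Rightarrow> 'a trace \<Rightarrow> 'a \<Rightarrow> 'a trace" where
  "snoc C T a = (\<Union>u \<in> T. trace C (u @ [a]))"

definition view :: "('p, 'a, 's) control_game \<Rightarrow> 'p \<Rightarrow> 'a trace \<Rightarrow> 'a trace" where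
  "view C p T = trace C (ARG_MIN length v. \<exists>w. v @ w \<in> T \<and> set w \<inter> acts_of C p = {})"

definition all_plays :: "('p, 'a, 's) control_game \<Rightarrow> 'a trace set" where
  "all_plays C = {trace C u | u s. exec C u s}"

subsection \<open>Controllers\<close>

type_synonym ('p, 'a) controller = "'p \<Rightarrow> 'a trace \<Rightarrow> 'a set"

definition controller :: "('p, 'a, 's) control_game \<Rightarrow> ('p, 'a) controller \<Rightarrow> bool" where
  "controller C \<rho> \<longleftrightarrow>
     (\<forall>p \<in> procs C. \<rho> p \<in> view C p ` all_plays C \<rightarrow> Pow (sys_acts C \<inter> acts_of C p))"

inductive_set plays :: "('p, 'a, 's) control_game \<Rightarrow> ('p, 'a) controller \<Rightarrow> 'a trace set"
  for C \<rho> where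
  empty: "trace C [] \<in> plays C \<rho>"
| env: "T \<in> plays C \<rho> \<Longrightarrow> snoc C T a \<in> all_plays C \<Longrightarrow> a \<in> env_acts C \<Longrightarrow> snoc C T a \<in> plays C \<rho>"
| sys: "T \<in> plays C \<rho> \<Longrightarrow> snoc C T a \<in> all_plays C \<Longrightarrow> a \<in> sys_acts C
    \<Longrightarrow> \<forall>p \<in> dmn C a. a \<in> \<rho> p (view C p T) \<Longrightarrow> snoc C T a \<in> plays C \<rho>"

definition controller_deadlock_avoiding ::
  "('p, 'a, 's) control_game \<Rightarrow> ('p, 'a) controller \<Rightarrow> bool" where
  "controller_deadlock_avoiding C \<rho> \<longleftrightarrow>
     (\<forall>T \<in> plays C \<rho>. \<not> (\<exists>a. snoc C T a \<in> plays C \<rho>) \<longrightarrow>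
        (\<forall>u s. u \<in> T \<and> exec C u s \<longrightarrow> final_state C s))"

definition visits_losing :: "('p, 'a, 's) control_game \<Rightarrow> 'a trace \<Rightarrow> bool" where
  "visits_losing C T \<longleftrightarrow>
     (\<exists>v w s p. v @ w \<in> T \<and> exec C v s \<and> p \<in> procs C \<and> s p \<in> losing C p)"

definition winning_controller ::
  "('p, 'a, 's) control_game \<Rightarrow> ('p, 'a) controller \<Rightarrow> bool" where
  "winning_controller C \<rho> \<longleftrightarrow> controller C \<rho> \<and> controller_deadlock_avoiding C \<rho>
     \<and> (\<forall>T \<in> plays C \<rho>. \<not> visits_losing C T)"

section \<open>Petri games\<close>

text \<open>The flow relation is given by the presets and postsets of the transitions. Markings are sets of
  places: the nets occurring below (occurrence nets and the game built from a control game) are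
  1-bounded.\<close>

record ('q, 't) net =
  places :: "'q set"
  transitions :: "'t set"
  pre :: "'t \<Rightarrow> 'q set"
  post :: "'t \<Rightarrow> 'q set"
  init_marking :: "'q set"

record ('q, 't) petri_game = "('q, 't) net" +
  sys_places :: "'q set"
  env_places :: "'q set"
  bad_places :: "'q set"

definition place_post :: "('q, 't, 'z) net_scheme \<Rightarrow> 'q \<Rightarrow> 't set" where
  "place_post N q = {t \<in> transitions N. q \<in> pre N t}"

definition place_pre :: "('q, 't, 'z) net_scheme \<Rightarrow> 'q \<Rightarrow> 't set" where
  "place_pre N q = {t \<in> transitions N. q \<in> post N t}"

definition enabled :: "('q, 't, 'z) net_scheme \<Rightarrow> 'q set \<Rightarrow> 't \<Rightarrow> bool" where
  "enabled N M t \<longleftrightarrow> t \<in> transitions N \<and> pre N t \<subseteq> M"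

definition fire :: "('q, 't, 'z) net_scheme \<Rightarrow> 'q set \<Rightarrow> 't \<Rightarrow> 'q set" where
  "fire N M t = (M - pre N t) \<union> post N t"

definition final_marking :: "('q, 't, 'z) net_scheme \<Rightarrow> 'q set \<Rightarrow> bool" where
  "final_marking N M \<longleftrightarrow> \<not> (\<exists>t. enabled N M t)"

inductive_set reachable :: "('q, 't, 'z) net_scheme \<Rightarrow> 'q set set" for N where
  init: "init_marking N \<in> reachable N"
| fire: "M \<in> reachable N \<Longrightarrow> enabled N M t \<Longrightarrow> fire N M t \<in> reachable N"

subsection \<open>Branching processes\<close>

definition flow :: "('q, 't, 'z) net_scheme \<Rightarrow> (('q + 't) \<times> ('q + 't)) set" where
  "flow N = {(Inl q, Inr t) | q t. t \<in> transitions N \<and> q \<in> pre N t}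
          \<union> {(Inr t, Inl q) | q t. t \<in> transitions N \<and> q \<in> post N t}"

definition conflict :: "('q, 't, 'z) net_scheme \<Rightarrow> 'q + 't \<Rightarrow> 'q + 't \<Rightarrow> bool" where
  "conflict N x y \<longleftrightarrow> (\<exists>q \<in> places N. \<exists>t1 \<in> place_post N q. \<exists>t2 \<in> place_post N q.
     t1 \<noteq> t2 \<and> (Inr t1, x) \<in> (flow N)\<^sup>* \<and> (Inr t2, y) \<in> (flow N)\<^sup>*)"

definition concurrent :: "('q, 't, 'z) net_scheme \<Rightarrow> 'q + 't \<Rightarrow> 'q + 't \<Rightarrow> bool" where
  "concurrent N x y \<longleftrightarrow>
     (x, y) \<notin> (flow N)\<^sup>* \<and> (y, x) \<notin> (flow N)\<^sup>* \<and> \<not> conflict N x y"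

definition occurrence_net :: "('q, 't, 'z) net_scheme \<Rightarrow> bool" where
  "occurrence_net N \<longleftrightarrow>
     (\<forall>t \<in> transitions N. pre N t \<subseteq> places N \<and> post N t \<subseteq> places N)
     \<and> (\<forall>q \<in> places N. \<forall>t1 \<in> place_pre N q. \<forall>t2 \<in> place_pre N q. t1 = t2)
     \<and> wf (flow N)
     \<and> (\<forall>t \<in> transitions N. \<not> conflict N (Inr t) (Inr t))
     \<and> init_marking N = {q \<in> places N. place_pre N q = {}}"

record ('q, 'u, 'x, 'y) branching_process = "('q, 'u) net" +
  plab :: "'q \<Rightarrow> 'x"
  tlab :: "'u \<Rightarrow> 'y"

definition branching_process_of ::
  "('x, 'y, 'z) net_scheme \<Rightarrow> ('q, 'u, 'x, 'y) branching_process \<Rightarrow> bool" where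
  "branching_process_of N \<sigma> \<longleftrightarrow> occurrence_net \<sigma>
     \<and> plab \<sigma> ` places \<sigma> \<subseteq> places N
     \<and> tlab \<sigma> ` transitions \<sigma> \<subseteq> transitions N
     \<and> (\<forall>t \<in> transitions \<sigma>. bij_betw (plab \<sigma>) (pre \<sigma> t) (pre N (tlab \<sigma> t)))
     \<and> (\<forall>t \<in> transitions \<sigma>. bij_betw (plab \<sigma>) (post \<sigma> t) (post N (tlab \<sigma> t)))
     \<and> bij_betw (plab \<sigma>) (init_marking \<sigma>) (init_marking N)
     \<and> (\<forall>t1 \<in> transitions \<sigma>. \<forall>t2 \<in> transitions \<sigma>.
          pre \<sigma> t1 = pre \<sigma> t2 \<and> tlab \<sigma> t1 = tlab \<sigma> t2 \<longrightarrow> t1 = t2)"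

subsection \<open>Strategies\<close>

definition justified_refusal ::
  "('x, 'y) petri_game \<Rightarrow> ('q, 'u, 'x, 'y) branching_process \<Rightarrow> bool" where
  "justified_refusal G \<sigma> \<longleftrightarrow>
     (\<forall>D t. D \<subseteq> places \<sigma>
        \<and> (\<forall>q \<in> D. \<forall>q' \<in> D. q \<noteq> q' \<longrightarrow> concurrent \<sigma> (Inl q) (Inl q'))
        \<and> t \<in> transitions G \<and> plab \<sigma> ` D = pre G t \<longrightarrow>
        (\<exists>t' \<in> transitions \<sigma>. tlab \<sigma> t' = t \<and> pre \<sigma> t' = D)
        \<or> (\<exists>q \<in> D. plab \<sigma> q \<in> sys_places G \<and> t \<notin> tlab \<sigma> ` place_post \<sigma> q))"

definition strategy ::
  "('x, 'y) petri_game \<Rightarrow> ('q, 'u, 'x, 'y) branching_process \<Rightarrow> bool" where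
  "strategy G \<sigma> \<longleftrightarrow> branching_process_of G \<sigma> \<and> justified_refusal G \<sigma>"

definition strategy_deadlock_avoiding ::
  "('x, 'y) petri_game \<Rightarrow> ('q, 'u, 'x, 'y) branching_process \<Rightarrow> bool" where
  "strategy_deadlock_avoiding G \<sigma> \<longleftrightarrow>
     (\<forall>M \<in> reachable \<sigma>. final_marking \<sigma> M \<longrightarrow> final_marking G (plab \<sigma> ` M))"

definition winning_strategy ::
  "('x, 'y) petri_game \<Rightarrow> ('q, 'u, 'x, 'y) branching_process \<Rightarrow> bool" where
  "winning_strategy G \<sigma> \<longleftrightarrow> strategy G \<sigma> \<and> strategy_deadlock_avoiding G \<sigma>
     \<and> (\<forall>M \<in> reachable \<sigma>. \<forall>q \<in> M. plab \<sigma> q \<notin> bad_places G)"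

text \<open>Committing means choosing one commitment set, i.e. having exactly one outgoing transition. If a
  strategy may keep several commitments open at one place, a bisimilar controller need not exist: with
  one process, one state \<open>s\<close>, and controllable self-loops \<open>a\<close> and \<open>b\<close>, the strategy that offers both
  \<open>{a}\<close> and \<open>{b}\<close> at every occurrence of \<open>s\<close> is winning, but a bisimulation would have to relate the
  markings after either choice to the same play.\<close>

definition always_commits ::
  "('x, 'y) petri_game \<Rightarrow> ('q, 'u, 'x, 'y) branching_process \<Rightarrow> bool" where
  "always_commits G \<sigma> \<longleftrightarrow>
     (\<forall>q \<in> places \<sigma>. plab \<sigma> q \<in> sys_places G \<longrightarrow> (\<exists>!t. t \<in> place_post \<sigma> q))"

section \<open>The Petri game of a control game\<close>

datatype ('p, 'a, 's) gplace = Sys 's | Env 's "'a set" | Bot 'p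

text \<open>In \<open>Act a B A\<close>, \<open>B\<close> is kept as a tuple in the domain of \<open>\<delta>\<^sub>a\<close>; its set of local states is
  \<open>B ` dmn C a\<close>, which determines \<open>B\<close> because the local state sets are disjoint. The family \<open>A\<close> is an
  extensional function on this set.\<close>

datatype ('p, 'a, 's) gtrans =
    Act 'a "'p \<Rightarrow> 's" "'s \<Rightarrow> 'a set"
  | Tau 's "'a set"
  | DL "('p, 'a, 's) gplace set"

definition en :: "('p, 'a, 's) control_game \<Rightarrow> 's \<Rightarrow> 'a set" where
  "en C s = {a \<in> acts C. \<exists>B. delta C a B \<noteq> None \<and> s \<in> B ` dmn C a}"

definition commitments :: "('p, 'a, 's) control_game \<Rightarrow> 's \<Rightarrow> 'a set set" where
  "commitments C s = Pow (en C s \<inter> sys_acts C)"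

definition all_lstates :: "('p, 'a, 's) control_game \<Rightarrow> 's set" where
  "all_lstates C = (\<Union>p \<in> procs C. lstates C p)"

definition env_trans :: "('p, 'a, 's) control_game \<Rightarrow> ('p, 'a, 's) gtrans set" where
  "env_trans C = {Act a B A | a B A. a \<in> env_acts C \<and> delta C a B \<noteq> None
     \<and> A \<in> PiE (B ` dmn C a) (commitments C)}"

definition sys_trans :: "('p, 'a, 's) control_game \<Rightarrow> ('p, 'a, 's) gtrans set" where
  "sys_trans C = {Act a B A | a B A. a \<in> sys_acts C \<and> delta C a B \<noteq> None
     \<and> A \<in> PiE (B ` dmn C a) (commitments C) \<and> (\<forall>s \<in> B ` dmn C a. a \<in> A s)}"

definition tau_trans :: "('p, 'a, 's) control_game \<Rightarrow> ('p, 'a, 's) gtrans set" where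
  "tau_trans C = {Tau s A | s A. s \<in> all_lstates C \<and> A \<in> commitments C s}"

primrec gpre :: "('p, 'a, 's) control_game \<Rightarrow> ('p, 'a, 's) gtrans \<Rightarrow> ('p, 'a, 's) gplace set" where
  "gpre C (Act a B A) = (\<lambda>s. Env s (A s)) ` B ` dmn C a"
| "gpre C (Tau s A) = {Sys s}"
| "gpre C (DL M) = M"

primrec gpost :: "('p, 'a, 's) control_game \<Rightarrow> ('p, 'a, 's) gtrans \<Rightarrow> ('p, 'a, 's) gplace set" where
  "gpost C (Act a B A) = Sys ` the (delta C a B) ` dmn C a"
| "gpost C (Tau s A) = {Env s A}"
| "gpost C (DL M) = Bot ` procs C"

definition commitment_places :: "('p, 'a, 's) control_game \<Rightarrow> ('p, 'a, 's) gplace set" where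
  "commitment_places C = {Env s A | s A. s \<in> all_lstates C \<and> A \<in> commitments C s}"

text \<open>The game without the deadlock transitions and the \<open>\<bottom>\<close>-places.\<close>

definition base_game ::
  "('p, 'a, 's) control_game \<Rightarrow> (('p, 'a, 's) gplace, ('p, 'a, 's) gtrans) petri_game" where
  "base_game C = \<lparr>
     places = Sys ` all_lstates C \<union> commitment_places C,
     transitions = env_trans C \<union> sys_trans C \<union> tau_trans C,
     pre = gpre C,
     post = gpost C,
     init_marking = Sys ` init_state C ` procs C,
     sys_places = Sys ` all_lstates C,
     env_places = commitment_places C,
     bad_places = Sys ` (\<Union>p \<in> procs C. losing C p) \<rparr>"

primrec (nonexhaustive) zeta :: "('p, 'a, 's) gplace \<Rightarrow> 's" where
  "zeta (Sys s) = s"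
| "zeta (Env s A) = s"

definition deadlock_markings :: "('p, 'a, 's) control_game \<Rightarrow> ('p, 'a, 's) gplace set set" where
  "deadlock_markings C = {M \<in> reachable (base_game C).
     M \<subseteq> env_places (base_game C) \<and> final_marking (base_game C) M
     \<and> (\<exists>s \<in> global_states C. s ` procs C = zeta ` M \<and> \<not> final_state C s)}"

definition game_of ::
  "('p, 'a, 's) control_game \<Rightarrow> (('p, 'a, 's) gplace, ('p, 'a, 's) gtrans) petri_game" where
  "game_of C = \<lparr>
     places = Sys ` all_lstates C \<union> commitment_places C \<union> Bot ` procs C,
     transitions = env_trans C \<union> sys_trans C \<union> tau_trans C \<union> DL ` deadlock_markings C,
     pre = gpre C,
     post = gpost C,
     init_marking = Sys ` init_state C ` procs C,
     sys_places = Sys ` all_lstates C,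
     env_places = commitment_places C \<union> Bot ` procs C,
     bad_places = Sys ` (\<Union>p \<in> procs C. losing C p) \<union> Bot ` procs C \<rparr>"

section \<open>Strategy-equivalence\<close>

primrec obs :: "('p, 'a, 's) gtrans \<Rightarrow> 'a option" where
  "obs (Act a B A) = Some a"
| "obs (Tau s A) = None"
| "obs (DL M) = None"

definition obs_step ::
  "('q, 'u, 'x, ('p, 'a, 's) gtrans) branching_process \<Rightarrow> 'a option \<Rightarrow> 'q set \<Rightarrow> 'q set \<Rightarrow> bool"
  where
  "obs_step \<sigma> l M M' \<longleftrightarrow> (\<exists>t. enabled \<sigma> M t \<and> obs (tlab \<sigma> t) = l \<and> M' = fire \<sigma> M t)"

definition weak_step ::
  "('q, 'u, 'x, ('p, 'a, 's) gtrans) branching_process \<Rightarrow> 'a \<Rightarrow> 'q set \<Rightarrow> 'q set \<Rightarrow> bool" where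
  "weak_step \<sigma> a = (obs_step \<sigma> None)\<^sup>*\<^sup>* OO obs_step \<sigma> (Some a) OO (obs_step \<sigma> None)\<^sup>*\<^sup>*"

text \<open>All actions of the control game are observable, so \<open>u \<tau>\<^sup>* a \<tau>\<^sup>*\<close> is \<open>u a\<close>, \<open>u \<tau>\<^sup>*\<close> is \<open>u\<close>, and the
  clause for an internal step on the side of the control game is void.\<close>

definition bisimilar ::
  "('p, 'a, 's) control_game \<Rightarrow> ('q, 'u, 'x, ('p, 'a, 's) gtrans) branching_process
     \<Rightarrow> ('p, 'a) controller \<Rightarrow> bool" where
  "bisimilar C \<sigma> \<rho> \<longleftrightarrow> (\<exists>R. R \<subseteq> reachable \<sigma> \<times> plays C \<rho>
     \<and> (init_marking \<sigma>, trace C []) \<in> R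
     \<and> (\<forall>M T a M'. (M, T) \<in> R \<and> obs_step \<sigma> (Some a) M M' \<longrightarrow>
          snoc C T a \<in> plays C \<rho> \<and> (M', snoc C T a) \<in> R)
     \<and> (\<forall>M T M'. (M, T) \<in> R \<and> obs_step \<sigma> None M M' \<longrightarrow> (M', T) \<in> R)
     \<and> (\<forall>M T a. (M, T) \<in> R \<and> snoc C T a \<in> plays C \<rho> \<longrightarrow>
          (\<exists>M'. weak_step \<sigma> a M M' \<and> (M', snoc C T a) \<in> R)))"

text \<open>Strategy-equivalence with respect to the strategies that always commit. Strategies given are
  over arbitrary types \<open>'q\<close> and \<open>'u\<close> of nodes; strategies claimed to exist have natural numbers as
  nodes (branching processes of a finite net are countable).\<close>

definition strategy_equivalent_committing ::
  "'q itself \<Rightarrow> 'u itself \<Rightarrow> ('p, 'a, 's) control_game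
     \<Rightarrow> ('x, ('p, 'a, 's) gtrans) petri_game \<Rightarrow> bool" where
  "strategy_equivalent_committing _ _ C G \<longleftrightarrow>
     (\<forall>\<sigma> :: ('q, 'u, 'x, ('p, 'a, 's) gtrans) branching_process.
        winning_strategy G \<sigma> \<and> always_commits G \<sigma> \<longrightarrow>
        (\<exists>\<rho>. winning_controller C \<rho> \<and> bisimilar C \<sigma> \<rho>))
     \<and> (\<forall>\<rho>. winning_controller C \<rho> \<longrightarrow>
        (\<exists>\<sigma> :: (nat, nat, 'x, ('p, 'a, 's) gtrans) branching_process.
           winning_strategy G \<sigma> \<and> always_commits G \<sigma> \<and> bisimilar C \<sigma> \<rho>))"

end

theory Submission
  imports Defs "HOL-Library.Countable_Set"
begin

text \<open>
  Up to the internal commitment transitions, the reachable markings of a committing strategy are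
  cuts holding one place per process, and a cut is determined by the play leading to it. The place of
  process \<open>p\<close> in the cut does not change under actions outside \<open>\<Sigma>\<^sub>p\<close>, so it depends only on the view
  of \<open>p\<close>, and its unique commitment set serves as the controller's choice. A deadlock of this
  controller in a non-final state would be a marking in \<open>\<DD>\<^sub>D\<^sub>L\<close>: its deadlock transition is enabled
  in the game although the marking is final in the strategy, which is deadlock-avoiding.

  Conversely, a controller is unfolded into a net whose places are pairs of a process and one of its
  views. An event is determined by its preset because the joint past of several processes is
  determined by their views: every projection of the joint past is the longest among the
  projections of the views. Justified refusal rests on the fact that a finite set of pairwise
  concurrent places of an occurrence net is contained in a reachable marking.
\<close>

section \<open>Traces\<close>

text \<open>Plays are traces, but states and controlled moves are followed along words, so each
  notion is handled on words and transferred by its invariance under commutation. The definition of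
  a view as a shortest trace resists induction; it is replaced by \<open>past C {p}\<close>,
  computed by scanning a word backwards. The scan must carry a whole set of processes, since an
  action merges the pasts of all its participants. Commitments are invisible and may happen early or
  late, so one play corresponds to many markings. In both directions a marking is therefore
  described by a play together with the set \<open>Q\<close> of processes that have already
  committed, and the bisimulation relates every such marking to the same play. Deadlock transitions
  must be excluded twice, for opposite reasons: a given winning strategy cannot contain a reachable
  one because it would produce bad places, while the unfolded controller never enables one because
  it always leaves an event enabled in a non-final state. For the unfolded net, absence of
  self-conflict is not read off the construction: every transition is shown to be enabled in some
  reachable marking, and the theory of configurations yields the rest.\<close>

lemma commute_append: "commute C u v \<Longrightarrow> commute C (x @ u @ y) (x @ v @ y)"
proof (induction rule: commute.induct)
  case (1 a b u v)
  then show ?case using commute.intros[of C a b "x @ u" "v @ y"] by simp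
qed

lemma commute_sym: "commute C u v \<Longrightarrow> commute C v u"
  by (induction rule: commute.induct) (metis commute.intros inf_commute)

lemma trace_eq_refl [simp]: "trace_eq C u u"
  by (simp add: trace_eq_def)

lemma trace_eq_trans: "trace_eq C u v \<Longrightarrow> trace_eq C v w \<Longrightarrow> trace_eq C u w"
  unfolding trace_eq_def by (rule rtranclp_trans)

lemma trace_eq_sym: "trace_eq C u v \<Longrightarrow> trace_eq C v u"
  unfolding trace_eq_def
  by (induction rule: rtranclp_induct) (auto intro: converse_rtranclp_into_rtranclp commute_sym)

lemma trace_eq_append: "trace_eq C u v \<Longrightarrow> trace_eq C (x @ u @ y) (x @ v @ y)"
  unfolding trace_eq_def
proof (induction rule: rtranclp_induct)
  case (step v w)
  then show ?case by (meson commute_append rtranclp.rtrancl_into_rtrancl)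
qed simp

lemma trace_eq_snoc: "trace_eq C u v \<Longrightarrow> trace_eq C (u @ [a]) (v @ [a])"
  using trace_eq_append[of C u v "[]" "[a]"] by simp

lemma commute_imp_trace_eq: "commute C u v \<Longrightarrow> trace_eq C u v"
  unfolding trace_eq_def by blast

lemma trace_eq_closed:
  assumes "trace_eq C u v" and "P u" and "\<And>u v. commute C u v \<Longrightarrow> P u \<Longrightarrow> P v"
  shows "P v"
  using assms(1,2) unfolding trace_eq_def
  by (induction rule: rtranclp_induct) (auto intro: assms(3))

lemma trace_eq_iff: "trace C u = trace C v \<longleftrightarrow> trace_eq C u v"
  unfolding trace_def using trace_eq_refl trace_eq_sym trace_eq_trans by blast

lemma mem_trace: "v \<in> trace C u \<longleftrightarrow> trace_eq C u v"
  by (simp add: trace_def)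

lemma snoc_trace: "snoc C (trace C u) a = trace C (u @ [a])"
proof -
  have "trace C (v @ [a]) = trace C (u @ [a])" if "v \<in> trace C u" for v
    using that trace_eq_snoc trace_eq_sym by (metis mem_trace trace_eq_iff)
  moreover have "u \<in> trace C u" by (simp add: mem_trace)
  ultimately show ?thesis unfolding snoc_def by blast
qed

lemma trace_eq_set: "trace_eq C u v \<Longrightarrow> set u = set v"
  by (erule trace_eq_closed) (auto elim!: commute.cases)

lemma trace_eq_length: "trace_eq C u v \<Longrightarrow> length u = length v"
  by (erule trace_eq_closed) (auto elim!: commute.cases)

section \<open>Projections of words to single processes\<close>

definition proj :: "('p, 'a, 's) control_game \<Rightarrow> 'p \<Rightarrow> 'a list \<Rightarrow> 'a list" where
  "proj C p = filter (\<lambda>a. p \<in> dmn C a)"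

lemma proj_Nil [simp]: "proj C p [] = []"
  by (simp add: proj_def)

lemma proj_append [simp]: "proj C p (u @ v) = proj C p u @ proj C p v"
  by (simp add: proj_def)

lemma proj_Cons: "proj C p (a # u) = (if p \<in> dmn C a then [a] else []) @ proj C p u"
  by (simp add: proj_def)

lemma proj_empty_iff: "proj C p u = [] \<longleftrightarrow> (\<forall>a\<in>set u. p \<notin> dmn C a)"
  by (simp add: proj_def filter_empty_conv)

lemma trace_eq_proj: "trace_eq C u v \<Longrightarrow> proj C p u = proj C p v"
  by (erule trace_eq_closed) (auto elim!: commute.cases simp: proj_Cons)

text \<open>\<open>past C D u\<close> consists of the letters of \<open>u\<close> that causally precede the current states of the
  processes in \<open>D\<close>, and \<open>rest C D u\<close> of the others.\<close>

primrec past_rev :: "('p, 'a, 's) control_game \<Rightarrow> 'a list \<Rightarrow> 'p set \<Rightarrow> 'a list" where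
  "past_rev C [] D = []"
| "past_rev C (a # u) D =
     (if dmn C a \<inter> D = {} then past_rev C u D else past_rev C u (D \<union> dmn C a) @ [a])"

primrec rest_rev :: "('p, 'a, 's) control_game \<Rightarrow> 'a list \<Rightarrow> 'p set \<Rightarrow> 'a list" where
  "rest_rev C [] D = []"
| "rest_rev C (a # u) D =
     (if dmn C a \<inter> D = {} then rest_rev C u D @ [a] else rest_rev C u (D \<union> dmn C a))"

definition past :: "('p, 'a, 's) control_game \<Rightarrow> 'p set \<Rightarrow> 'a list \<Rightarrow> 'a list" where
  "past C D u = past_rev C (rev u) D"

definition rest :: "('p, 'a, 's) control_game \<Rightarrow> 'p set \<Rightarrow> 'a list \<Rightarrow> 'a list" where
  "rest C D u = rest_rev C (rev u) D"

lemma past_Nil [simp]: "past C D [] = []"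
  by (simp add: past_def)

text \<open>The scan runs from the right because a letter belongs to the past of \<open>D\<close>
  exactly if it meets \<open>D\<close> or the domain of a later letter of that past;
  \<open>D\<close> accumulates these domains.\<close>

lemma past_snoc: "past C D (u @ [a]) =
    (if dmn C a \<inter> D = {} then past C D u else past C (D \<union> dmn C a) u @ [a])"
  by (simp add: past_def)

lemma rest_Nil [simp]: "rest C D [] = []"
  by (simp add: rest_def)

lemma rest_snoc: "rest C D (u @ [a]) =
    (if dmn C a \<inter> D = {} then rest C D u @ [a] else rest C (D \<union> dmn C a) u)"
  by (simp add: rest_def)

text \<open>The link between views and joint pasts: as \<open>p\<close> takes part in
  \<open>a\<close>, enlarging \<open>{p}\<close> by \<open>dmn C a\<close> gives
  \<open>dmn C a\<close> itself. So an action leaves all its participants with the same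
  view.\<close>

lemma past_singleton_snoc:
  "p \<in> dmn C a \<Longrightarrow> past C {p} (u @ [a]) = past C (dmn C a) u @ [a]"
  "p \<notin> dmn C a \<Longrightarrow> past C {p} (u @ [a]) = past C {p} u"
  by (auto simp: past_snoc insert_absorb)

text \<open>The accumulated set only grows during the scan, so a letter disjoint from it is disjoint
  from the original \<open>D\<close>.\<close>

lemma rest_indep: "a \<in> set (rest C D u) \<Longrightarrow> dmn C a \<inter> D = {}"
  by (induction u arbitrary: D rule: rev_induct) (auto simp: rest_snoc split: if_splits)

lemma set_past_rest: "set (past C D u) \<union> set (rest C D u) = set u"
  by (induction u arbitrary: D rule: rev_induct) (auto simp: past_snoc rest_snoc)

lemma set_past: "set (past C D u) \<subseteq> set u"
  using set_past_rest[of C D u] by blast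

lemma proj_rest: "p \<in> D \<Longrightarrow> proj C p (rest C D u) = []"
  unfolding proj_empty_iff using rest_indep by fastforce

text \<open>Once a letter of \<open>p\<close> enters the past, \<open>p\<close> is in the
  accumulated set, and no earlier letter of \<open>p\<close> can be put into the rest. Hence on each
  process the past is a prefix.\<close>

lemma proj_past_rest: "proj C p (past C D u) @ proj C p (rest C D u) = proj C p u"
proof (induction u arbitrary: D rule: rev_induct)
  case (snoc a u)
  show ?case
  proof (cases "dmn C a \<inter> D = {}")
    case True
    then show ?thesis using snoc[of D] by (simp add: past_snoc rest_snoc flip: append_assoc)
  next
    case False
    then show ?thesis using snoc[of "D \<union> dmn C a"] proj_rest[of p "D \<union> dmn C a" C u]
      by (auto simp: past_snoc rest_snoc proj_Cons)
  qed
qed simp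

lemma proj_past: "p \<in> D \<Longrightarrow> proj C p (past C D u) = proj C p u"
  using proj_past_rest[of C p D u] proj_rest[of p D C u] by simp

lemma length_proj_past: "length (proj C p (past C D u)) \<le> length (proj C p u)"
  using arg_cong[OF proj_past_rest[of C p D u], of length] by simp

lemma past_append:
  "\<forall>a\<in>set w. dmn C a \<inter> D = {} \<Longrightarrow> past C D (u @ w) = past C D u"
proof (induction w rule: rev_induct)
  case (snoc a w)
  then show ?case by (simp add: past_snoc flip: append_assoc)
qed simp

lemma length_past: "length (past C D u) \<le> length u"
  by (induction u arbitrary: D rule: rev_induct) (auto simp: past_snoc le_SucI)

text \<open>A skipped letter is never regained, so equal length means that nothing was skipped. This
  turns minimality of length into equality when views are identified.\<close>

lemma past_eq_self: "length (past C D u) = length u \<Longrightarrow> past C D u = u"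
proof (induction u arbitrary: D rule: rev_induct)
  case (snoc a u)
  then show ?case using length_past[of C D u] by (auto simp: past_snoc split: if_splits)
qed simp

text \<open>The second of the two swapped letters to be scanned is tested against \<open>D\<close>,
  possibly enlarged by the domain of the other; by independence the enlargement does not change the
  outcome.\<close>

lemma commute_past: "commute C u v \<Longrightarrow> trace_eq C (past C D u) (past C D v)"
proof (induction arbitrary: D rule: commute.induct)
  case (1 a b u v)
  show ?case
  proof (induction v arbitrary: D rule: rev_induct)
    case Nil
    have swap: "trace_eq C (w @ [a, b]) (w @ [b, a])" for w
      using commute.intros[OF 1, of w "[]"] by (simp add: commute_imp_trace_eq)
    have *: "u @ [a, b] = (u @ [a]) @ [b]" "u @ [b, a] = (u @ [b]) @ [a]" by auto
    have "dmn C a \<inter> (D \<union> dmn C b) = dmn C a \<inter> D" "dmn C b \<inter> (D \<union> dmn C a) = dmn C b \<inter> D"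
      using 1 by auto
    then show ?case
      using swap[of "past C (D \<union> dmn C a \<union> dmn C b) u"]
      by (simp only: * past_snoc append_Nil2) (auto simp: Un_ac)
  next
    case (snoc x v)
    then show ?case
      by (auto simp only: append_assoc[symmetric] past_snoc intro: trace_eq_snoc split: if_split)
  qed
qed

lemma trace_eq_past: "trace_eq C u v \<Longrightarrow> trace_eq C (past C D u) (past C D v)"
  by (erule trace_eq_closed) (auto intro: commute_past trace_eq_trans)

text \<open>The arguments will be prefixes of one projection \<open>proj C q u\<close>, so their
  lengths decide and a tie is harmless.\<close>

definition longer :: "'a list \<Rightarrow> 'a list \<Rightarrow> 'a list" where
  "longer xs ys = (if length xs < length ys then ys else xs)"

text \<open>The past of a union is the union of the pasts, and on a fixed process both are prefixes
  of the same word. Both sets are generalised in the induction because a letter may enlarge either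
  one.\<close>

lemma proj_past_Un:
  "proj C q (past C (D \<union> D') u) = longer (proj C q (past C D u)) (proj C q (past C D' u))"
proof (induction u arbitrary: D D' rule: rev_induct)
  case Nil
  then show ?case by (simp add: longer_def)
next
  case (snoc a u)
  note le = length_proj_past[of C q _ u]
  consider "dmn C a \<inter> D = {}" "dmn C a \<inter> D' = {}" | "dmn C a \<inter> D \<noteq> {}" "dmn C a \<inter> D' = {}"
    | "dmn C a \<inter> D = {}" "dmn C a \<inter> D' \<noteq> {}" | "dmn C a \<inter> D \<noteq> {}" "dmn C a \<inter> D' \<noteq> {}"
    by blast
  then show ?case
  proof cases
    case 1
    then show ?thesis using snoc[of D D'] by (simp add: past_snoc Int_Un_distrib)
  next
    case 2
    \<comment> \<open>If \<open>q\<close> takes part in \<open>a\<close>, the past of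
      \<open>D \<union> dmn C a\<close> already has all of \<open>proj C q u\<close>, so the
      contribution of \<open>D'\<close> cannot be longer.\<close>
    have *: "D \<union> D' \<union> dmn C a = D \<union> dmn C a \<union> D'" by blast
    show ?thesis using 2 snoc[of "D \<union> dmn C a" D'] le[of D']
      by (auto simp: past_snoc Int_Un_distrib * proj_Cons longer_def proj_past)
  next
    case 3
    have *: "D \<union> D' \<union> dmn C a = D \<union> (D' \<union> dmn C a)" by blast
    show ?thesis using 3 snoc[of D "D' \<union> dmn C a"] le[of D]
      by (auto simp: past_snoc Int_Un_distrib * proj_Cons longer_def proj_past)
  next
    case 4
    have *: "D \<union> D' \<union> dmn C a = (D \<union> dmn C a) \<union> (D' \<union> dmn C a)" by blast
    show ?thesis using 4 snoc[of "D \<union> dmn C a" "D' \<union> dmn C a"]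
      by (auto simp: past_snoc Int_Un_distrib * proj_Cons longer_def)
  qed
qed

section \<open>Traces determined by their projections; views as pasts\<close>

context control_game
begin

lemma trace_eq_move_last:
  assumes "\<forall>b\<in>set w. dmn C b \<inter> dmn C a = {}"
  shows "trace_eq C (u @ a # w) (u @ w @ [a])"
  using assms
proof (induction w arbitrary: u)
  case (Cons b w)
  have "trace_eq C (u @ a # b # w) (u @ b # a # w)"
    using commute.intros[of C a b u w] Cons.prems by (auto intro!: commute_imp_trace_eq)
  moreover have "trace_eq C ((u @ [b]) @ a # w) ((u @ [b]) @ w @ [a])"
    using Cons by (intro Cons.IH) auto
  ultimately show ?case using trace_eq_trans by fastforce
qed simp

text \<open>The last letter of \<open>u\<close> is cancelled against its last occurrence in
  \<open>v\<close>, which can be moved to the end. Nonempty domains make every letter visible in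
  some projection.\<close>

lemma trace_eqI:
  assumes "set u \<subseteq> acts C" "set v \<subseteq> acts C" "\<And>p. proj C p u = proj C p v"
  shows "trace_eq C u v"
  using assms
proof (induction u arbitrary: v rule: rev_induct)
  case Nil
  have "v = []"
  proof (rule ccontr)
    assume "v \<noteq> []"
    then obtain b where b: "b \<in> set v" by (meson last_in_set)
    then obtain p where "p \<in> dmn C b" using Nil dmn_nonempty by blast
    then show False using Nil(3)[of p] b proj_empty_iff[of C p v] by (metis proj_Nil)
  qed
  then show ?case by simp
next
  case (snoc a u)
  then obtain p where p: "p \<in> dmn C a" using dmn_nonempty by fastforce
  have "a \<in> set v"
    using snoc.prems(3)[of p] p by (auto simp: proj_Cons proj_def dest!: arg_cong[where f = set])
  then obtain v1 v2 where v: "v = v1 @ a # v2" and nin: "a \<notin> set v2"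
    using split_list_last by metis
  \<comment> \<open>On a process of \<open>a\<close> both projections end with \<open>a\<close>; as
    \<open>v2\<close> contains no \<open>a\<close>, it has no letter of this process at all.\<close>
  have v2: "proj C q v2 = []" if "q \<in> dmn C a" for q
  proof (rule ccontr)
    assume ne: "proj C q v2 \<noteq> []"
    have "proj C q u @ [a] = proj C q v1 @ a # proj C q v2"
      using snoc.prems(3)[of q] that by (simp add: v proj_Cons)
    then have "last (proj C q v2) = a"
      using ne by (metis last_ConsR last_appendR last_snoc list.distinct(1))
    then show False using ne nin last_in_set[OF ne] by (auto simp: proj_def)
  qed
  have indep: "\<forall>b\<in>set v2. dmn C b \<inter> dmn C a = {}"
    using v2 by (auto simp: proj_empty_iff)
  have "trace_eq C u (v1 @ v2)"
  proof (rule snoc.IH)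
    fix q show "proj C q u = proj C q (v1 @ v2)"
      using snoc.prems(3)[of q] v2[of q] by (auto simp: v proj_Cons split: if_splits)
  qed (use snoc.prems v in auto)
  then have "trace_eq C (u @ [a]) (v1 @ v2 @ [a])"
    using trace_eq_snoc by fastforce
  then show ?case
    using trace_eq_move_last[OF indep, of v1] trace_eq_trans trace_eq_sym v by blast
qed

lemma trace_eq_cancel:
  assumes "trace_eq C (u @ [a]) (v @ [a])" "set (u @ [a]) \<subseteq> acts C"
  shows "trace_eq C u v"
proof (rule trace_eqI)
  show "set u \<subseteq> acts C" "set v \<subseteq> acts C"
    using assms(2) trace_eq_set[OF assms(1)] by auto
  show "proj C p u = proj C p v" for p
    using trace_eq_proj[OF assms(1), of p] by (simp add: proj_Cons)
qed

lemma trace_eq_past_rest: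
  "set u \<subseteq> acts C \<Longrightarrow> trace_eq C u (past C D u @ rest C D u)"
  using set_past_rest[of C D u] by (intro trace_eqI) (auto simp: proj_past_rest)

text \<open>What lies outside the past of \<open>D\<close> avoids \<open>p\<close>, so the scan for
  \<open>{p}\<close> skips it after it has been moved to the end.\<close>

lemma past_of_past:
  assumes "set u \<subseteq> acts C" "p \<in> D"
  shows "trace_eq C (past C {p} (past C D u)) (past C {p} u)"
proof -
  have "past C {p} (past C D u @ rest C D u) = past C {p} (past C D u)"
    using rest_indep[of _ C D u] assms(2) by (intro past_append) blast
  then show ?thesis
    using trace_eq_past[OF trace_eq_past_rest[OF assms(1)], of "{p}" D] trace_eq_sym by metis
qed

text \<open>Every admissible decomposition \<open>v @ w\<close> has the same past of
  \<open>{p}\<close> as \<open>u\<close>, up to trace equivalence, since \<open>w\<close> avoids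
  \<open>p\<close>. No such \<open>v\<close> is shorter than this past, and the past itself is
  admissible.\<close>

lemma view_trace:
  assumes u: "set u \<subseteq> acts C"
  shows "view C p (trace C u) = trace C (past C {p} u)"
proof -
  define P where "P v \<longleftrightarrow> (\<exists>w. v @ w \<in> trace C u \<and> set w \<inter> acts_of C p = {})" for v
  define v where "v = (ARG_MIN length v. P v)"
  have "P (past C {p} u)"
    using trace_eq_past_rest[OF u, of "{p}"] rest_indep[of _ C "{p}" u]
    by (fastforce simp: P_def mem_trace acts_of_def)
  then have "P v" and le: "length v \<le> length (past C {p} u)"
    unfolding v_def by (rule arg_min_natI, rule arg_min_nat_le)
  then obtain w where w: "trace_eq C u (v @ w)" "set w \<inter> acts_of C p = {}"
    by (auto simp: P_def mem_trace)
  then have "past C {p} (v @ w) = past C {p} v"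
    using u trace_eq_set[OF w(1)] by (intro past_append) (auto simp: acts_of_def)
  then have eq: "trace_eq C (past C {p} u) (past C {p} v)"
    using trace_eq_past[OF w(1), of "{p}"] by simp
  \<comment> \<open>Minimality gives that \<open>v\<close> is at most as long as the past of
    \<open>u\<close>, which has the length of the past of \<open>v\<close>; so \<open>v\<close>
    coincides with its own past.\<close>
  then have "past C {p} v = v"
    using le trace_eq_length[OF eq] length_past[of C "{p}" v] by (intro past_eq_self) simp
  then show ?thesis
    using eq unfolding view_def P_def[symmetric] v_def[symmetric] trace_eq_iff
    by (simp add: trace_eq_sym)
qed

text \<open>Every projection of the past of \<open>D\<close> is the longest of the projections of the pasts of its
  elements.\<close>

lemma past_determined_by_views:
  assumes D: "finite D" "D \<noteq> {}" and "set u \<subseteq> acts C" "set v \<subseteq> acts C"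
    and "\<And>p. p \<in> D \<Longrightarrow> trace_eq C (past C {p} u) (past C {p} v)"
  shows "trace_eq C (past C D u) (past C D v)"
proof (rule trace_eqI)
  fix q
  show "proj C q (past C D u) = proj C q (past C D v)"
    using D assms(5)
  proof (induction D rule: finite_ne_induct)
    case (insert p D)
    then show ?case
      using proj_past_Un[of C q "{p}" D] trace_eq_proj[of C "past C {p} u" "past C {p} v" q]
      by simp
  qed (auto intro: trace_eq_proj)
qed (use assms set_past_rest[of C D] in blast)+

end

section \<open>Executions and controlled plays\<close>

lemma exec_snoc_iff: "exec C (u @ [a]) s' \<longleftrightarrow> (\<exists>s. exec C u s \<and> step C s a s')"
  by (auto elim: exec.cases intro: exec_snoc)

lemma exec_acts: "exec C u s \<Longrightarrow> set u \<subseteq> acts C"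
  by (induction rule: exec.induct) (auto simp: step_def)

lemma step_outside: "step C s a s' \<Longrightarrow> p \<notin> dmn C a \<Longrightarrow> s' p = s p"
  unfolding step_def global_states_def by (metis DiffI PiE_E)

lemma step_delta:
  "step C s a s' \<Longrightarrow> delta C a (restrict s (dmn C a)) = Some (restrict s' (dmn C a))"
  by (simp add: step_def)

lemma step_determ:
  assumes "step C s a s'" "step C s a s''" shows "s' = s''"
proof
  fix p
  show "s' p = s'' p"
  proof (cases "p \<in> dmn C a")
    case True
    then show ?thesis using step_delta[OF assms(1)] step_delta[OF assms(2)]
      by (metis option.inject restrict_apply')
  qed (use assms step_outside in metis)
qed

lemma exec_determ: "exec C u s \<Longrightarrow> exec C u s' \<Longrightarrow> s = s'"
proof (induction u arbitrary: s s' rule: rev_induct)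
  case Nil
  then show ?case by (auto elim: exec.cases)
qed (metis exec_snoc_iff step_determ)

lemma exec_append_outside:
  "exec C (u @ w) s' \<Longrightarrow> exec C u s \<Longrightarrow> \<forall>a\<in>set w. p \<notin> dmn C a \<Longrightarrow> s' p = s p"
proof (induction w arbitrary: s' rule: rev_induct)
  case Nil
  then show ?case using exec_determ by fastforce
next
  case (snoc a w)
  then show ?case by (auto simp: exec_snoc_iff simp flip: append_assoc dest!: step_outside)
qed

lemma exec_prefix: "exec C (u @ w) s \<Longrightarrow> \<exists>s. exec C u s"
  by (induction w arbitrary: s rule: rev_induct)
    (auto simp: exec_snoc_iff simp flip: append_assoc)

lemma step_swap:
  assumes ab: "dmn C a \<inter> dmn C b = {}" and a: "step C s a s1" and b: "step C s1 b s2"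
  shows "\<exists>s1'. step C s b s1' \<and> step C s1' a s2"
proof -
  \<comment> \<open>The state after \<open>b\<close> alone: participants of \<open>b\<close> already
    have their new states, all others still the old ones.\<close>
  define s1' where "s1' = (\<lambda>p. if p \<in> dmn C b then s2 p else s p)"
  have 1: "restrict s1 (dmn C b) = restrict s (dmn C b)" "restrict s1' (dmn C a) = restrict s (dmn C a)"
    "restrict s2 (dmn C a) = restrict s1 (dmn C a)" "restrict s1' (dmn C b) = restrict s2 (dmn C b)"
    using ab step_outside[OF a] step_outside[OF b] by (auto simp: s1'_def restrict_def fun_eq_iff)
  have "s1' \<in> global_states C"
    using a b by (auto simp: s1'_def step_def global_states_def PiE_iff extensional_def)
  moreover have "s2 p = s1' p" if "p \<notin> dmn C a" for p
    using that step_outside[OF a] step_outside[OF b] by (simp add: s1'_def)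
  ultimately show ?thesis
    using a b 1 by (intro exI[of _ s1']) (auto simp: step_def s1'_def)
qed

lemma commute_exec: "commute C u v \<Longrightarrow> exec C u s \<Longrightarrow> exec C v s"
proof (induction arbitrary: s rule: commute.induct)
  case (1 a b u v)
  from 1(2) show ?case
  proof (induction v arbitrary: s rule: rev_induct)
    case Nil
    then have "exec C ((u @ [a]) @ [b]) s" by simp
    then have "exec C ((u @ [b]) @ [a]) s"
      unfolding exec_snoc_iff using step_swap[OF 1(1)] by blast
    then show ?case by simp
  next
    case (snoc x v)
    then show ?case
      using exec_snoc_iff[of C "u @ [a, b] @ v"] exec_snoc_iff[of C "u @ [b, a] @ v"] by auto
  qed
qed

lemma trace_eq_exec: "trace_eq C u v \<Longrightarrow> exec C u s \<Longrightarrow> exec C v s"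
  by (erule trace_eq_closed) (auto intro: commute_exec)

section \<open>Controlled executions of words\<close>

definition allowed :: "('p, 'a, 's) control_game \<Rightarrow> ('p, 'a) controller \<Rightarrow> 'a list \<Rightarrow> 'a \<Rightarrow> bool"
  where
  "allowed C \<rho> u a \<longleftrightarrow>
     a \<in> env_acts C \<or> a \<in> sys_acts C \<and> (\<forall>p\<in>dmn C a. a \<in> \<rho> p (view C p (trace C u)))"

text \<open>A version of \<open>plays\<close> on words that also carries the global state, so that
  inductions need no choice of representatives; \<open>trace_plays\<close> is the
  translation.\<close>

inductive ctrl_exec ::
  "('p, 'a, 's) control_game \<Rightarrow> ('p, 'a) controller \<Rightarrow> 'a list \<Rightarrow> ('p \<Rightarrow> 's) \<Rightarrow> bool"
  for C \<rho> where
  ctrl_exec_Nil: "ctrl_exec C \<rho> [] (init_state C)"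
| ctrl_exec_snoc: "ctrl_exec C \<rho> u s \<Longrightarrow> step C s a s' \<Longrightarrow> allowed C \<rho> u a
    \<Longrightarrow> ctrl_exec C \<rho> (u @ [a]) s'"

lemma ctrl_exec_snoc_iff: "ctrl_exec C \<rho> (u @ [a]) s' \<longleftrightarrow>
    (\<exists>s. ctrl_exec C \<rho> u s \<and> step C s a s' \<and> allowed C \<rho> u a)"
  by (auto elim: ctrl_exec.cases intro: ctrl_exec_snoc)

lemma ctrl_exec_exec: "ctrl_exec C \<rho> u s \<Longrightarrow> exec C u s"
  by (induction rule: ctrl_exec.induct) (auto intro: exec.intros)

lemma ctrl_exec_prefix: "ctrl_exec C \<rho> (u @ w) s \<Longrightarrow> \<exists>s. ctrl_exec C \<rho> u s"
  by (induction w arbitrary: s rule: rev_induct)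
    (auto simp: ctrl_exec_snoc_iff simp flip: append_assoc)

context control_game
begin

lemma view_snoc_outside:
  assumes "set (u @ [a]) \<subseteq> acts C" "p \<notin> dmn C a"
  shows "view C p (trace C (u @ [a])) = view C p (trace C u)"
  using assms by (simp add: view_trace past_singleton_snoc)

lemma allowed_snoc_indep:
  assumes "set (u @ [b]) \<subseteq> acts C" "dmn C a \<inter> dmn C b = {}"
  shows "allowed C \<rho> (u @ [b]) a \<longleftrightarrow> allowed C \<rho> u a"
proof -
  have "view C p (trace C (u @ [b])) = view C p (trace C u)" if "p \<in> dmn C a" for p
    using view_snoc_outside[OF assms(1)] that assms(2) by blast
  then show ?thesis by (simp add: allowed_def)
qed

text \<open>An action independent of \<open>a\<close> leaves the views of the participants of
  \<open>a\<close> unchanged, hence also the permission for \<open>a\<close>. Only the order of the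
  two permissions is exchanged.\<close>

lemma commute_ctrl_exec: "commute C u v \<Longrightarrow> ctrl_exec C \<rho> u s \<Longrightarrow> ctrl_exec C \<rho> v s"
proof (induction arbitrary: s rule: commute.induct)
  case (1 a b u v)
  from 1(2) show ?case
  proof (induction v arbitrary: s rule: rev_induct)
    case Nil
    then have ab: "ctrl_exec C \<rho> ((u @ [a]) @ [b]) s" by simp
    then have acts: "set (u @ [a]) \<subseteq> acts C" "set (u @ [b]) \<subseteq> acts C"
      using ctrl_exec_exec[OF ab] exec_acts by fastforce+
    obtain s0 s1 where s: "ctrl_exec C \<rho> u s0" "step C s0 a s1" "step C s1 b s"
      and al: "allowed C \<rho> u a" "allowed C \<rho> (u @ [a]) b"
      using ab unfolding ctrl_exec_snoc_iff by blast
    obtain s1' where "step C s0 b s1'" "step C s1' a s" using step_swap[OF 1(1) s(2,3)] by blast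
    moreover have "allowed C \<rho> u b" "allowed C \<rho> (u @ [b]) a"
      using al allowed_snoc_indep[OF acts(1)] allowed_snoc_indep[OF acts(2)] 1(1) by blast+
    ultimately have "ctrl_exec C \<rho> ((u @ [b]) @ [a]) s"
      using s(1) by (blast intro: ctrl_exec_snoc)
    then show ?case by simp
  next
    case (snoc x v)
    have "trace C (u @ [a, b] @ v) = trace C (u @ [b, a] @ v)"
      using commute.intros[OF 1(1)] commute_imp_trace_eq trace_eq_iff by blast
    then have "allowed C \<rho> (u @ [a, b] @ v) = allowed C \<rho> (u @ [b, a] @ v)"
      by (simp add: allowed_def fun_eq_iff)
    then show ?case
      using snoc ctrl_exec_snoc_iff[of C \<rho> "u @ [a, b] @ v"]
        ctrl_exec_snoc_iff[of C \<rho> "u @ [b, a] @ v"] by auto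
  qed
qed

lemma trace_eq_ctrl_exec: "trace_eq C u v \<Longrightarrow> ctrl_exec C \<rho> u s \<Longrightarrow> ctrl_exec C \<rho> v s"
  by (erule trace_eq_closed) (auto intro: commute_ctrl_exec)

lemma trace_all_plays: "trace C u \<in> all_plays C \<longleftrightarrow> (\<exists>s. exec C u s)"
  unfolding all_plays_def using trace_eq_iff trace_eq_exec trace_eq_sym by blast

lemma plays_ctrl_exec: "T \<in> plays C \<rho> \<Longrightarrow> \<exists>u s. T = trace C u \<and> ctrl_exec C \<rho> u s"
proof (induction rule: plays.induct)
  case empty
  then show ?case using ctrl_exec_Nil by blast
next
  case (env T a)
  then obtain u s where u: "T = trace C u" "ctrl_exec C \<rho> u s" by blast
  then obtain s' where "exec C (u @ [a]) s'" using env by (auto simp: snoc_trace trace_all_plays)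
  then have "step C s a s'" using u exec_snoc_iff exec_determ ctrl_exec_exec by metis
  then have "ctrl_exec C \<rho> (u @ [a]) s'" using u env by (auto intro: ctrl_exec_snoc simp: allowed_def)
  then show ?case using u snoc_trace by metis
next
  case (sys T a)
  then obtain u s where u: "T = trace C u" "ctrl_exec C \<rho> u s" by blast
  then obtain s' where "exec C (u @ [a]) s'" using sys by (auto simp: snoc_trace trace_all_plays)
  then have "step C s a s'" using u exec_snoc_iff exec_determ ctrl_exec_exec by metis
  then have "ctrl_exec C \<rho> (u @ [a]) s'" using u sys by (auto intro: ctrl_exec_snoc simp: allowed_def)
  then show ?case using u snoc_trace by metis
qed

lemma ctrl_exec_plays: "ctrl_exec C \<rho> u s \<Longrightarrow> trace C u \<in> plays C \<rho>"
proof (induction rule: ctrl_exec.induct)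
  case ctrl_exec_Nil
  then show ?case by (rule plays.empty)
next
  case (ctrl_exec_snoc u s a s')
  then have "snoc C (trace C u) a \<in> all_plays C"
    by (metis snoc_trace trace_all_plays ctrl_exec_exec exec_snoc)
  then have "snoc C (trace C u) a \<in> plays C \<rho>"
    using ctrl_exec_snoc by (auto simp: allowed_def intro: plays.env plays.sys)
  then show ?case by (simp add: snoc_trace)
qed

lemma trace_plays: "trace C u \<in> plays C \<rho> \<longleftrightarrow> (\<exists>s. ctrl_exec C \<rho> u s)"
  using plays_ctrl_exec ctrl_exec_plays trace_eq_iff trace_eq_ctrl_exec trace_eq_sym by metis

end

section \<open>Configurations of occurrence nets\<close>

lemma flow_simps:
  "(Inl q, y) \<in> flow N \<longleftrightarrow> (\<exists>t. y = Inr t \<and> t \<in> transitions N \<and> q \<in> pre N t)"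
  "(Inr t, y) \<in> flow N \<longleftrightarrow> (\<exists>q. y = Inl q \<and> t \<in> transitions N \<and> q \<in> post N t)"
  "(x, Inr t) \<in> flow N \<longleftrightarrow> (\<exists>q. x = Inl q \<and> t \<in> transitions N \<and> q \<in> pre N t)"
  "(x, Inl q) \<in> flow N \<longleftrightarrow> (\<exists>t. x = Inr t \<and> t \<in> transitions N \<and> q \<in> post N t)"
  by (auto simp: flow_def)

text \<open>The axioms of occurrence nets except freedom from self-conflict, with nonempty presets
  added. Leaving the missing axiom out lets the unfolded controller enter the locale first and
  obtain that axiom from \<open>enabled_no_self_conflict\<close>.\<close>

locale causal_net =
  fixes N :: "('q, 't, 'z) net_scheme"
  assumes pre_places: "t \<in> transitions N \<Longrightarrow> pre N t \<subseteq> places N"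
    and post_places: "t \<in> transitions N \<Longrightarrow> post N t \<subseteq> places N"
    and unique_producer: "t \<in> transitions N \<Longrightarrow> t' \<in> transitions N
      \<Longrightarrow> q \<in> post N t \<Longrightarrow> q \<in> post N t' \<Longrightarrow> t = t'"
    and wf_flow: "wf (flow N)"
    and init_eq: "init_marking N = {q \<in> places N. place_pre N q = {}}"
    and pre_nonempty: "t \<in> transitions N \<Longrightarrow> pre N t \<noteq> {}"
begin

definition configuration :: "'t set \<Rightarrow> bool" where
  "configuration X \<longleftrightarrow> X \<subseteq> transitions N
     \<and> (\<forall>t\<in>X. \<forall>t'\<in>transitions N. post N t' \<inter> pre N t \<noteq> {} \<longrightarrow> t' \<in> X)
     \<and> (\<forall>t\<in>X. \<forall>t'\<in>X. t \<noteq> t' \<longrightarrow> pre N t \<inter> pre N t' = {})"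

definition cut :: "'t set \<Rightarrow> 'q set" where
  "cut X = (init_marking N \<union> (\<Union>t\<in>X. post N t)) - (\<Union>t\<in>X. pre N t)"

lemma flow_acyclic: "(x, x) \<notin> (flow N)\<^sup>+"
  using wf_flow wf_acyclic acyclic_def by metis

lemma not_init_if_produced: "t \<in> transitions N \<Longrightarrow> q \<in> post N t \<Longrightarrow> q \<notin> init_marking N"
  by (auto simp: init_eq place_pre_def)

lemma init_or_produced:
  "q \<in> places N \<Longrightarrow> q \<in> init_marking N \<or> (\<exists>t\<in>transitions N. q \<in> post N t)"
  by (auto simp: init_eq place_pre_def)

text \<open>Walking backwards along the flow stays inside \<open>X\<close>: initial places have no
  producer, a place produced by \<open>X\<close> has only that producer, and producers of consumed
  places are in \<open>X\<close> by causal closure. Places and transitions alternate, so the claim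
  covers both.\<close>

lemma below_configuration:
  assumes "configuration X" and "(Inr t, x) \<in> (flow N)\<^sup>*"
    and "case x of Inr t' \<Rightarrow> t' \<in> X
       | Inl q \<Rightarrow> q \<in> init_marking N \<union> (\<Union>t\<in>X. post N t) \<union> (\<Union>t\<in>X. pre N t)"
  shows "t \<in> X"
  using assms(2,3)
proof (induction rule: rtrancl_induct)
  case (step y z)
  show ?case
  proof (cases z)
    case (Inl q)
    then obtain t' where t': "y = Inr t'" "t' \<in> transitions N" "q \<in> post N t'"
      using step by (auto simp: flow_simps)
    have "q \<in> (\<Union>t\<in>X. post N t) \<union> (\<Union>t\<in>X. pre N t)"
      using step.prems t' not_init_if_produced Inl by auto
    then have "t' \<in> X"
      using t' assms(1) unique_producer by (fastforce simp: configuration_def)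
    then show ?thesis using step.IH t' by simp
  next
    case (Inr t')
    then obtain q where q: "y = Inl q" "q \<in> pre N t'" using step by (auto simp: flow_simps)
    have "t' \<in> X" using step.prems Inr by simp
    then show ?thesis using q by (intro step.IH) auto
  qed
qed simp

lemma configuration_insert:
  assumes X: "configuration X" and en: "enabled N (cut X) t"
  shows "configuration (insert t X)" "cut (insert t X) = fire N (cut X) t"
proof -
  have t: "t \<in> transitions N" "pre N t \<subseteq> cut X" using en by (auto simp: enabled_def)
  \<comment> \<open>A transition of \<open>X\<close> has removed its nonempty preset from the
    cut.\<close>
  have tX: "t \<notin> X" using t pre_nonempty[of t] by (auto simp: cut_def)
  have "t' \<in> X" if t': "t' \<in> transitions N" "q \<in> post N t'" "q \<in> pre N t" for t' q
  proof -
    obtain t'' where "t'' \<in> X" "q \<in> post N t''"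
      using t' t(2) not_init_if_produced by (auto simp: cut_def)
    then show ?thesis using t' X unique_producer[of t' t'' q] by (auto simp: configuration_def)
  qed
  then show "configuration (insert t X)"
    using X t by (fastforce simp: configuration_def cut_def)
  have "q \<notin> pre N t'" if "q \<in> post N t" "t' \<in> X" for q t'
    using that t X tX by (fastforce simp: configuration_def)
  moreover have "q \<notin> pre N t" if "q \<in> post N t" for q
    using that t(1) flow_acyclic[of "Inl q"]
      trancl_trans[OF r_into_trancl r_into_trancl, of "Inl q" "Inr t" "flow N" "Inl q"]
    by (auto simp: flow_simps)
  ultimately show "cut (insert t X) = fire N (cut X) t"
    by (auto simp: cut_def fire_def)
qed

lemma reachable_cut:
  assumes "M \<in> reachable N" shows "\<exists>X. configuration X \<and> M = cut X"
  using assms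
proof (induction rule: reachable.induct)
  case init
  have "configuration {}" "cut {} = init_marking N" by (auto simp: configuration_def cut_def)
  then show ?case by metis
next
  case (fire M t)
  then show ?case using configuration_insert by metis
qed

text \<open>A causally maximal transition can be fired last: removing it keeps the set causally
  closed, and it is enabled at the smaller cut.\<close>

lemma cut_reachable:
  assumes "finite X" "configuration X" shows "cut X \<in> reachable N"
  using assms
proof (induction "card X" arbitrary: X)
  case 0
  then show ?case using reachable.init by (simp add: cut_def)
next
  case (Suc n)
  \<comment> \<open>Causality reversed, so that a minimal element for well-foundedness is causally
    maximal in \<open>X\<close>.\<close>
  define r where "r = {(t', t). t \<in> X \<and> t' \<in> X \<and> (Inr t, Inr t') \<in> (flow N)\<^sup>+}"
  have "finite r" using Suc(3) by (rule_tac finite_subset[of _ "X \<times> X"]) (auto simp: r_def)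
  moreover have "(Inr t, Inr t') \<in> (flow N)\<^sup>+" if "(t', t) \<in> r\<^sup>+" for t t'
    using that by (induction rule: trancl_induct) (auto simp: r_def intro: trancl_trans)
  then have "acyclic r"
    using flow_acyclic by (blast intro: acyclicI)
  ultimately have "wf r" by (rule finite_acyclic_wf)
  moreover have "X \<noteq> {}" using Suc(2) by auto
  ultimately obtain t where t: "t \<in> X" and max: "\<And>t'. (t', t) \<in> r \<Longrightarrow> t' \<notin> X"
    by (metis wf_eq_minimal ex_in_conv)
  define Y where "Y = X - {t}"
  have nsucc: "post N t \<inter> pre N t' = {}" if "t' \<in> X" for t'
  proof (rule ccontr)
    assume "post N t \<inter> pre N t' \<noteq> {}"
    then obtain q where q: "q \<in> post N t" "q \<in> pre N t'" by blast
    have "t \<in> transitions N" "t' \<in> transitions N"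
      using that t Suc(4) by (auto simp: configuration_def)
    then have "(Inr t, Inl q) \<in> flow N" "(Inl q, Inr t') \<in> flow N"
      using q by (simp_all add: flow_simps)
    then have "(t', t) \<in> r" using that t by (auto simp: r_def)
    then show False using max that by blast
  qed
  have confY: "configuration Y"
    using Suc(4) nsucc by (auto simp: configuration_def Y_def) (metis disjoint_iff)+
  have "cut Y \<in> reachable N"
    using Suc(2,3) t confY by (intro Suc(1)) (auto simp: Y_def)
  moreover have "q \<in> cut Y" if "q \<in> pre N t" for q
  proof -
    have tN: "t \<in> transitions N" using t Suc(4) by (auto simp: configuration_def)
    have "q \<in> init_marking N \<or> (\<exists>t'\<in>Y. q \<in> post N t')"
      using init_or_produced[of q] pre_places[OF tN] that Suc(4) t nsucc[OF t]
      unfolding configuration_def Y_def by blast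
    moreover have "q \<notin> pre N t'" if "t' \<in> Y" for t'
      using Suc(4) t that \<open>q \<in> pre N t\<close> unfolding configuration_def Y_def by blast
    ultimately show ?thesis by (auto simp: cut_def)
  qed
  then have en: "enabled N (cut Y) t" using t Suc(4) by (auto simp: enabled_def configuration_def)
  moreover have "insert t Y = X" using t by (auto simp: Y_def)
  ultimately show ?case
    using configuration_insert[OF confY en] reachable.fire by metis
qed

text \<open>Everything causally below a place of the cut lies in its configuration. An order between
  two such places would mean that one has been consumed, and a conflict would put two competing
  transitions into the configuration.\<close>

lemma reachable_concurrent:
  assumes M: "M \<in> reachable N" and q: "q \<in> M" "q' \<in> M" "q \<noteq> q'"
  shows "concurrent N (Inl q) (Inl q')"
proof -
  obtain X where X: "configuration X" "M = cut X" using reachable_cut[OF M] by blast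
  have below: "t \<in> X" if "(Inr t, Inl x) \<in> (flow N)\<^sup>*" "x \<in> M" for t x
    using below_configuration[OF X(1) that(1)] that(2) X(2) by (auto simp: cut_def)
  have ord: "(Inl x, Inl y) \<notin> (flow N)\<^sup>*" if "x \<in> M" "y \<in> M" "x \<noteq> y" for x y
  proof
    assume "(Inl x, Inl y) \<in> (flow N)\<^sup>*"
    then obtain t where "x \<in> pre N t" "(Inr t, Inl y) \<in> (flow N)\<^sup>*"
      using \<open>x \<noteq> y\<close> by (cases rule: converse_rtranclE) (auto simp: flow_simps)
    then show False using below \<open>x \<in> M\<close> \<open>y \<in> M\<close> X(2) by (auto simp: cut_def)
  qed
  have "\<not> conflict N (Inl q) (Inl q')"
    using below q X(1) by (auto simp: conflict_def place_post_def configuration_def) blast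
  then show ?thesis using ord q by (auto simp: concurrent_def)
qed

text \<open>After firing, the configuration contains \<open>t\<close> and its whole past, and
  configurations are free of conflict.\<close>

lemma enabled_no_self_conflict:
  assumes M: "M \<in> reachable N" and t: "enabled N M t"
  shows "\<not> conflict N (Inr t) (Inr t)"
proof -
  obtain X where X: "configuration X" "M = cut X" using reachable_cut[OF M] by blast
  define Y where "Y = insert t X"
  have Y: "configuration Y" using configuration_insert[OF X(1)] t X(2) by (simp add: Y_def)
  have "t' \<in> Y" if "(Inr t', Inr t) \<in> (flow N)\<^sup>*" for t'
    using below_configuration[OF Y that] by (simp add: Y_def)
  then show ?thesis
    using Y by (auto simp: conflict_def place_post_def configuration_def) blast
qed

text \<open>Well-foundedness together with finitely many direct predecessors: a place has at most
  one producer, a transition a finite preset.\<close>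

lemma finite_below:
  assumes "\<And>t. t \<in> transitions N \<Longrightarrow> finite (pre N t)"
  shows "finite {t. (Inr t, x) \<in> (flow N)\<^sup>*}"
  using wf_flow
proof (induction x rule: wf_induct_rule)
  case (less x)
  have "finite {y. (y, x) \<in> flow N}"
  proof (cases x)
    case (Inl q)
    then have "{y. (y, x) \<in> flow N} = Inr ` {t \<in> transitions N. q \<in> post N t}"
      by (auto simp: flow_simps)
    moreover have "finite {t \<in> transitions N. q \<in> post N t}"
    proof (cases "\<exists>t\<in>transitions N. q \<in> post N t")
      case True
      then obtain t where "t \<in> transitions N" "q \<in> post N t" by blast
      then have "{t \<in> transitions N. q \<in> post N t} \<subseteq> {t}" using unique_producer by blast
      then show ?thesis using finite_subset by blast
    next
      case False
      then have "{t \<in> transitions N. q \<in> post N t} = {}" by blast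
      then show ?thesis by (metis finite.emptyI)
    qed
    ultimately show ?thesis by simp
  next
    case (Inr t)
    then have "{y. (y, x) \<in> flow N} \<subseteq> Inl ` (if t \<in> transitions N then pre N t else {})"
      by (auto simp: flow_simps)
    then show ?thesis by (rule finite_subset) (auto intro: assms)
  qed
  moreover have "{t. (Inr t, x) \<in> (flow N)\<^sup>*} \<subseteq>
      {t. x = Inr t} \<union> (\<Union>y\<in>{y. (y, x) \<in> flow N}. {t. (Inr t, y) \<in> (flow N)\<^sup>*})"
    by (auto elim: rtranclE)
  moreover have "finite {t. x = Inr t}" by (cases x) auto
  ultimately show ?case using less by (auto intro: finite_subset)
qed

text \<open>The transitions causally below \<open>D\<close> form a finite configuration, and its cut
  contains \<open>D\<close>.\<close>

lemma concurrent_subset_reachable: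
  assumes fin: "\<And>t. t \<in> transitions N \<Longrightarrow> finite (pre N t)"
    and nsc: "\<And>t. t \<in> transitions N \<Longrightarrow> \<not> conflict N (Inr t) (Inr t)"
    and D: "finite D" "D \<subseteq> places N"
      "\<And>q q'. q \<in> D \<Longrightarrow> q' \<in> D \<Longrightarrow> q \<noteq> q' \<Longrightarrow> concurrent N (Inl q) (Inl q')"
  shows "\<exists>M\<in>reachable N. D \<subseteq> M"
proof -
  define X where "X = (\<Union>q\<in>D. {t. (Inr t, Inl q) \<in> (flow N)\<^sup>*})"
  have finX: "finite X" using D(1) finite_below[OF fin] by (auto simp: X_def)
  have trX: "t \<in> transitions N" if "(Inr t, Inl q) \<in> (flow N)\<^sup>*" for t q
    using that by (cases rule: converse_rtranclE) (auto simp: flow_simps)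
  have conf: "pre N t \<inter> pre N t' = {}"
    if t: "t \<noteq> t'" and q: "q \<in> D" "(Inr t, Inl q) \<in> (flow N)\<^sup>*"
      and q': "q' \<in> D" "(Inr t', Inl q') \<in> (flow N)\<^sup>*" for t t' q q'
  proof (rule ccontr)
    assume "pre N t \<inter> pre N t' \<noteq> {}"
    then obtain r where r: "r \<in> pre N t" "r \<in> pre N t'" by blast
    have rt: "r \<in> places N" "t \<in> place_post N r" "t' \<in> place_post N r"
      using r trX[OF q(2)] trX[OF q'(2)] pre_places by (auto simp: place_post_def)
    then have "conflict N (Inl q) (Inl q')"
      using t q q' by (auto simp: conflict_def)
    \<comment> \<open>Two competitors below distinct places contradict concurrency. Below a single
      place both lead through its only producer, which would then be in conflict with
      itself.\<close>
    then have "q = q'" using D(3) q q' by (auto simp: concurrent_def)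
    obtain t1 where t1: "(Inr t, Inr t1) \<in> (flow N)\<^sup>*" "t1 \<in> transitions N" "q \<in> post N t1"
      using q(2) by (cases rule: rtranclE) (auto simp: flow_simps)
    moreover obtain t2 where "(Inr t', Inr t2) \<in> (flow N)\<^sup>*" "t2 \<in> transitions N" "q \<in> post N t2"
      using q'(2) unfolding \<open>q = q'\<close> by (cases rule: rtranclE) (auto simp: flow_simps)
    moreover have "t1 = t2" using calculation unique_producer by blast
    ultimately have "conflict N (Inr t1) (Inr t1)"
      using rt t by (auto simp: conflict_def)
    then show False using nsc t1 by blast
  qed
  have "configuration X"
    unfolding configuration_def
  proof (intro conjI ballI impI)
    fix t t' assume "t \<in> X" "t' \<in> transitions N" "post N t' \<inter> pre N t \<noteq> {}"
    then obtain q r where q: "q \<in> D" "(Inr t, Inl q) \<in> (flow N)\<^sup>*"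
      and r: "r \<in> post N t'" "r \<in> pre N t" by (auto simp: X_def)
    then have "(Inr t', Inl r) \<in> flow N" "(Inl r, Inr t) \<in> flow N"
      using trX \<open>t' \<in> transitions N\<close> by (auto simp: flow_simps)
    then have "(Inr t', Inl q) \<in> (flow N)\<^sup>*"
      using q(2) by (meson converse_rtrancl_into_rtrancl)
    then show "t' \<in> X" using q(1) by (auto simp: X_def)
  next
    show "X \<subseteq> transitions N" using trX by (auto simp: X_def)
  next
    fix t t' assume "t \<in> X" "t' \<in> X" "t \<noteq> t'"
    then show "pre N t \<inter> pre N t' = {}" using conf unfolding X_def by blast
  qed
  then have "cut X \<in> reachable N" using cut_reachable finX by blast
  moreover have "q \<in> cut X" if "q \<in> D" for q
  proof -
    have "q \<in> init_marking N \<or> (\<exists>t\<in>X. q \<in> post N t)"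
    proof -
      have "t \<in> X" if "t \<in> transitions N" "q \<in> post N t" for t
      proof -
        have "(Inr t, Inl q) \<in> flow N" using that by (simp add: flow_simps)
        then show ?thesis using \<open>q \<in> D\<close> by (auto simp: X_def)
      qed
      then show ?thesis using init_or_produced[of q] \<open>q \<in> D\<close> D(2) by blast
    qed
    \<comment> \<open>A consumer of \<open>q\<close> in \<open>X\<close> would put \<open>q\<close>
      strictly below some place of \<open>D\<close>: a cycle if that place is \<open>q\<close>,
      otherwise two ordered places of \<open>D\<close>.\<close>
    moreover have "q \<notin> pre N t" if "t \<in> X" for t
    proof
      assume "q \<in> pre N t"
      obtain q' where q': "q' \<in> D" "(Inr t, Inl q') \<in> (flow N)\<^sup>*" using \<open>t \<in> X\<close> by (auto simp: X_def)
      then have "(Inl q, Inl q') \<in> (flow N)\<^sup>+"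
        using \<open>q \<in> pre N t\<close> trX rtrancl_into_trancl2[of "Inl q" "Inr t" "flow N"]
        by (auto simp: flow_simps)
      then show False
        using flow_acyclic D(3)[OF \<open>q \<in> D\<close> q'(1)] by (auto simp: concurrent_def dest: trancl_into_rtrancl)
    qed
    ultimately show ?thesis by (auto simp: cut_def)
  qed
  ultimately show ?thesis by blast
qed

end

section \<open>The Petri game of a control game\<close>

lemma game_of_simps [simp]:
  "pre (game_of C) = gpre C"
  "post (game_of C) = gpost C"
  "init_marking (game_of C) = Sys ` init_state C ` procs C"
  "sys_places (game_of C) = Sys ` all_lstates C"
  "bad_places (game_of C) = Sys ` (\<Union>p \<in> procs C. losing C p) \<union> Bot ` procs C"
  by (simp_all add: game_of_def)

lemma base_game_simps [simp]:
  "pre (base_game C) = gpre C"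
  "post (base_game C) = gpost C"
  "init_marking (base_game C) = Sys ` init_state C ` procs C"
  "env_places (base_game C) = commitment_places C"
  by (simp_all add: base_game_def)

lemma places_game_of:
  "places (game_of C) = Sys ` all_lstates C \<union> commitment_places C \<union> Bot ` procs C"
  by (simp add: game_of_def)

lemma transitions_game_of: "transitions (game_of C) =
    env_trans C \<union> sys_trans C \<union> tau_trans C \<union> DL ` deadlock_markings C"
  by (simp add: game_of_def)

lemma tau_mem: "Tau s A \<in> transitions (game_of C) \<longleftrightarrow> s \<in> all_lstates C \<and> A \<in> commitments C s"
  by (auto simp: transitions_game_of env_trans_def sys_trans_def tau_trans_def)

lemma DL_mem: "DL M \<in> transitions (game_of C) \<longleftrightarrow> M \<in> deadlock_markings C"
  by (auto simp: transitions_game_of env_trans_def sys_trans_def tau_trans_def)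

lemma base_mem: "t \<in> transitions (base_game C) \<longleftrightarrow>
    t \<in> transitions (game_of C) \<and> (\<forall>M. t \<noteq> DL M)"
  by (auto simp: base_game_def transitions_game_of env_trans_def sys_trans_def tau_trans_def)

lemma deadlock_marking_places: "M \<in> deadlock_markings C \<Longrightarrow> M \<subseteq> commitment_places C"
  by (auto simp: deadlock_markings_def)

text \<open>The marking of the game for a global state \<open>s\<close> in which the processes in \<open>Q\<close> have committed
  to the sets \<open>K\<close>.\<close>

definition game_marking ::
  "('p, 'a, 's) control_game \<Rightarrow> ('p \<Rightarrow> 's) \<Rightarrow> ('p \<Rightarrow> 'a set) \<Rightarrow> 'p set
     \<Rightarrow> ('p, 'a, 's) gplace set" where
  "game_marking C s K Q = (\<lambda>p. Env (s p) (K p)) ` Q \<union> (\<lambda>p. Sys (s p)) ` (procs C - Q)"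

context control_game
begin

lemma act_mem: "Act a B A \<in> transitions (game_of C) \<longleftrightarrow>
    a \<in> acts C \<and> delta C a B \<noteq> None \<and> A \<in> PiE (B ` dmn C a) (commitments C)
    \<and> (a \<in> env_acts C \<or> a \<in> sys_acts C \<and> (\<forall>s\<in>B ` dmn C a. a \<in> A s))"
  using acts_union by (auto simp: transitions_game_of env_trans_def sys_trans_def tau_trans_def)

lemma lstates_unique:
  "p \<in> procs C \<Longrightarrow> p' \<in> procs C \<Longrightarrow> x \<in> lstates C p \<Longrightarrow> x \<in> lstates C p' \<Longrightarrow> p = p'"
  using lstates_disjoint by blast

lemma global_state_lstates: "s \<in> global_states C \<Longrightarrow> p \<in> procs C \<Longrightarrow> s p \<in> lstates C p"
  by (auto simp: global_states_def)

lemma global_state_eq_iff: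
  "s \<in> global_states C \<Longrightarrow> s' \<in> global_states C \<Longrightarrow> p \<in> procs C \<Longrightarrow> p' \<in> procs C
    \<Longrightarrow> s p = s' p' \<Longrightarrow> p = p'"
  using lstates_unique global_state_lstates by metis

lemma exec_global_state: "exec C u s \<Longrightarrow> s \<in> global_states C"
  by (induction rule: exec.induct) (auto simp: init_state step_def)

lemma en_acts_of:
  assumes "p \<in> procs C" "x \<in> lstates C p" shows "en C x \<subseteq> acts_of C p"
proof
  fix a assume "a \<in> en C x"
  then obtain B B' p' where a: "a \<in> acts C" "delta C a B = Some B'" "p' \<in> dmn C a" "x = B p'"
    by (auto simp: en_def)
  then have "x \<in> lstates C p'" "p' \<in> procs C" using delta_dom dmn_subset by blast+
  then show "a \<in> acts_of C p" using a assms lstates_unique by (auto simp: acts_of_def)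
qed

lemma step_en:
  assumes "step C s a s'" "p \<in> dmn C a" shows "a \<in> en C (s p)"
proof -
  have "s p \<in> restrict s (dmn C a) ` dmn C a"
    using assms(2) by (metis imageI restrict_apply')
  then show ?thesis using assms(1) by (auto simp: step_def en_def)
qed

lemma delta_step:
  assumes s: "s \<in> global_states C" and a: "a \<in> acts C"
    and d: "delta C a (restrict s (dmn C a)) = Some B'"
  shows "step C s a (\<lambda>p. if p \<in> dmn C a then B' p else s p)" (is "step C s a ?s'")
proof -
  have B': "B' \<in> PiE (dmn C a) (lstates C)" using delta_ran[OF a d] .
  have "?s' \<in> global_states C"
    using s B' dmn_subset[OF a] by (auto simp: global_states_def PiE_iff extensional_def)
  moreover have "restrict ?s' (dmn C a) = B'"
    using B' by (auto simp: PiE_iff extensional_def restrict_def)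
  ultimately show ?thesis using s a d by (auto simp: step_def)
qed

lemma finite_all_lstates: "finite (all_lstates C)"
  using finite_procs finite_lstates by (auto simp: all_lstates_def)

lemma finite_commitments: "finite (commitments C x)"
proof -
  have "finite (en C x)" using finite_acts by (rule finite_subset[rotated]) (auto simp: en_def)
  then show ?thesis by (simp add: commitments_def)
qed

lemma finite_commitment_places: "finite (commitment_places C)"
proof -
  have "commitment_places C = (\<Union>s\<in>all_lstates C. Env s ` commitments C s)"
    by (auto simp: commitment_places_def)
  then show ?thesis using finite_all_lstates finite_commitments by simp
qed

lemma finite_dmn: "a \<in> acts C \<Longrightarrow> finite (dmn C a)"
  using dmn_subset finite_procs finite_subset by blast

text \<open>A non-final state has a step, and every action has a participant. Consequently a
  deadlock transition has a nonempty preset and produces at least one bad place.\<close>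

lemma deadlock_procs_nonempty:
  assumes "M \<in> deadlock_markings C" shows "procs C \<noteq> {}"
proof -
  obtain s a s' where "step C s a s'"
    using assms by (auto simp: deadlock_markings_def final_state_def)
  then have "a \<in> acts C" by (simp add: step_def)
  then show ?thesis using dmn_subset dmn_nonempty by blast
qed

lemma gpre_finite: "t \<in> transitions (game_of C) \<Longrightarrow> finite (gpre C t)"
  by (cases t)
    (auto simp: act_mem DL_mem dest: deadlock_marking_places
      intro: finite_subset[OF _ finite_commitment_places] intro!: finite_imageI finite_dmn)

lemma gpre_nonempty:
  assumes "t \<in> transitions (game_of C)" shows "gpre C t \<noteq> {}"
proof (cases t)
  case (Act a B A)
  then show ?thesis using assms dmn_nonempty by (simp add: act_mem)
next
  case (DL M)
  then have "M \<in> deadlock_markings C" using assms DL_mem by blast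
  then have "procs C \<noteq> {}" and "\<exists>s. s ` procs C = zeta ` M"
    using deadlock_procs_nonempty by (auto simp: deadlock_markings_def)
  then show ?thesis using DL by auto
qed simp

lemma Sys_in_gpre:
  assumes "t \<in> transitions (game_of C)" "Sys x \<in> gpre C t"
  shows "\<exists>A\<in>commitments C x. t = Tau x A"
proof (cases t)
  case (DL M)
  then show ?thesis using assms deadlock_marking_places[of M C]
    by (auto simp: DL_mem commitment_places_def)
qed (use assms in \<open>auto simp: tau_mem\<close>)

text \<open>A local state identifies its process, so each place of the preset must be the commitment
  place which that very process occupies in the marking.\<close>

lemma act_pre_subset:
  assumes t: "Act a B A \<in> transitions (game_of C)"
    and sub: "gpre C (Act a B A) \<subseteq> game_marking C s K Q"
    and s: "s \<in> global_states C" and Q: "Q \<subseteq> procs C"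
  shows "B = restrict s (dmn C a)" "dmn C a \<subseteq> Q" "\<And>p. p \<in> dmn C a \<Longrightarrow> A (s p) = K p"
proof -
  obtain B' where a: "a \<in> acts C" "delta C a B = Some B'" using t unfolding act_mem by blast
  then have B: "B \<in> PiE (dmn C a) (lstates C)" using delta_dom by blast
  have *: "p \<in> Q \<and> B p = s p \<and> A (B p) = K p" if p: "p \<in> dmn C a" for p
  proof -
    have "Env (B p) (A (B p)) \<in> game_marking C s K Q" using sub p by auto
    then obtain p' where p': "p' \<in> Q" "B p = s p'" "A (B p) = K p'"
      by (auto simp: game_marking_def)
    moreover have "p = p'"
    proof (rule lstates_unique)
      show "p \<in> procs C" "p' \<in> procs C" using p p' Q dmn_subset[OF a(1)] by auto
      then show "B p \<in> lstates C p'" using p' global_state_lstates[OF s] by simp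
      show "B p \<in> lstates C p" using p B by auto
    qed
    ultimately show ?thesis by simp
  qed
  then show "dmn C a \<subseteq> Q" "\<And>p. p \<in> dmn C a \<Longrightarrow> A (s p) = K p" by force+
  show "B = restrict s (dmn C a)"
    using * B by (auto simp: PiE_iff extensional_def restrict_def fun_eq_iff)
qed

text \<open>\<open>M\<close> contains a place for every process, so inside a game marking it leaves
  no room: all processes have committed and \<open>M\<close> is the entire marking.\<close>

lemma deadlock_pre_subset:
  assumes M: "M \<in> deadlock_markings C" and sub: "M \<subseteq> game_marking C s K Q"
    and s: "s \<in> global_states C" and Q: "Q \<subseteq> procs C"
  shows "Q = procs C" "M = game_marking C s K Q" "\<not> final_state C s"
    "final_marking (base_game C) M"
proof -
  obtain s' where s': "s' \<in> global_states C" "s' ` procs C = zeta ` M" "\<not> final_state C s'"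
    using M by (auto simp: deadlock_markings_def)
  have MQ: "M \<subseteq> (\<lambda>p. Env (s p) (K p)) ` Q"
    using sub deadlock_marking_places[OF M] by (fastforce simp: game_marking_def commitment_places_def)
  have *: "p \<in> Q \<and> s' p = s p \<and> Env (s p) (K p) \<in> M" if p: "p \<in> procs C" for p
  proof -
    have "s' p \<in> zeta ` M" using s'(2) p by blast
    then obtain p' where p': "p' \<in> Q" "s' p = s p'" "Env (s p') (K p') \<in> M" using MQ by fastforce
    moreover have "p = p'" using global_state_eq_iff[OF s'(1) s p] p' Q by auto
    ultimately show ?thesis by simp
  qed
  then show "Q = procs C" using Q by blast
  then show "M = game_marking C s K Q" using * MQ by (auto simp: game_marking_def)
  have "s' = s" using * s'(1) s by (auto simp: global_states_def intro: PiE_ext)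
  then show "\<not> final_state C s" using s' by simp
  show "final_marking (base_game C) M" using M by (simp add: deadlock_markings_def)
qed

text \<open>Local states belong to a single process, so a family indexed by processes can be reindexed by
  local states.\<close>

definition family :: "'a \<Rightarrow> ('p \<Rightarrow> 's) \<Rightarrow> ('p \<Rightarrow> 'a set) \<Rightarrow> 's \<Rightarrow> 'a set" where
  "family a s K = restrict (\<lambda>x. K (THE p. p \<in> procs C \<and> x \<in> lstates C p)) (s ` dmn C a)"

lemma family_apply:
  assumes "s \<in> global_states C" "a \<in> acts C" "p \<in> dmn C a" shows "family a s K (s p) = K p"
proof -
  have "(THE p'. p' \<in> procs C \<and> s p \<in> lstates C p') = p"
    using assms dmn_subset global_state_lstates[of s p] lstates_unique[of _ p "s p"]
    by (intro the_equality) auto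
  then show ?thesis using assms(3) by (simp add: family_def)
qed

lemma gpre_family:
  assumes "s \<in> global_states C" "a \<in> acts C"
  shows "gpre C (Act a (restrict s (dmn C a)) (family a s K)) = (\<lambda>p. Env (s p) (K p)) ` dmn C a"
  unfolding gpre.simps image_image by (rule image_cong) (simp_all add: family_apply[OF assms])

lemma family_mem:
  assumes "step C s a s'" "\<And>p. p \<in> dmn C a \<Longrightarrow> K p \<in> commitments C (s p)"
    and "a \<in> env_acts C \<or> a \<in> sys_acts C \<and> (\<forall>p\<in>dmn C a. a \<in> K p)"
  shows "Act a (restrict s (dmn C a)) (family a s K) \<in> transitions (game_of C)"
proof -
  have s: "s \<in> global_states C" "a \<in> acts C" using assms by (auto simp: step_def)
  have "family a s K \<in> PiE (s ` dmn C a) (commitments C)"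
    using family_apply[OF s, of _ K] assms(2) by (auto simp: PiE_iff family_def)
  moreover have "restrict s (dmn C a) ` dmn C a = s ` dmn C a" by auto
  ultimately show ?thesis
    unfolding act_mem using assms(1,3) s family_apply[OF s, of _ K] by (auto simp: step_def)
qed

text \<open>Hence a marking enables at most one transition for each action. This is the source of
  determinism on the side of the game.\<close>

lemma act_eq_family:
  assumes t: "Act a B A \<in> transitions (game_of C)"
    and "gpre C (Act a B A) \<subseteq> game_marking C s K Q"
    and s: "s \<in> global_states C" and "Q \<subseteq> procs C"
  shows "B = restrict s (dmn C a)" "A = family a s K"
proof -
  note * = act_pre_subset[OF assms]
  show B: "B = restrict s (dmn C a)" using * by simp
  have a: "a \<in> acts C" and "A \<in> PiE (s ` dmn C a) (commitments C)"
    using t unfolding act_mem B by auto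
  moreover have "A x = family a s K x" if "x \<in> s ` dmn C a" for x
    using that *(3) family_apply[OF s a] by auto
  ultimately show "A = family a s K"
    by (auto simp: PiE_iff extensional_def family_def fun_eq_iff)
qed

lemma branching_process_causal_net:
  assumes "branching_process_of (game_of C) \<sigma>" shows "causal_net \<sigma>"
proof
  have o: "occurrence_net \<sigma>"
    and b: "\<And>t. t \<in> transitions \<sigma> \<Longrightarrow> bij_betw (plab \<sigma>) (pre \<sigma> t) (gpre C (tlab \<sigma> t))"
    and l: "\<And>t. t \<in> transitions \<sigma> \<Longrightarrow> tlab \<sigma> t \<in> transitions (game_of C)"
    using assms by (auto simp: branching_process_of_def)
  show "wf (flow \<sigma>)" "init_marking \<sigma> = {q \<in> places \<sigma>. place_pre \<sigma> q = {}}"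
    using o by (simp_all add: occurrence_net_def)
  show "pre \<sigma> t \<subseteq> places \<sigma>" if "t \<in> transitions \<sigma>" for t
    using that o by (simp add: occurrence_net_def)
  show post: "post \<sigma> t \<subseteq> places \<sigma>" if "t \<in> transitions \<sigma>" for t
    using that o by (simp add: occurrence_net_def)
  show "t = t'" if "t \<in> transitions \<sigma>" "t' \<in> transitions \<sigma>" "q \<in> post \<sigma> t" "q \<in> post \<sigma> t'" for t t' q
  proof -
    have "q \<in> places \<sigma>" using that post by blast
    then show ?thesis using that o unfolding occurrence_net_def place_pre_def by blast
  qed
  show "pre \<sigma> t \<noteq> {}" if "t \<in> transitions \<sigma>" for t
    using b[OF that] gpre_nonempty[OF l[OF that]] by (auto simp: bij_betw_def)
qed

end

section \<open>From strategies to controllers\<close>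

locale committing_strategy = control_game C
  for C :: "('p, 'a, 's) control_game" +
  fixes \<sigma> :: "('q, 'u, ('p, 'a, 's) gplace, ('p, 'a, 's) gtrans) branching_process"
  assumes winning: "winning_strategy (game_of C) \<sigma>"
    and commits: "always_commits (game_of C) \<sigma>"
begin

lemma branching: "branching_process_of (game_of C) \<sigma>"
  using winning by (simp add: winning_strategy_def strategy_def)

sublocale causal_net \<sigma>
  using branching by (rule branching_process_causal_net)

lemma
  assumes "t \<in> transitions \<sigma>"
  shows tlab_mem: "tlab \<sigma> t \<in> transitions (game_of C)"
    and pre_bij: "bij_betw (plab \<sigma>) (pre \<sigma> t) (gpre C (tlab \<sigma> t))"
    and post_bij: "bij_betw (plab \<sigma>) (post \<sigma> t) (gpost C (tlab \<sigma> t))"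
  using assms branching by (auto simp: branching_process_of_def)

lemma init_bij: "bij_betw (plab \<sigma>) (init_marking \<sigma>) (Sys ` init_state C ` procs C)"
  using branching by (simp add: branching_process_of_def)

lemma label_unique:
  "t \<in> transitions \<sigma> \<Longrightarrow> t' \<in> transitions \<sigma> \<Longrightarrow> pre \<sigma> t = pre \<sigma> t' \<Longrightarrow> tlab \<sigma> t = tlab \<sigma> t' \<Longrightarrow> t = t'"
  using branching unfolding branching_process_of_def by blast

lemma not_bad: "M \<in> reachable \<sigma> \<Longrightarrow> q \<in> M \<Longrightarrow> plab \<sigma> q \<notin> bad_places (game_of C)"
  using winning by (simp add: winning_strategy_def)

definition commit :: "'q \<Rightarrow> 'u" where
  "commit q = (THE t. t \<in> place_post \<sigma> q)"

definition commit_place :: "'q \<Rightarrow> 'q" where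
  "commit_place q = (THE q'. q' \<in> post \<sigma> (commit q))"

definition commitment :: "'q \<Rightarrow> 'a set" where
  "commitment q = (THE A. \<exists>x. plab \<sigma> (commit_place q) = Env x A)"

text \<open>Only a \<open>Tau\<close> transition consumes a system place, and labels are bijective
  on presets and postsets, so the unique consumer has exactly one place before and one after it.
  This justifies the definite descriptions in \<open>commit\<close>, \<open>commit_place\<close> and
  \<open>commitment\<close>.\<close>

lemma
  assumes q: "q \<in> places \<sigma>" "plab \<sigma> q = Sys x"
  shows commit_mem: "commit q \<in> transitions \<sigma>"
    and commit_unique: "t \<in> transitions \<sigma> \<Longrightarrow> q \<in> pre \<sigma> t \<Longrightarrow> t = commit q"
    and commit_pre: "pre \<sigma> (commit q) = {q}"
    and commit_post: "post \<sigma> (commit q) = {commit_place q}"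
    and plab_commit_place: "plab \<sigma> (commit_place q) = Env x (commitment q)"
    and commitment_mem: "commitment q \<in> commitments C x"
    and tlab_commit: "tlab \<sigma> (commit q) = Tau x (commitment q)"
proof -
  have "plab \<sigma> q \<in> places (game_of C)" using q branching by (auto simp: branching_process_of_def)
  then have "plab \<sigma> q \<in> sys_places (game_of C)"
    using q by (auto simp: places_game_of commitment_places_def)
  then have ex1: "\<exists>!t. t \<in> place_post \<sigma> q" using commits q by (auto simp: always_commits_def)
  then have "commit q \<in> place_post \<sigma> q" unfolding commit_def by (rule theI')
  then have t: "commit q \<in> transitions \<sigma>" and qt: "q \<in> pre \<sigma> (commit q)"
    by (auto simp: place_post_def)
  show "commit q \<in> transitions \<sigma>" by fact
  show "t \<in> transitions \<sigma> \<Longrightarrow> q \<in> pre \<sigma> t \<Longrightarrow> t = commit q" for t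
    using ex1 \<open>commit q \<in> place_post \<sigma> q\<close> by (auto simp: place_post_def)
  have "Sys x \<in> gpre C (tlab \<sigma> (commit q))"
    using pre_bij[OF t] qt q by (force simp: bij_betw_def)
  then obtain A where A: "A \<in> commitments C x" "tlab \<sigma> (commit q) = Tau x A"
    using Sys_in_gpre[OF tlab_mem[OF t]] by blast
  show "pre \<sigma> (commit q) = {q}"
  proof -
    have "q' = q" if "q' \<in> pre \<sigma> (commit q)" for q'
      using pre_bij[OF t] qt q A that by (fastforce simp: bij_betw_def inj_on_def)
    then show ?thesis using qt by blast
  qed
  have post: "bij_betw (plab \<sigma>) (post \<sigma> (commit q)) {Env x A}" using post_bij[OF t] A by simp
  then obtain q' where q': "post \<sigma> (commit q) = {q'}"
    using bij_betw_same_card[OF post] card_1_singletonE by (metis card.empty card_insert_disjoint empty_iff finite.emptyI One_nat_def)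
  then have q'': "commit_place q = q'" by (simp add: commit_place_def)
  then show "post \<sigma> (commit q) = {commit_place q}" using q' by simp
  have lab: "plab \<sigma> (commit_place q) = Env x A" using post q' q'' by (auto simp: bij_betw_def)
  then have "commitment q = A" by (simp add: commitment_def)
  then show "plab \<sigma> (commit_place q) = Env x (commitment q)" "commitment q \<in> commitments C x"
    "tlab \<sigma> (commit q) = Tau x (commitment q)" using lab A by simp_all
qed

section \<open>Cuts of a committing strategy, up to commitments\<close>

definition is_cut :: "('p \<Rightarrow> 's) \<Rightarrow> ('p \<Rightarrow> 'q) \<Rightarrow> bool" where
  "is_cut s c \<longleftrightarrow> s \<in> global_states C \<and> (\<forall>p\<in>procs C. c p \<in> places \<sigma> \<and> plab \<sigma> (c p) = Sys (s p))"

text \<open>The cut \<open>c\<close> always records the system place of a process, even after its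
  commitment; \<open>Q\<close> tells which processes have moved on to the corresponding commitment
  place.\<close>

definition mix :: "('p \<Rightarrow> 'q) \<Rightarrow> 'p set \<Rightarrow> 'q set" where
  "mix c Q = (\<lambda>p. commit_place (c p)) ` Q \<union> c ` (procs C - Q)"

lemma plab_mix:
  assumes "is_cut s c" "Q \<subseteq> procs C"
  shows "plab \<sigma> ` mix c Q = game_marking C s (\<lambda>p. commitment (c p)) Q"
proof -
  have "plab \<sigma> (commit_place (c p)) = Env (s p) (commitment (c p))" if "p \<in> Q" for p
    using assms that by (auto simp: is_cut_def intro: plab_commit_place)
  then show ?thesis
    using assms by (auto simp: mix_def game_marking_def image_Un image_image is_cut_def)
qed

lemma
  assumes c: "is_cut s c" and p: "p \<in> procs C"
  shows cut_plab: "plab \<sigma> (c p) = Sys (s p)"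
    and cut_commit_plab: "plab \<sigma> (commit_place (c p)) = Env (s p) (commitment (c p))"
  using c p plab_commit_place by (auto simp: is_cut_def)

lemma cut_inj: "is_cut s c \<Longrightarrow> p \<in> procs C \<Longrightarrow> p' \<in> procs C \<Longrightarrow> c p = c p' \<Longrightarrow> p = p'"
  using cut_plab global_state_eq_iff[of s s p p'] by (metis gplace.inject(1) is_cut_def)

lemma cut_commit_inj:
  "is_cut s c \<Longrightarrow> p \<in> procs C \<Longrightarrow> p' \<in> procs C \<Longrightarrow> commit_place (c p) = commit_place (c p') \<Longrightarrow> p = p'"
  using cut_commit_plab global_state_eq_iff[of s s p p'] by (metis gplace.inject(2) is_cut_def)

lemma inj_on_mix:
  assumes "is_cut s c" "Q \<subseteq> procs C" shows "inj_on (plab \<sigma>) (mix c Q)"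
proof (rule inj_onI)
  fix x y assume xy: "x \<in> mix c Q" "y \<in> mix c Q" "plab \<sigma> x = plab \<sigma> y"
  have s: "s \<in> global_states C" using assms by (simp add: is_cut_def)
  show "x = y"
    using xy assms(2) cut_plab[OF assms(1)] cut_commit_plab[OF assms(1)]
      global_state_eq_iff[OF s s]
    by (auto simp: mix_def subset_iff) metis+
qed

lemma mix_tau:
  assumes c: "is_cut s c" and Q: "Q \<subseteq> procs C" and p: "p \<in> procs C - Q"
  shows "enabled \<sigma> (mix c Q) (commit (c p))"
    "fire \<sigma> (mix c Q) (commit (c p)) = mix c (insert p Q)"
proof -
  have cp: "c p \<in> places \<sigma>" "plab \<sigma> (c p) = Sys (s p)" using c p by (auto simp: is_cut_def)
  note commit = commit_mem[OF cp] commit_pre[OF cp] commit_post[OF cp]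
  show "enabled \<sigma> (mix c Q) (commit (c p))"
    using p commit by (auto simp: enabled_def mix_def)
  have "commit_place (c p') \<noteq> c p" "c p \<noteq> commit_place (c p')" if "p' \<in> Q" for p'
    using cut_commit_plab[OF c, of p'] cp that Q by auto
  then show "fire \<sigma> (mix c Q) (commit (c p)) = mix c (insert p Q)"
    using commit p Q cut_inj[OF c] by (auto simp: fire_def mix_def)
qed

text \<open>Commitments of different processes do not interfere and can be added one by one. With
  \<open>Q0\<close> empty this gives reachability of all mixtures; with \<open>Q\<close> all
  processes it supplies the internal steps before an action.\<close>

lemma mix_reachable:
  assumes c: "is_cut s c" and Q: "Q \<subseteq> procs C" and Q0: "Q0 \<subseteq> procs C"
    and "mix c Q0 \<in> reachable \<sigma>"
  shows "mix c (Q0 \<union> Q) \<in> reachable \<sigma> \<and> (obs_step \<sigma> None)\<^sup>*\<^sup>* (mix c Q0) (mix c (Q0 \<union> Q))"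
proof -
  have "finite Q" using Q finite_procs finite_subset by blast
  then show ?thesis using Q
  proof (induction Q rule: finite_induct)
    case (insert p Q)
    show ?case
    proof (cases "p \<in> Q0")
      case False
      then have p: "p \<in> procs C - (Q0 \<union> Q)" and sub: "Q0 \<union> Q \<subseteq> procs C" using insert Q0 by auto
      note tau = mix_tau[OF c sub p]
      have "tlab \<sigma> (commit (c p)) = Tau (s p) (commitment (c p))"
        using c p by (intro tlab_commit) (auto simp: is_cut_def)
      then have "obs_step \<sigma> None (mix c (Q0 \<union> Q)) (mix c (insert p (Q0 \<union> Q)))"
        using tau unfolding obs_step_def by (metis obs.simps(2))
      moreover have "mix c (insert p (Q0 \<union> Q)) \<in> reachable \<sigma>"
        using insert tau reachable.fire by (metis insert_subset)
      ultimately show ?thesis using insert by (auto intro: rtranclp.rtrancl_into_rtrancl)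
    qed (use insert in \<open>auto simp: insert_absorb\<close>)
  qed (use assms(4) in simp)
qed

section \<open>Runs of the strategy as sequences of cuts\<close>

definition init_cut :: "'p \<Rightarrow> 'q" where
  "init_cut p = (THE q. q \<in> init_marking \<sigma> \<and> plab \<sigma> q = Sys (init_state C p))"

definition next_cut :: "('p \<Rightarrow> 'q) \<Rightarrow> 'u \<Rightarrow> 'a \<Rightarrow> ('p \<Rightarrow> 's) \<Rightarrow> 'p \<Rightarrow> 'q" where
  "next_cut c t a s' =
     (\<lambda>p. if p \<in> dmn C a then THE q. q \<in> post \<sigma> t \<and> plab \<sigma> q = Sys (s' p) else c p)"

definition cut_step :: "('p \<Rightarrow> 's) \<Rightarrow> ('p \<Rightarrow> 'q) \<Rightarrow> 'a \<Rightarrow> 'u \<Rightarrow> ('p \<Rightarrow> 's) \<Rightarrow> ('p \<Rightarrow> 'q) \<Rightarrow> bool" where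
  "cut_step s c a t s' c' \<longleftrightarrow> step C s a s' \<and> t \<in> transitions \<sigma> \<and> (\<exists>B A. tlab \<sigma> t = Act a B A)
     \<and> pre \<sigma> t = (\<lambda>p. commit_place (c p)) ` dmn C a \<and> c' = next_cut c t a s'"

inductive cut_exec :: "'a list \<Rightarrow> ('p \<Rightarrow> 's) \<Rightarrow> ('p \<Rightarrow> 'q) \<Rightarrow> bool" where
  cut_exec_Nil: "cut_exec [] (init_state C) init_cut"
| cut_exec_snoc: "cut_exec u s c \<Longrightarrow> cut_step s c a t s' c' \<Longrightarrow> cut_exec (u @ [a]) s' c'"

lemma cut_exec_Nil_iff: "cut_exec [] s c \<longleftrightarrow> s = init_state C \<and> c = init_cut"
  by (auto elim: cut_exec.cases intro: cut_exec_Nil)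

lemma cut_exec_snoc_iff:
  "cut_exec (u @ [a]) s' c' \<longleftrightarrow> (\<exists>s c t. cut_exec u s c \<and> cut_step s c a t s' c')"
proof
  assume "cut_exec (u @ [a]) s' c'"
  then show "\<exists>s c t. cut_exec u s c \<and> cut_step s c a t s' c'"
    by (cases rule: cut_exec.cases) auto
qed (blast intro: cut_exec_snoc)

lemma init_cut: "is_cut (init_state C) init_cut" "mix init_cut {} = init_marking \<sigma>"
proof -
  have i: "init_cut p \<in> init_marking \<sigma> \<and> plab \<sigma> (init_cut p) = Sys (init_state C p)"
    if p: "p \<in> procs C" for p
  proof -
    have "Sys (init_state C p) \<in> plab \<sigma> ` init_marking \<sigma>"
      using init_bij p by (simp add: bij_betw_def)
    then have "\<exists>!q. q \<in> init_marking \<sigma> \<and> plab \<sigma> q = Sys (init_state C p)"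
      using init_bij by (force simp: bij_betw_def inj_on_def)
    then show ?thesis unfolding init_cut_def by (rule theI')
  qed
  then show "is_cut (init_state C) init_cut"
    using init_state by (auto simp: is_cut_def init_eq)
  have "plab \<sigma> ` init_cut ` procs C = plab \<sigma> ` init_marking \<sigma>"
    using i init_bij by (force simp: bij_betw_def image_image)
  then have "init_cut ` procs C = init_marking \<sigma>"
    using i init_bij by (subst (asm) inj_on_image_eq_iff) (auto simp: bij_betw_def)
  then show "mix init_cut {} = init_marking \<sigma>" by (simp add: mix_def)
qed

text \<open>The labels of the preset already spell out the state and the commitments of the
  participants, and these fix the game transition.\<close>

lemma cut_step_label:
  assumes c: "is_cut s c" and st: "cut_step s c a t s' c'"
  shows "tlab \<sigma> t = Act a (restrict s (dmn C a)) (family a s (\<lambda>p. commitment (c p)))"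
proof -
  obtain B A where lab: "tlab \<sigma> t = Act a B A" and t: "t \<in> transitions \<sigma>"
    and pr: "pre \<sigma> t = (\<lambda>p. commit_place (c p)) ` dmn C a" and a: "a \<in> acts C"
    using st by (auto simp: cut_step_def step_def)
  have D: "dmn C a \<subseteq> procs C" using a dmn_subset by blast
  have "gpre C (Act a B A) = plab \<sigma> ` pre \<sigma> t" using pre_bij[OF t] lab by (simp add: bij_betw_def)
  also have "\<dots> \<subseteq> game_marking C s (\<lambda>p. commitment (c p)) (dmn C a)"
    unfolding plab_mix[OF c D, symmetric] pr mix_def by blast
  finally show ?thesis
    using act_eq_family[OF _ _ _ D, of a B A s] tlab_mem[OF t] c lab by (auto simp: is_cut_def)
qed

lemma cut_step_post:
  assumes c: "is_cut s c" and st: "cut_step s c a t s' c'"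
  shows "is_cut s' c'" "post \<sigma> t = c' ` dmn C a"
proof -
  have t: "t \<in> transitions \<sigma>" and stp: "step C s a s'" and c': "c' = next_cut c t a s'"
    using st by (auto simp: cut_step_def)
  have post: "bij_betw (plab \<sigma>) (post \<sigma> t) ((\<lambda>p. Sys (s' p)) ` dmn C a)"
    using post_bij[OF t] step_delta[OF stp]
    by (simp add: cut_step_label[OF c st] image_image cong: image_cong)
  have i: "c' p \<in> post \<sigma> t \<and> plab \<sigma> (c' p) = Sys (s' p)" if p: "p \<in> dmn C a" for p
  proof -
    have "Sys (s' p) \<in> plab \<sigma> ` post \<sigma> t" using post p by (simp add: bij_betw_def)
    then have "\<exists>!q. q \<in> post \<sigma> t \<and> plab \<sigma> q = Sys (s' p)"
      using post by (force simp: bij_betw_def inj_on_def)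
    then have "(\<lambda>q. q \<in> post \<sigma> t \<and> plab \<sigma> q = Sys (s' p)) (c' p)"
      unfolding c' next_cut_def using p by (simp only: if_True) (rule theI')
    then show ?thesis by simp
  qed
  have "c' p = c p \<and> s' p = s p" if "p \<notin> dmn C a" for p
    using that step_outside[OF stp] by (simp add: c' next_cut_def)
  moreover have "s' \<in> global_states C" using stp by (simp add: step_def)
  moreover have "c' p \<in> places \<sigma> \<and> plab \<sigma> (c' p) = Sys (s' p)" if "p \<in> procs C" for p
  proof (cases "p \<in> dmn C a")
    case True
    then show ?thesis using i post_places[OF t] by blast
  next
    case False
    then show ?thesis using calculation c that by (simp add: is_cut_def)
  qed
  ultimately show "is_cut s' c'" by (simp add: is_cut_def)
  have "plab \<sigma> ` c' ` dmn C a = plab \<sigma> ` post \<sigma> t"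
    using i post by (force simp: bij_betw_def image_image)
  then show "post \<sigma> t = c' ` dmn C a"
    using i post by (subst (asm) inj_on_image_eq_iff) (auto simp: bij_betw_def)
qed

lemma cut_exec_is_cut: "cut_exec u s c \<Longrightarrow> is_cut s c"
  by (induction rule: cut_exec.induct) (auto intro: init_cut cut_step_post)

lemma cut_exec_exec: "cut_exec u s c \<Longrightarrow> exec C u s"
  by (induction rule: cut_exec.induct) (auto simp: cut_step_def intro: exec.intros)

lemma mix_act:
  assumes c: "is_cut s c" and Q: "Q \<subseteq> procs C" and D: "dmn C a \<subseteq> Q"
    and st: "cut_step s c a t s' c'"
  shows "enabled \<sigma> (mix c Q) t" "fire \<sigma> (mix c Q) t = mix c' (Q - dmn C a)"
proof -
  have t: "t \<in> transitions \<sigma>" and pr: "pre \<sigma> t = (\<lambda>p. commit_place (c p)) ` dmn C a"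
    and c': "c' = next_cut c t a s'"
    using st by (auto simp: cut_step_def)
  show "enabled \<sigma> (mix c Q) t" using t pr D by (auto simp: enabled_def mix_def)
  have out: "c p = c' p" if "p \<notin> dmn C a" for p using that by (simp add: c' next_cut_def)
  have "mix c Q - pre \<sigma> t = (\<lambda>p. commit_place (c p)) ` (Q - dmn C a) \<union> c ` (procs C - Q)"
  proof -
    have "inj_on (\<lambda>p. commit_place (c p)) Q"
      using cut_commit_inj[OF c] Q by (auto intro!: inj_onI)
    then have "(\<lambda>p. commit_place (c p)) ` (Q - dmn C a) = (\<lambda>p. commit_place (c p)) ` Q - pre \<sigma> t"
      unfolding pr using D by (intro inj_on_image_set_diff) auto
    moreover have "c p \<notin> pre \<sigma> t" if "p \<in> procs C" for p
      using that D Q cut_commit_plab[OF c] cut_plab[OF c, of p] unfolding pr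
      by (metis (no_types, lifting) gplace.distinct(1) imageE subsetD)
    ultimately show ?thesis unfolding mix_def by auto
  qed
  also have "\<dots> = (\<lambda>p. commit_place (c' p)) ` (Q - dmn C a) \<union> c' ` (procs C - Q)"
    using D by (intro arg_cong2[of _ _ _ _ "(\<union>)"] image_cong) (use out in auto)
  also have "\<dots> \<union> post \<sigma> t = mix c' (Q - dmn C a)"
  proof -
    have "procs C - (Q - dmn C a) = (procs C - Q) \<union> dmn C a" using D Q by blast
    then show ?thesis unfolding mix_def cut_step_post(2)[OF c st] by auto
  qed
  finally show "fire \<sigma> (mix c Q) t = mix c' (Q - dmn C a)" by (simp add: fire_def)
qed

lemma cut_exec_reachable:
  assumes "cut_exec u s c" "Q \<subseteq> procs C" shows "mix c Q \<in> reachable \<sigma>"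
  using assms
proof (induction arbitrary: Q rule: cut_exec.induct)
  case cut_exec_Nil
  have "mix init_cut ({} \<union> Q) \<in> reachable \<sigma>"
    using mix_reachable[OF init_cut(1) cut_exec_Nil, of "{}"] init_cut(2) reachable.init[of \<sigma>]
    by simp
  then show ?case by simp
next
  case (cut_exec_snoc u s c a t s' c')
  have c: "is_cut s c" using cut_exec_snoc cut_exec_is_cut by blast
  have D: "dmn C a \<subseteq> procs C" using cut_exec_snoc dmn_subset by (auto simp: cut_step_def step_def)
  \<comment> \<open>Exactly the participants of \<open>a\<close> commit before it. After the action
    nobody is committed, so any set \<open>Q\<close> can be committed afresh.\<close>
  have "mix c' {} \<in> reachable \<sigma>"
    using mix_act[OF c D _ cut_exec_snoc(2)] cut_exec_snoc(3)[OF D] reachable.fire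
    by (metis Diff_cancel order_refl)
  then show ?case
    using mix_reachable[OF cut_step_post(1)[OF c cut_exec_snoc(2)] cut_exec_snoc(4), of "{}"] by simp
qed

text \<open>The cut fixes preset and label of \<open>t\<close>, and a branching process has no two
  transitions agreeing in both.\<close>

lemma cut_step_determ:
  assumes "is_cut s c" "cut_step s c a t s' c'" "cut_step s c a t2 s2 c2"
  shows "s' = s2 \<and> c' = c2"
proof -
  have "s' = s2" using assms step_determ by (auto simp: cut_step_def)
  moreover have "t = t2"
  proof (rule label_unique)
    show "tlab \<sigma> t = tlab \<sigma> t2"
      using cut_step_label[OF assms(1,2)] cut_step_label[OF assms(1,3)] by simp
  qed (use assms in \<open>auto simp: cut_step_def\<close>)
  ultimately show ?thesis using assms by (simp add: cut_step_def)
qed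

lemma cut_exec_determ: "cut_exec u s c \<Longrightarrow> cut_exec u s' c' \<Longrightarrow> s = s' \<and> c = c'"
proof (induction u arbitrary: s c s' c' rule: rev_induct)
  case Nil
  then show ?case by (simp add: cut_exec_Nil_iff)
next
  case (snoc a u)
  obtain s1 c1 t1 where 1: "cut_exec u s1 c1" "cut_step s1 c1 a t1 s c"
    using snoc.prems(1) by (auto simp: cut_exec_snoc_iff)
  obtain s2 c2 t2 where 2: "cut_exec u s2 c2" "cut_step s2 c2 a t2 s' c'"
    using snoc.prems(2) by (auto simp: cut_exec_snoc_iff)
  then show ?case using snoc.IH[OF 1(1) 2(1)] 1 cut_step_determ cut_exec_is_cut by metis
qed

text \<open>Independent actions change disjoint components of the cut, so the same two transitions
  occur in the opposite order.\<close>

lemma cut_step_swap: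
  assumes ab: "dmn C a \<inter> dmn C b = {}"
    and a: "cut_step s c a ta s1 c1" and b: "cut_step s1 c1 b tb s2 c2"
  shows "\<exists>s1' c1'. cut_step s c b tb s1' c1' \<and> cut_step s1' c1' a ta s2 c2"
proof -
  have "step C s a s1" "step C s1 b s2" using a b by (auto simp: cut_step_def)
  then obtain s1' where s1': "step C s b s1'" "step C s1' a s2" using step_swap[OF ab] by blast
  define c1' where "c1' = next_cut c tb b s1'"
  have c1: "c1 = next_cut c ta a s1" and c2: "c2 = next_cut c1 tb b s2"
    using a b by (auto simp: cut_step_def)
  have "s2 p = s1' p" if "p \<in> dmn C b" for p using that ab step_outside[OF s1'(2)] by blast
  moreover have "s2 p = s1 p" if "p \<in> dmn C a" for p
    using that ab step_outside[of C s1 b s2] b by (auto simp: cut_step_def)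
  ultimately have eq: "c2 = next_cut c1' ta a s2"
    using ab unfolding c1 c2 c1'_def next_cut_def by (auto simp: fun_eq_iff)
  have "c1 p = c p" if "p \<in> dmn C b" for p using that ab by (auto simp: c1 next_cut_def)
  then have "cut_step s c b tb s1' c1'"
    using b s1' by (auto simp: cut_step_def c1'_def)
  moreover have "c1' p = c p" if "p \<in> dmn C a" for p using that ab by (auto simp: c1'_def next_cut_def)
  then have "cut_step s1' c1' a ta s2 c2"
    using a s1' eq by (auto simp: cut_step_def)
  ultimately show ?thesis by blast
qed

lemma commute_cut_exec: "commute C u v \<Longrightarrow> cut_exec u s c \<Longrightarrow> cut_exec v s c"
proof (induction arbitrary: s c rule: commute.induct)
  case (1 a b u v)
  from 1(2) show ?case
  proof (induction v arbitrary: s c rule: rev_induct)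
    case Nil
    then have "cut_exec ((u @ [a]) @ [b]) s c" by simp
    then have "cut_exec ((u @ [b]) @ [a]) s c"
      unfolding cut_exec_snoc_iff using cut_step_swap[OF 1(1)] by blast
    then show ?case by simp
  next
    case (snoc x v)
    then show ?case
      using cut_exec_snoc_iff[of "u @ [a, b] @ v"] cut_exec_snoc_iff[of "u @ [b, a] @ v"]
      by (metis append_assoc)
  qed
qed

lemma trace_eq_cut_exec: "trace_eq C u v \<Longrightarrow> cut_exec u s c \<Longrightarrow> cut_exec v s c"
  by (erule trace_eq_closed) (auto intro: commute_cut_exec)

lemma cut_exec_append_outside:
  assumes "cut_exec (u @ w) s' c'" "\<forall>a\<in>set w. p \<notin> dmn C a"
  shows "\<exists>s c. cut_exec u s c \<and> c p = c' p"
  using assms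
proof (induction w arbitrary: s' c' rule: rev_induct)
  case (snoc a w)
  then obtain s c t where *: "cut_exec (u @ w) s c" "cut_step s c a t s' c'"
    by (metis append_assoc cut_exec_snoc_iff)
  then have "c' p = c p" using snoc.prems(2) by (simp add: cut_step_def next_cut_def)
  then show ?case using snoc.IH[OF *(1)] snoc.prems(2) by simp
qed auto

text \<open>An existential over representatives avoids choosing one. Invariance and determinism of
  \<open>cut_exec\<close> make it single-valued on views of runs; on a trace without a run it is
  empty.\<close>

definition induced_controller :: "('p, 'a) controller" where
  "induced_controller p V = {a. \<exists>u s c. V = trace C u \<and> cut_exec u s c \<and> a \<in> commitment (c p)}"

lemma induced_controller_view:
  assumes "cut_exec u s c"
  shows "induced_controller p (view C p (trace C u)) = commitment (c p)"
proof -
  have u: "set u \<subseteq> acts C" using assms cut_exec_exec exec_acts by blast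
  have "cut_exec (past C {p} u @ rest C {p} u) s c"
    using trace_eq_cut_exec[OF trace_eq_past_rest[OF u] assms] .
  then obtain s' c' where c': "cut_exec (past C {p} u) s' c'" "c' p = c p"
    using cut_exec_append_outside rest_indep by (metis disjoint_iff singletonI)
  have "commitment (c2 p) = commitment (c p)"
    if "trace C (past C {p} u) = trace C v" "cut_exec v s2 c2" for v s2 c2
  proof -
    have "cut_exec (past C {p} u) s2 c2"
      using that trace_eq_iff trace_eq_sym trace_eq_cut_exec by metis
    then show ?thesis using cut_exec_determ c' by metis
  qed
  moreover have "\<exists>v s c. trace C (past C {p} u) = trace C v \<and> cut_exec v s c \<and> x \<in> commitment (c p)"
    if "x \<in> commitment (c p)" for x
    using c' that by metis
  ultimately show ?thesis
    unfolding view_trace[OF u] induced_controller_def by blast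
qed

lemma cut_exec_ctrl_exec: "cut_exec u s c \<Longrightarrow> ctrl_exec C induced_controller u s"
proof (induction rule: cut_exec.induct)
  case cut_exec_Nil
  then show ?case by (rule ctrl_exec_Nil)
next
  case (cut_exec_snoc u s c a t s' c')
  have c: "is_cut s c" using cut_exec_snoc cut_exec_is_cut by blast
  have a: "step C s a s'" "a \<in> acts C" and t: "t \<in> transitions \<sigma>"
    using cut_exec_snoc by (auto simp: cut_step_def step_def)
  have s: "s \<in> global_states C" using c by (simp add: is_cut_def)
  have "a \<in> env_acts C \<or> a \<in> sys_acts C \<and> (\<forall>p\<in>dmn C a. a \<in> commitment (c p))"
    using tlab_mem[OF t] family_apply[OF s a(2)]
    by (simp add: cut_step_label[OF c cut_exec_snoc(2)] act_mem)
  then have "allowed C induced_controller u a"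
    using induced_controller_view[OF cut_exec_snoc(1)] by (auto simp: allowed_def)
  then show ?case using cut_exec_snoc a by (blast intro: ctrl_exec_snoc)
qed

text \<open>The preset of the wanted transition consists of environment places only, so no place can
  refuse and justified refusal forces the transition to exist.\<close>

lemma cut_step_exists:
  assumes u: "cut_exec u s c" and a: "step C s a s'"
    and al: "a \<in> env_acts C \<or> a \<in> sys_acts C \<and> (\<forall>p\<in>dmn C a. a \<in> commitment (c p))"
  shows "\<exists>t c'. cut_step s c a t s' c'"
proof -
  have c: "is_cut s c" using u cut_exec_is_cut by blast
  have s: "s \<in> global_states C" and aC: "a \<in> acts C" using a by (auto simp: step_def)
  have D: "dmn C a \<subseteq> procs C" using aC dmn_subset by blast
  define t where "t = Act a (restrict s (dmn C a)) (family a s (\<lambda>p. commitment (c p)))"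
  define E where "E = (\<lambda>p. commit_place (c p)) ` dmn C a"
  note jr = winning[unfolded winning_strategy_def strategy_def justified_refusal_def,
      THEN conjunct1, THEN conjunct2]
  have "t \<in> transitions (game_of C)"
    unfolding t_def using D c
    by (intro family_mem[OF a _ al] commitment_mem) (auto simp: is_cut_def)
  moreover have E: "E \<subseteq> mix c (procs C)" using D by (auto simp: E_def mix_def)
  moreover have "mix c (procs C) \<in> reachable \<sigma>" using cut_exec_reachable[OF u] by simp
  moreover have lab: "plab \<sigma> ` E = gpre C t"
    unfolding E_def t_def gpre_family[OF s aC] image_image
    using D cut_commit_plab[OF c] by (intro image_cong) auto
  moreover have "E \<subseteq> places \<sigma>"
    unfolding E_def using D c commit_post commit_mem post_places unfolding is_cut_def by blast
  ultimately have "(\<exists>t'\<in>transitions \<sigma>. tlab \<sigma> t' = t \<and> pre \<sigma> t' = E) \<or>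
      (\<exists>q\<in>E. plab \<sigma> q \<in> sys_places (game_of C) \<and> t \<notin> tlab \<sigma> ` place_post \<sigma> q)"
    using jr[rule_format, of E t] reachable_concurrent[of "mix c (procs C)"]
    by (simp add: subset_iff)
  moreover have "plab \<sigma> q \<notin> sys_places (game_of C)" if "q \<in> E" for q
    using that D cut_commit_plab[OF c] by (auto simp: E_def)
  ultimately obtain t' where "t' \<in> transitions \<sigma>" "tlab \<sigma> t' = t" "pre \<sigma> t' = E" by blast
  then show ?thesis using a by (auto simp: cut_step_def t_def E_def)
qed

lemma ctrl_exec_cut_exec: "ctrl_exec C induced_controller u s \<Longrightarrow> \<exists>c. cut_exec u s c"
proof (induction rule: ctrl_exec.induct)
  case ctrl_exec_Nil
  then show ?case using cut_exec_Nil by blast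
next
  case (ctrl_exec_snoc u s a s')
  then obtain c where c: "cut_exec u s c" by blast
  have "a \<in> env_acts C \<or> a \<in> sys_acts C \<and> (\<forall>p\<in>dmn C a. a \<in> commitment (c p))"
    using ctrl_exec_snoc(3) induced_controller_view[OF c] by (auto simp: allowed_def)
  then show ?case using cut_step_exists[OF c ctrl_exec_snoc(2)] c cut_exec_snoc by blast
qed

text \<open>Complete list of moves from a mixture, on which both the invariant of reachable markings
  and the bisimulation rest.\<close>

lemma enabled_mix_cases:
  assumes u: "cut_exec u s c" and Q: "Q \<subseteq> procs C" and t: "enabled \<sigma> (mix c Q) t"
  obtains (act) a s' c' where "cut_step s c a t s' c'" "dmn C a \<subseteq> Q" "obs (tlab \<sigma> t) = Some a"
      "\<And>M. tlab \<sigma> t \<noteq> DL M"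
    | (tau) p where "p \<in> procs C - Q" "t = commit (c p)" "obs (tlab \<sigma> t) = None"
      "\<And>M. tlab \<sigma> t \<noteq> DL M"
proof -
  have c: "is_cut s c" using u cut_exec_is_cut by blast
  have s: "s \<in> global_states C" using c by (simp add: is_cut_def)
  have tt: "t \<in> transitions \<sigma>" "pre \<sigma> t \<subseteq> mix c Q" using t by (auto simp: enabled_def)
  have lab: "plab \<sigma> ` pre \<sigma> t = gpre C (tlab \<sigma> t)" using pre_bij[OF tt(1)] by (simp add: bij_betw_def)
  show thesis
  proof (cases "tlab \<sigma> t")
    case (Act a B A)
    have memt: "Act a B A \<in> transitions (game_of C)" using tlab_mem[OF tt(1)] Act by simp
    have sub: "gpre C (Act a B A) \<subseteq> game_marking C s (\<lambda>p. commitment (c p)) Q"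
      using image_mono[OF tt(2), of "plab \<sigma>"] lab Act plab_mix[OF c Q] by simp
    note B = act_eq_family[OF memt sub s Q]
    have D: "dmn C a \<subseteq> Q" using act_pre_subset[OF memt sub s Q] by blast
    have a: "a \<in> acts C" and "delta C a B \<noteq> None" using memt by (auto simp: act_mem)
    then obtain s' where s': "step C s a s'" using delta_step[OF s a] B by blast
    define E where "E = (\<lambda>p. commit_place (c p)) ` dmn C a"
    have "plab \<sigma> ` E = plab \<sigma> ` pre \<sigma> t"
      unfolding lab Act B gpre_family[OF s a] E_def image_image
      using D Q cut_commit_plab[OF c] by (intro image_cong) auto
    then have "E = pre \<sigma> t"
      using tt(2) D inj_on_mix[OF c Q]
      by (subst (asm) inj_on_image_eq_iff[of _ "mix c Q"]) (auto simp: E_def mix_def)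
    then have "cut_step s c a t s' (next_cut c t a s')"
      using s' tt Act by (simp add: cut_step_def E_def)
    then show thesis using D Act by (intro act) auto
  next
    case (Tau x A)
    then obtain q where q: "q \<in> pre \<sigma> t" "plab \<sigma> q = Sys x"
      using lab by (metis gpre.simps(2) imageE insertI1)
    then have "q \<in> mix c Q" using tt by blast
    then obtain p where p: "p \<in> procs C - Q" "q = c p"
      using q Q cut_commit_plab[OF c] by (auto simp: mix_def)
    then have "t = commit (c p)"
      using commit_unique[of "c p" "s p" t] c q tt by (auto simp: is_cut_def)
    then show thesis using p Tau by (intro tau) auto
  next
    case (DL M)
    \<comment> \<open>Firing a deadlock transition would reach a \<open>Bot\<close> place, which a
      winning strategy excludes.\<close>
    have "M \<in> deadlock_markings C" using tlab_mem[OF tt(1)] DL DL_mem by metis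
    then obtain p where "p \<in> procs C" using deadlock_procs_nonempty by blast
    then have "Bot p \<in> plab \<sigma> ` post \<sigma> t" using post_bij[OF tt(1)] DL by (auto simp: bij_betw_def)
    then obtain q where "q \<in> post \<sigma> t" and q: "plab \<sigma> q = Bot p" by (metis imageE)
    then have "q \<in> fire \<sigma> (mix c Q) t" by (simp add: fire_def)
    moreover have "fire \<sigma> (mix c Q) t \<in> reachable \<sigma>"
      using reachable.fire[OF cut_exec_reachable[OF u Q] t] .
    ultimately have "plab \<sigma> q \<notin> bad_places (game_of C)" using not_bad by blast
    then show thesis using q \<open>p \<in> procs C\<close> by simp
  qed
qed

text \<open>\<open>deadlock_markings\<close> demands reachability in the game without deadlock
  transitions. The shape of the marking is carried along because labels are injective on mixtures,
  which makes labelling commute with firing.\<close>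

lemma mix_base_reachable:
  assumes "M \<in> reachable \<sigma>"
  shows "(\<exists>u s c Q. cut_exec u s c \<and> Q \<subseteq> procs C \<and> M = mix c Q)
    \<and> plab \<sigma> ` M \<in> reachable (base_game C)"
  using assms
proof (induction rule: reachable.induct)
  case init
  have "plab \<sigma> ` init_marking \<sigma> = init_marking (base_game C)"
    using init_bij by (simp add: bij_betw_def)
  then show ?case using init_cut(2) cut_exec_Nil reachable.init by (metis empty_subsetI)
next
  case (fire M t)
  then obtain u s c Q where M: "cut_exec u s c" "Q \<subseteq> procs C" "M = mix c Q" by blast
  have c: "is_cut s c" using M cut_exec_is_cut by blast
  have t: "t \<in> transitions \<sigma>" "pre \<sigma> t \<subseteq> M" using fire by (auto simp: enabled_def)
  have notDL: "tlab \<sigma> t \<noteq> DL X" for X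
    using enabled_mix_cases[OF M(1,2)] fire(2) M(3) by metis
  have form: "\<exists>u s c Q. cut_exec u s c \<and> Q \<subseteq> procs C \<and> fire \<sigma> M t = mix c Q"
  proof (rule enabled_mix_cases[OF M(1,2) fire(2)[unfolded M(3)]])
    fix a s' c' assume act: "cut_step s c a t s' c'" "dmn C a \<subseteq> Q"
    show ?thesis
      using mix_act(2)[OF c M(2) act(2,1)] cut_exec_snoc[OF M(1) act(1)] M(2,3)
      by (intro exI[of _ "u @ [a]"] exI[of _ s'] exI[of _ c'] exI[of _ "Q - dmn C a"]) auto
  next
    fix p assume tau: "p \<in> procs C - Q" "t = commit (c p)"
    show ?thesis using mix_tau(2)[OF c M(2) tau(1)] M tau
      by (intro exI[of _ u] exI[of _ s] exI[of _ c] exI[of _ "insert p Q"]) auto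
  qed
  have labs: "plab \<sigma> ` pre \<sigma> t = gpre C (tlab \<sigma> t)" "plab \<sigma> ` post \<sigma> t = gpost C (tlab \<sigma> t)"
    using pre_bij[OF t(1)] post_bij[OF t(1)] by (auto simp: bij_betw_def)
  have "plab \<sigma> ` (M - pre \<sigma> t) = plab \<sigma> ` M - plab \<sigma> ` pre \<sigma> t"
    using inj_on_mix[OF c M(2)] t M(3) by (intro inj_on_image_set_diff[of _ M]) auto
  then have "plab \<sigma> ` fire \<sigma> M t = fire (base_game C) (plab \<sigma> ` M) (tlab \<sigma> t)"
    by (simp add: fire_def image_Un labs)
  moreover have "enabled (base_game C) (plab \<sigma> ` M) (tlab \<sigma> t)"
    using tlab_mem[OF t(1)] notDL image_mono[OF t(2), of "plab \<sigma>"] labs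
    by (simp add: enabled_def base_mem)
  ultimately show ?case using form fire reachable.fire by metis
qed

section \<open>The induced controller is winning and bisimilar\<close>

lemma induced_controller_controller: "controller C induced_controller"
proof -
  have "commitment (c p) \<subseteq> sys_acts C \<inter> acts_of C p"
    if u: "cut_exec u s c" and p: "p \<in> procs C" for u s c p
  proof -
    have "is_cut s c" using u cut_exec_is_cut by blast
    then have "commitment (c p) \<in> commitments C (s p)" "s p \<in> lstates C p"
      using p commitment_mem global_state_lstates by (auto simp: is_cut_def)
    then show ?thesis using en_acts_of[OF p] by (auto simp: commitments_def)
  qed
  then show ?thesis unfolding controller_def induced_controller_def by fastforce
qed

lemma induced_controller_deadlock_avoiding: "controller_deadlock_avoiding C induced_controller"
  unfolding controller_deadlock_avoiding_def
proof (intro ballI impI allI, elim conjE)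
  fix T v s
  assume T: "T \<in> plays C induced_controller"
    and max: "\<not> (\<exists>a. snoc C T a \<in> plays C induced_controller)"
    and v: "v \<in> T" "exec C v s"
  obtain u s' where u: "T = trace C u" "ctrl_exec C induced_controller u s'"
    using plays_ctrl_exec[OF T] by blast
  then have "s' = s"
    using v by (metis ctrl_exec_exec exec_determ mem_trace trace_eq_exec)
  then obtain c where cx: "cut_exec u s c" using u ctrl_exec_cut_exec by blast
  then have c: "is_cut s c" by (rule cut_exec_is_cut)
  \<comment> \<open>With everybody committed no internal transition remains, so anything enabled
    would be an action that extends the maximal play.\<close>
  define M where "M = mix c (procs C)"
  have M: "M \<in> reachable \<sigma>" using cut_exec_reachable[OF cx] by (simp add: M_def)
  have "\<not> enabled \<sigma> M t" for t
  proof
    assume "enabled \<sigma> M t"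
    then have "enabled \<sigma> (mix c (procs C)) t" by (simp add: M_def)
    then show False
    proof (rule enabled_mix_cases[OF cx order_refl])
      fix a s' c' assume act: "cut_step s c a t s' c'"
      then have "trace C (u @ [a]) \<in> plays C induced_controller"
        using cut_exec_ctrl_exec[OF cut_exec_snoc[OF cx act(1)]] ctrl_exec_plays by blast
      then show False using max u(1) by (auto simp: snoc_trace)
    qed blast
  qed
  then have fin: "final_marking (game_of C) (plab \<sigma> ` M)"
    using winning M by (auto simp: winning_strategy_def strategy_deadlock_avoiding_def final_marking_def)
  have lab: "plab \<sigma> ` M = game_marking C s (\<lambda>p. commitment (c p)) (procs C)"
    using plab_mix[OF c order_refl] by (simp add: M_def)
  show "final_state C s"
  proof (rule ccontr)
    assume "\<not> final_state C s"
    moreover have "plab \<sigma> ` M \<subseteq> commitment_places C"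
      using c commitment_mem global_state_lstates unfolding lab
      by (fastforce simp: game_marking_def commitment_places_def all_lstates_def is_cut_def)
    moreover have "final_marking (base_game C) (plab \<sigma> ` M)"
      using fin by (auto simp: final_marking_def enabled_def base_mem)
    moreover have "s ` procs C = zeta ` plab \<sigma> ` M"
      unfolding lab by (auto simp: game_marking_def image_image)
    ultimately have "plab \<sigma> ` M \<in> deadlock_markings C"
      using mix_base_reachable[OF M] c by (auto simp: deadlock_markings_def is_cut_def)
    then have "enabled (game_of C) (plab \<sigma> ` M) (DL (plab \<sigma> ` M))"
      by (simp add: enabled_def DL_mem)
    then show False using fin by (auto simp: final_marking_def)
  qed
qed

lemma induced_controller_safe:
  assumes "T \<in> plays C induced_controller" shows "\<not> visits_losing C T"
proof
  assume "visits_losing C T"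
  then obtain v w s p where v: "v @ w \<in> T" "exec C v s" "p \<in> procs C" "s p \<in> losing C p"
    by (auto simp: visits_losing_def)
  obtain u s' where u: "T = trace C u" "ctrl_exec C induced_controller u s'"
    using plays_ctrl_exec[OF assms] by blast
  then have "ctrl_exec C induced_controller (v @ w) s'"
    using v(1) trace_eq_ctrl_exec by (simp add: mem_trace)
  then obtain s'' where "ctrl_exec C induced_controller v s''" using ctrl_exec_prefix by blast
  then have "ctrl_exec C induced_controller v s" using v(2) ctrl_exec_exec exec_determ by metis
  then obtain c where cx: "cut_exec v s c" using ctrl_exec_cut_exec by blast
  have "mix c {} \<in> reachable \<sigma>" using cut_exec_reachable[OF cx] by simp
  moreover have "c p \<in> mix c {}" using v by (simp add: mix_def)
  ultimately have "plab \<sigma> (c p) \<notin> bad_places (game_of C)" by (rule not_bad)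
  then show False using v cut_plab[OF cut_exec_is_cut[OF cx]] by auto
qed

lemma induced_controller_winning: "winning_controller C induced_controller"
  using induced_controller_controller induced_controller_deadlock_avoiding induced_controller_safe
  by (simp add: winning_controller_def)

lemma induced_controller_bisimilar: "bisimilar C \<sigma> induced_controller"
proof -
  define R where "R = {(mix c Q, trace C u) | u s c Q. cut_exec u s c \<and> Q \<subseteq> procs C}"
  have R: "(mix c Q, trace C u) \<in> R" if "cut_exec u s c" "Q \<subseteq> procs C" for u s c Q
    using that by (auto simp: R_def)
  have RE: "\<exists>u s c Q. M = mix c Q \<and> T = trace C u \<and> cut_exec u s c \<and> Q \<subseteq> procs C"
    if "(M, T) \<in> R" for M T
    using that by (auto simp: R_def)
  show ?thesis
    unfolding bisimilar_def
  proof (intro exI[of _ R] conjI allI impI)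
    show "R \<subseteq> reachable \<sigma> \<times> plays C induced_controller"
      unfolding R_def using cut_exec_reachable ctrl_exec_plays[OF cut_exec_ctrl_exec] by blast
    show "(init_marking \<sigma>, trace C []) \<in> R"
      using R[OF cut_exec_Nil, of "{}"] init_cut(2) by simp
  next
    fix M T a M' assume "(M, T) \<in> R \<and> obs_step \<sigma> (Some a) M M'"
    then obtain u s c Q t where M: "M = mix c Q" "T = trace C u" and cx: "cut_exec u s c"
      and Q: "Q \<subseteq> procs C" and t: "enabled \<sigma> (mix c Q) t" "obs (tlab \<sigma> t) = Some a" "M' = fire \<sigma> M t"
      using RE unfolding obs_step_def by blast
    obtain s' c' where st: "cut_step s c a t s' c'" "dmn C a \<subseteq> Q"
      using enabled_mix_cases[OF cx Q t(1)] t(2) by (metis option.distinct(1) option.inject)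
    have "M' = mix c' (Q - dmn C a)" using mix_act(2)[OF cut_exec_is_cut[OF cx] Q st(2,1)] M t by simp
    moreover have cx': "cut_exec (u @ [a]) s' c'" using cut_exec_snoc[OF cx st(1)] .
    ultimately show "(M', snoc C T a) \<in> R" using R[OF cx', of "Q - dmn C a"] Q M by (auto simp: snoc_trace)
    show "snoc C T a \<in> plays C induced_controller"
      using ctrl_exec_plays[OF cut_exec_ctrl_exec[OF cx']] M by (simp add: snoc_trace)
  next
    fix M T M' assume "(M, T) \<in> R \<and> obs_step \<sigma> None M M'"
    then obtain u s c Q t where M: "M = mix c Q" "T = trace C u" and cx: "cut_exec u s c"
      and Q: "Q \<subseteq> procs C" and t: "enabled \<sigma> (mix c Q) t" "obs (tlab \<sigma> t) = None" "M' = fire \<sigma> M t"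
      using RE unfolding obs_step_def by blast
    obtain p where p: "p \<in> procs C - Q" "t = commit (c p)"
      using enabled_mix_cases[OF cx Q t(1)] t(2) by (metis option.distinct(1))
    then have "M' = mix c (insert p Q)" using mix_tau(2)[OF cut_exec_is_cut[OF cx] Q] M t by simp
    then show "(M', T) \<in> R" using R[OF cx, of "insert p Q"] p Q M by auto
  next
    fix M T a assume "(M, T) \<in> R \<and> snoc C T a \<in> plays C induced_controller"
    then obtain u s c Q where M: "M = mix c Q" "T = trace C u" and cx: "cut_exec u s c"
      and Q: "Q \<subseteq> procs C" and "trace C (u @ [a]) \<in> plays C induced_controller"
      using RE snoc_trace by metis
    then obtain s' where "ctrl_exec C induced_controller (u @ [a]) s'" using trace_plays by blast
    then obtain c' where cx': "cut_exec (u @ [a]) s' c'" using ctrl_exec_cut_exec by blast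
    then obtain t where st: "cut_step s c a t s' c'"
      using cx cut_exec_snoc_iff cut_exec_determ by metis
    have c: "is_cut s c" using cut_exec_is_cut[OF cx] .
    have D: "dmn C a \<subseteq> procs C" using st dmn_subset by (auto simp: cut_step_def step_def)
    \<comment> \<open>The processes that are still uncommitted commit before the action; the play
      does not change meanwhile.\<close>
    have "(obs_step \<sigma> None)\<^sup>*\<^sup>* M (mix c (procs C))"
      using mix_reachable[OF c order_refl Q cut_exec_reachable[OF cx Q]] Q M(1)
      by (simp add: Un_absorb1)
    moreover have "obs_step \<sigma> (Some a) (mix c (procs C)) (mix c' (procs C - dmn C a))"
      using mix_act[OF c order_refl D st] cut_step_label[OF c st] unfolding obs_step_def
      by (metis obs.simps(1))
    ultimately have "weak_step \<sigma> a M (mix c' (procs C - dmn C a))"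
      unfolding weak_step_def by blast
    then show "\<exists>M'. weak_step \<sigma> a M M' \<and> (M', snoc C T a) \<in> R"
      using R[OF cx', of "procs C - dmn C a"] M(2) by (auto simp: snoc_trace)
  qed
qed

end

section \<open>From controllers to strategies\<close>

lemma bij_betw_image_comp:
  assumes "inj_on g A" "\<And>x. x \<in> A \<Longrightarrow> f (h x) = g x" shows "bij_betw f (h ` A) (g ` A)"
  using assms by (force simp: bij_betw_def inj_on_def image_image)

text \<open>The places of the constructed strategy are pairs of a process and its view, once before and once
  after the commitment; an action is named by its label and the joint past of its participants.\<close>

datatype ('p, 'a) node =
    Sys_Place 'p "'a trace" | Env_Place 'p "'a trace" | Commit 'p "'a trace" | Event 'a "'a trace"

locale winning_control = control_game C
  for C :: "('p, 'a, 's) control_game" +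
  fixes \<rho> :: "('p, 'a) controller"
  assumes winning: "winning_controller C \<rho>"
begin

section \<open>Local states, choices and joint pasts of controlled plays\<close>

definition state_of :: "'a trace \<Rightarrow> 'p \<Rightarrow> 's" where
  "state_of V = (THE s. \<exists>u\<in>V. exec C u s)"

lemma state_of_trace:
  assumes "exec C u s" shows "state_of (trace C u) = s"
  unfolding state_of_def
proof (rule the_equality)
  show "\<exists>v\<in>trace C u. exec C v s" using assms mem_trace trace_eq_refl by metis
  show "s' = s" if "\<exists>v\<in>trace C u. exec C v s'" for s'
    using that assms by (metis exec_determ mem_trace trace_eq_exec)
qed

text \<open>The game admits only commitment sets inside \<open>en\<close>, whereas
  \<open>\<rho>\<close> may offer other actions as well. By \<open>allowed_iff_choice\<close> the
  restriction affects no executable action.\<close>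

definition choice :: "'p \<Rightarrow> 'a trace \<Rightarrow> 'a set" where
  "choice p V = \<rho> p V \<inter> en C (state_of V p)"

definition joint_past :: "'a \<Rightarrow> 'a list \<Rightarrow> 'a trace" where
  "joint_past a u = trace C (past C (dmn C a) u)"

abbreviation lview :: "'a list \<Rightarrow> 'p \<Rightarrow> 'a trace" where
  "lview u p \<equiv> view C p (trace C u)"

lemma ctrl_exec_acts: "ctrl_exec C \<rho> u s \<Longrightarrow> set u \<subseteq> acts C"
  using ctrl_exec_exec exec_acts by blast

lemma ctrl_exec_global: "ctrl_exec C \<rho> u s \<Longrightarrow> s \<in> global_states C"
  using ctrl_exec_exec exec_global_state by blast

lemma ctrl_exec_determ: "ctrl_exec C \<rho> u s \<Longrightarrow> ctrl_exec C \<rho> u s' \<Longrightarrow> s = s'"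
  using ctrl_exec_exec exec_determ by metis

text \<open>Up to equivalence the play continues its past by letters that avoid \<open>D\<close>,
  and these do not change the states of \<open>D\<close>.\<close>

lemma state_of_past:
  assumes "ctrl_exec C \<rho> u s" "p \<in> D" shows "state_of (trace C (past C D u)) p = s p"
proof -
  have ex: "exec C (past C D u @ rest C D u) s"
    using trace_eq_exec[OF trace_eq_past_rest] ctrl_exec_acts ctrl_exec_exec assms(1) by blast
  then obtain s' where s': "exec C (past C D u) s'" using exec_prefix by blast
  have "\<forall>a\<in>set (rest C D u). p \<notin> dmn C a" using rest_indep assms(2) by fast
  then show ?thesis using exec_append_outside[OF ex s'] state_of_trace[OF s'] by simp
qed

lemma state_of_lview: "ctrl_exec C \<rho> u s \<Longrightarrow> state_of (lview u p) p = s p"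
  using state_of_past[of u s p "{p}"] by (simp add: view_trace ctrl_exec_acts)

lemma choice_commitment:
  assumes u: "ctrl_exec C \<rho> u s" and p: "p \<in> procs C"
  shows "choice p (lview u p) \<in> commitments C (s p)"
proof -
  have "trace C u \<in> all_plays C" using u ctrl_exec_exec trace_all_plays by blast
  then have "\<rho> p (lview u p) \<subseteq> sys_acts C"
    using winning p by (fastforce simp: winning_controller_def controller_def)
  then show ?thesis using state_of_lview[OF u] by (auto simp: choice_def commitments_def)
qed

lemma allowed_iff_choice:
  assumes u: "ctrl_exec C \<rho> u s" and a: "step C s a s'"
  shows "allowed C \<rho> u a \<longleftrightarrow>
    a \<in> env_acts C \<or> a \<in> sys_acts C \<and> (\<forall>p\<in>dmn C a. a \<in> choice p (lview u p))"
  using step_en[OF a] state_of_lview[OF u] by (auto simp: allowed_def choice_def)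

lemma view_joint_past:
  "set u \<subseteq> acts C \<Longrightarrow> p \<in> dmn C a \<Longrightarrow> view C p (joint_past a u) = lview u p"
  using past_of_past[of u p "dmn C a"]
  by (simp add: joint_past_def view_trace trace_eq_iff subset_trans[OF set_past])

lemma snoc_joint_past:
  "set (u @ [a]) \<subseteq> acts C \<Longrightarrow> p \<in> dmn C a \<Longrightarrow> snoc C (joint_past a u) a = lview (u @ [a]) p"
  by (simp add: joint_past_def snoc_trace view_trace past_singleton_snoc)

text \<open>Needed twice: to identify events with equal presets, and to recognise an enabled event,
  whatever play it stems from, as a continuation of the current play.\<close>

lemma joint_past_eqI:
  assumes "set u \<subseteq> acts C" "set v \<subseteq> acts C" "a \<in> acts C"
    and "\<And>p. p \<in> dmn C a \<Longrightarrow> lview u p = lview v p"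
  shows "joint_past a u = joint_past a v"
  unfolding joint_past_def trace_eq_iff
proof (rule past_determined_by_views)
  show "trace_eq C (past C {p} u) (past C {p} v)" if "p \<in> dmn C a" for p
    using assms(4)[OF that] by (simp add: view_trace assms(1,2) trace_eq_iff)
qed (use assms finite_dmn dmn_nonempty in simp_all)

definition local_views :: "('p \<times> 'a trace) set" where
  "local_views = {(p, lview u p) | p u s. p \<in> procs C \<and> ctrl_exec C \<rho> u s}"

definition events :: "('a \<times> 'a trace) set" where
  "events = {(a, joint_past a u) | a u s. ctrl_exec C \<rho> (u @ [a]) s}"

lemma local_viewsI: "p \<in> procs C \<Longrightarrow> ctrl_exec C \<rho> u s \<Longrightarrow> (p, lview u p) \<in> local_views"
  by (auto simp: local_views_def)

lemma local_viewsE: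
  assumes "(p, V) \<in> local_views"
  obtains u s where "p \<in> procs C" "ctrl_exec C \<rho> u s" "V = lview u p"
  using assms by (auto simp: local_views_def)

lemma eventsI: "ctrl_exec C \<rho> (u @ [a]) s \<Longrightarrow> (a, joint_past a u) \<in> events"
  by (auto simp: events_def)

lemma eventsE:
  assumes "(a, W) \<in> events"
  obtains u s s' where "ctrl_exec C \<rho> u s" "ctrl_exec C \<rho> (u @ [a]) s'" "step C s a s'"
    "allowed C \<rho> u a" "W = joint_past a u" "a \<in> acts C" "dmn C a \<subseteq> procs C"
proof -
  obtain u s' where u: "ctrl_exec C \<rho> (u @ [a]) s'" "W = joint_past a u"
    using assms by (auto simp: events_def)
  moreover obtain s where "ctrl_exec C \<rho> u s" "step C s a s'" "allowed C \<rho> u a"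
    using u(1) ctrl_exec_snoc_iff by metis
  ultimately show thesis using that dmn_subset by (auto simp: step_def)
qed

definition nodes :: "('p, 'a) node set" where
  "nodes = {n. case n of Sys_Place p V \<Rightarrow> (p, V) \<in> local_views | Env_Place p V \<Rightarrow> (p, V) \<in> local_views
     | Commit p V \<Rightarrow> (p, V) \<in> local_views | Event a W \<Rightarrow> (a, W) \<in> events}"

lemma nodes_simps [simp]:
  "Sys_Place p V \<in> nodes \<longleftrightarrow> (p, V) \<in> local_views"
  "Env_Place p V \<in> nodes \<longleftrightarrow> (p, V) \<in> local_views"
  "Commit p V \<in> nodes \<longleftrightarrow> (p, V) \<in> local_views"
  "Event a W \<in> nodes \<longleftrightarrow> (a, W) \<in> events"
  by (simp_all add: nodes_def)

text \<open>The strategy must have natural numbers as nodes, and its nodes are named by traces over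
  a finite alphabet.\<close>

lemma countable_nodes: "countable nodes"
proof -
  define T where "T = trace C ` lists (acts C)"
  have T: "countable T" using finite_acts by (simp add: T_def countable_finite)
  have T_mem: "trace C (past C D u) \<in> T" if "ctrl_exec C \<rho> u s" for D u s
    using ctrl_exec_acts[OF that] set_past[of C D u] by (auto simp: T_def in_lists_conv_set)
  have "local_views \<subseteq> procs C \<times> T"
    using T_mem ctrl_exec_acts by (auto simp: local_views_def view_trace)
  moreover have "events \<subseteq> acts C \<times> T"
  proof (rule subrelI)
    fix a W assume "(a, W) \<in> events"
    then obtain u s where "ctrl_exec C \<rho> u s" "W = joint_past a u" "a \<in> acts C" by (rule eventsE)
    then show "(a, W) \<in> acts C \<times> T" using T_mem by (simp add: joint_past_def)
  qed
  moreover have "countable (procs C \<times> T)" "countable (acts C \<times> T)"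
    using T finite_procs finite_acts by (auto intro: countable_finite)
  ultimately have lv: "countable local_views" and ev: "countable events"
    using countable_subset by blast+
  have "nodes \<subseteq> case_prod Sys_Place ` local_views \<union> case_prod Env_Place ` local_views
      \<union> case_prod Commit ` local_views \<union> case_prod Event ` events"
  proof
    fix n assume "n \<in> nodes"
    then show "n \<in> case_prod Sys_Place ` local_views \<union> case_prod Env_Place ` local_views
      \<union> case_prod Commit ` local_views \<union> case_prod Event ` events"
      by (cases n) force+
  qed
  moreover have "countable (case_prod Sys_Place ` local_views \<union> case_prod Env_Place ` local_views
      \<union> case_prod Commit ` local_views \<union> case_prod Event ` events)"
    using lv ev by (intro countable_Un countable_image)
  ultimately show ?thesis by (rule countable_subset)
qed

section \<open>The unfolded controller as a net on natural numbers\<close>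

definition code :: "('p, 'a) node \<Rightarrow> nat" where
  "code = to_nat_on nodes"

definition decode :: "nat \<Rightarrow> ('p, 'a) node" where
  "decode = inv_into nodes code"

lemma code_inj: "inj_on code nodes"
  unfolding code_def using countable_nodes by (rule inj_on_to_nat_on)

lemma decode_code [simp]: "n \<in> nodes \<Longrightarrow> decode (code n) = n"
  unfolding decode_def using code_inj by (rule inv_into_f_f)

lemma code_eq [simp]: "n \<in> nodes \<Longrightarrow> m \<in> nodes \<Longrightarrow> code n = code m \<longleftrightarrow> n = m"
  using code_inj by (auto dest: inj_onD)

text \<open>The name of an event only stores the joint past \<open>W\<close>; the view of a
  participant before the event is recovered as \<open>view C p W\<close>.\<close>

fun node_pre :: "('p, 'a) node \<Rightarrow> ('p, 'a) node set" where
  "node_pre (Commit p V) = {Sys_Place p V}"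
| "node_pre (Event a W) = (\<lambda>p. Env_Place p (view C p W)) ` dmn C a"
| "node_pre _ = {}"

text \<open>All participants share one view after \<open>a\<close>, namely \<open>W\<close> extended
  by \<open>a\<close>, so the trace in the postset does not depend on \<open>p\<close>.\<close>

fun node_post :: "('p, 'a) node \<Rightarrow> ('p, 'a) node set" where
  "node_post (Commit p V) = {Env_Place p V}"
| "node_post (Event a W) = (\<lambda>p. Sys_Place p (snoc C W a)) ` dmn C a"
| "node_post _ = {}"

fun place_label :: "('p, 'a) node \<Rightarrow> ('p, 'a, 's) gplace" where
  "place_label (Sys_Place p V) = Sys (state_of V p)"
| "place_label (Env_Place p V) = Env (state_of V p) (choice p V)"
| "place_label _ = undefined"

fun trans_label :: "('p, 'a) node \<Rightarrow> ('p, 'a, 's) gtrans" where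
  "trans_label (Commit p V) = Tau (state_of V p) (choice p V)"
| "trans_label (Event a W) = Act a (restrict (state_of W) (dmn C a))
     (family a (state_of W) (\<lambda>p. choice p (view C p W)))"
| "trans_label _ = undefined"

definition strat :: "(nat, nat, ('p, 'a, 's) gplace, ('p, 'a, 's) gtrans) branching_process" where
  "strat = \<lparr>
     places = {q. \<exists>p V. (p, V) \<in> local_views
       \<and> (q = code (Sys_Place p V) \<or> q = code (Env_Place p V))},
     transitions = {t. (\<exists>p V. (p, V) \<in> local_views \<and> t = code (Commit p V))
       \<or> (\<exists>a W. (a, W) \<in> events \<and> t = code (Event a W))},
     pre = \<lambda>t. code ` node_pre (decode t),
     post = \<lambda>t. code ` node_post (decode t),
     init_marking = (\<lambda>p. code (Sys_Place p (trace C []))) ` procs C,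
     plab = \<lambda>q. place_label (decode q),
     tlab = \<lambda>t. trans_label (decode t) \<rparr>"

lemma strat_simps [simp]:
  "pre strat t = code ` node_pre (decode t)"
  "post strat t = code ` node_post (decode t)"
  "init_marking strat = (\<lambda>p. code (Sys_Place p (trace C []))) ` procs C"
  "plab strat q = place_label (decode q)"
  "tlab strat t = trans_label (decode t)"
  by (simp_all add: strat_def)

lemma strat_places: "q \<in> places strat \<longleftrightarrow>
    (\<exists>p V. (p, V) \<in> local_views \<and> (q = code (Sys_Place p V) \<or> q = code (Env_Place p V)))"
  by (simp add: strat_def)

lemma strat_transitions: "t \<in> transitions strat \<longleftrightarrow>
    (\<exists>p V. (p, V) \<in> local_views \<and> t = code (Commit p V)) \<or>
    (\<exists>a W. (a, W) \<in> events \<and> t = code (Event a W))"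
  by (simp add: strat_def)

lemma strat_transE:
  assumes "t \<in> transitions strat"
  obtains p V where "(p, V) \<in> local_views" "t = code (Commit p V)"
    | a u s s' where "(a, joint_past a u) \<in> events" "t = code (Event a (joint_past a u))"
      "ctrl_exec C \<rho> u s" "ctrl_exec C \<rho> (u @ [a]) s'" "step C s a s'"
      "allowed C \<rho> u a" "a \<in> acts C" "dmn C a \<subseteq> procs C"
proof -
  consider p V where "(p, V) \<in> local_views" "t = code (Commit p V)"
    | a W where "(a, W) \<in> events" "t = code (Event a W)"
    using assms unfolding strat_transitions by blast
  then show thesis
  proof cases
    case 1
    then show thesis by (rule that(1))
  next
    case (2 a W)
    from 2(1) show thesis by (rule eventsE) (use 2 that(2) in blast)
  qed
qed

lemma node_pre_event:
  assumes "set u \<subseteq> acts C"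
  shows "node_pre (Event a (joint_past a u)) = (\<lambda>p. Env_Place p (lview u p)) ` dmn C a"
  using view_joint_past[OF assms] by simp

lemma node_post_event:
  assumes "set (u @ [a]) \<subseteq> acts C"
  shows "node_post (Event a (joint_past a u)) = (\<lambda>p. Sys_Place p (lview (u @ [a]) p)) ` dmn C a"
  using snoc_joint_past[OF assms] by simp

lemma trans_label_event:
  assumes u: "ctrl_exec C \<rho> u s" and a: "step C s a s'"
  shows "trans_label (Event a (joint_past a u)) =
    Act a (restrict s (dmn C a)) (family a s (\<lambda>p. choice p (lview u p)))"
proof -
  have aC: "a \<in> acts C" using a by (simp add: step_def)
  have eq: "state_of (joint_past a u) p = s p" if "p \<in> dmn C a" for p
    using that state_of_past[OF u] by (simp add: joint_past_def)
  have "exec C (past C (dmn C a) u @ rest C (dmn C a) u) s"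
    using trace_eq_exec[OF trace_eq_past_rest] ctrl_exec_acts ctrl_exec_exec u by blast
  then obtain s'' where s'': "exec C (past C (dmn C a) u) s''" using exec_prefix by blast
  then have W: "state_of (joint_past a u) \<in> global_states C"
    using state_of_trace exec_global_state by (simp add: joint_past_def)
  have "family a (state_of (joint_past a u)) (\<lambda>p. choice p (view C p (joint_past a u))) x
      = family a s (\<lambda>p. choice p (lview u p)) x" for x
  proof (cases "x \<in> s ` dmn C a")
    case True
    then obtain p where p: "p \<in> dmn C a" "x = s p" by blast
    then show ?thesis
      using family_apply[OF W aC p(1)] family_apply[OF ctrl_exec_global[OF u] aC p(1)] eq
        view_joint_past[OF ctrl_exec_acts[OF u] p(1)] by simp
  next
    case False
    moreover have "state_of (joint_past a u) ` dmn C a = s ` dmn C a" using eq by simp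
    ultimately show ?thesis by (simp add: family_def)
  qed
  moreover have "restrict (state_of (joint_past a u)) (dmn C a) = restrict s (dmn C a)"
    using eq by (auto simp: restrict_def)
  ultimately show ?thesis by auto
qed

section \<open>Producers of places and well-foundedness of the flow\<close>

lemma Nil_local_view: "p \<in> procs C \<Longrightarrow> (p, trace C []) \<in> local_views"
  using local_viewsI[OF _ ctrl_exec_Nil, of p] by (simp add: view_trace)

lemma past_singleton_nonempty:
  "past C {p} u \<noteq> [] \<Longrightarrow>
    \<exists>v a w. u = (v @ [a]) @ w \<and> p \<in> dmn C a \<and> past C {p} u = past C (dmn C a) v @ [a]"
proof (induction u rule: rev_induct)
  case (snoc b u)
  show ?case
  proof (cases "p \<in> dmn C b")
    case True
    then show ?thesis using past_singleton_snoc(1) by (metis append_Nil2)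
  next
    case False
    then show ?thesis using snoc past_singleton_snoc(2) by (metis append_assoc)
  qed
qed simp

text \<open>The last letter of the view is the last action of \<open>p\<close>; it is the producing
  event, and an empty view means an initial place.\<close>

lemma sys_place_cases:
  assumes "(p, V) \<in> local_views"
  obtains "V = trace C []" | a W where "(a, W) \<in> events" "p \<in> dmn C a" "V = snoc C W a"
proof -
  obtain u s where u: "ctrl_exec C \<rho> u s" "V = lview u p" using assms by (rule local_viewsE)
  then have V: "V = trace C (past C {p} u)" using view_trace ctrl_exec_acts by blast
  show thesis
  proof (cases "past C {p} u = []")
    case True
    then show thesis using V that by simp
  next
    case False
    then obtain v a w where "u = (v @ [a]) @ w" "p \<in> dmn C a"
      and pa: "past C {p} u = past C (dmn C a) v @ [a]"
      using past_singleton_nonempty by blast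
    moreover obtain s' where "ctrl_exec C \<rho> (v @ [a]) s'"
      using u calculation ctrl_exec_prefix by blast
    ultimately show thesis
      using that(2)[OF eventsI] V by (simp add: pa joint_past_def snoc_trace)
  qed
qed

text \<open>The projections to \<open>p\<close> end with \<open>a\<close> and with \<open>b\<close>,
  so these agree, and cancelling the common last letter identifies the joint pasts.\<close>

lemma event_producer_unique:
  assumes "(a, W) \<in> events" "(b, W') \<in> events" "p \<in> dmn C a" "p \<in> dmn C b"
    and eq: "snoc C W a = snoc C W' b"
  shows "a = b \<and> W = W'"
proof -
  obtain u s where u: "ctrl_exec C \<rho> u s" "W = joint_past a u" "a \<in> acts C"
    using assms(1) by (rule eventsE)
  obtain v s' where v: "ctrl_exec C \<rho> v s'" "W' = joint_past b v" "b \<in> acts C"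
    using assms(2) by (rule eventsE)
  have te: "trace_eq C (past C (dmn C a) u @ [a]) (past C (dmn C b) v @ [b])"
    using eq u v by (simp add: joint_past_def snoc_trace trace_eq_iff)
  have "a = b" using trace_eq_proj[OF te, of p] assms by (simp add: proj_Cons)
  moreover have "set (past C (dmn C a) u @ [a]) \<subseteq> acts C"
    using ctrl_exec_acts[OF u(1)] set_past_rest[of C "dmn C a" u] u(3) by auto
  ultimately show ?thesis
    using trace_eq_cancel te u v by (simp add: joint_past_def trace_eq_iff)
qed

definition trace_length :: "'a trace \<Rightarrow> nat" where
  "trace_length V = length (SOME u. u \<in> V)"

lemma trace_length [simp]: "trace_length (trace C u) = length u"
proof -
  have "(SOME v. v \<in> trace C u) \<in> trace C u"
    by (rule someI[of _ u]) (simp add: mem_trace)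
  then show ?thesis using trace_eq_length by (fastforce simp: trace_length_def mem_trace)
qed

text \<open>A strictly increasing measure along the flow. At a given trace length the order is
  system place, commitment, commitment place, event, whence the factor 4; an event then extends the
  trace by one letter.\<close>

fun rank :: "('p, 'a) node \<Rightarrow> nat" where
  "rank (Sys_Place p V) = 4 * trace_length V"
| "rank (Commit p V) = 4 * trace_length V + 1"
| "rank (Env_Place p V) = 4 * trace_length V + 2"
| "rank (Event a W) = 4 * trace_length W + 3"

lemma event_pre_nodes:
  assumes "(a, W) \<in> events" shows "node_pre (Event a W) \<subseteq> nodes"
proof -
  obtain u s where u: "ctrl_exec C \<rho> u s" "W = joint_past a u" "dmn C a \<subseteq> procs C"
    using assms by (rule eventsE)
  then have "(p, lview u p) \<in> local_views" if "p \<in> dmn C a" for p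
    using that local_viewsI by blast
  then show ?thesis using node_pre_event[OF ctrl_exec_acts[OF u(1)]] u(2) by auto
qed

lemma event_post_nodes:
  assumes "(a, W) \<in> events" shows "node_post (Event a W) \<subseteq> nodes"
proof -
  obtain u s where u: "ctrl_exec C \<rho> (u @ [a]) s" "W = joint_past a u" "dmn C a \<subseteq> procs C"
    using assms by (rule eventsE)
  then have "(p, lview (u @ [a]) p) \<in> local_views" if "p \<in> dmn C a" for p
    using that local_viewsI by blast
  then show ?thesis using node_post_event[OF ctrl_exec_acts[OF u(1)]] u(2) by auto
qed

lemma event_pre_rank:
  assumes "(a, W) \<in> events" "n \<in> node_pre (Event a W)" shows "rank n < rank (Event a W)"
proof -
  obtain u s where u: "ctrl_exec C \<rho> u s" "W = joint_past a u" using assms(1) by (rule eventsE)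
  have "set (past C (dmn C a) u) \<subseteq> acts C"
    using ctrl_exec_acts[OF u(1)] set_past_rest[of C "dmn C a" u] by blast
  then show ?thesis
    using assms(2) u(2) by (auto simp: joint_past_def view_trace less_Suc_eq_le length_past)
qed

lemma event_post_rank:
  assumes "(a, W) \<in> events" "n \<in> node_post (Event a W)" shows "rank (Event a W) < rank n"
proof -
  obtain u s where "ctrl_exec C \<rho> u s" "W = joint_past a u" using assms(1) by (rule eventsE)
  then show ?thesis using assms(2) by (auto simp: joint_past_def snoc_trace)
qed

sublocale causal_net strat
proof
  fix t assume t: "t \<in> transitions strat"
  then show "pre strat t \<subseteq> places strat"
    unfolding strat_transitions
    using event_pre_nodes by (fastforce simp: strat_places)
  show "post strat t \<subseteq> places strat"
    using t event_post_nodes unfolding strat_transitions by (fastforce simp: strat_places)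
  show "pre strat t \<noteq> {}"
    using t by (cases rule: strat_transE) (simp_all add: dmn_nonempty)
next
  fix t t' q assume "t \<in> transitions strat" "t' \<in> transitions strat" "q \<in> post strat t" "q \<in> post strat t'"
  then show "t = t'"
    unfolding strat_transitions using event_post_nodes event_producer_unique
    by (auto simp: subset_iff) blast+
next
  define r where "r x = (case x of Inl q \<Rightarrow> rank (decode q) | Inr t \<Rightarrow> rank (decode t))" for x
  have "r x < r y" if xy: "(x, y) \<in> flow strat" for x y
  proof (cases x)
    case (Inl q)
    then obtain t where t: "y = Inr t" "t \<in> transitions strat" "q \<in> pre strat t"
      using xy by (auto simp: flow_simps simp del: strat_simps)
    then show ?thesis
      using Inl
    proof (cases rule: strat_transE[OF t(2)])
      case (2 a u)
      then obtain n where n: "n \<in> node_pre (Event a (joint_past a u))" "q = code n"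
        using t(3) by (auto simp del: node_pre.simps)
      then have "n \<in> nodes" using event_pre_nodes[OF 2(1)] by blast
      then show ?thesis using event_pre_rank[OF 2(1) n(1)] Inl t(1) 2(1,2) n(2)
        by (simp add: r_def del: rank.simps)
    qed (use t in \<open>auto simp: r_def\<close>)
  next
    case (Inr t)
    then obtain q where t: "y = Inl q" "t \<in> transitions strat" "q \<in> post strat t"
      using xy by (auto simp: flow_simps simp del: strat_simps)
    then show ?thesis
      using Inr
    proof (cases rule: strat_transE[OF t(2)])
      case (2 a u)
      then obtain n where n: "n \<in> node_post (Event a (joint_past a u))" "q = code n"
        using t(3) by (auto simp del: node_post.simps)
      then have "n \<in> nodes" using event_post_nodes[OF 2(1)] by blast
      then show ?thesis using event_post_rank[OF 2(1) n(1)] Inr t(1) 2(1,2) n(2)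
        by (simp add: r_def del: rank.simps)
    qed (use t in \<open>auto simp: r_def\<close>)
  qed
  then have "flow strat \<subseteq> measure r" by auto
  then show "wf (flow strat)" by (rule wf_subset[rotated]) simp
next
  have "place_pre strat (code (Sys_Place p (trace C []))) = {}" if p: "p \<in> procs C" for p
  proof -
    have "code (Sys_Place p (trace C [])) \<notin> post strat t" if t: "t \<in> transitions strat" for t
    proof
      assume q: "code (Sys_Place p (trace C [])) \<in> post strat t"
      from t show False
      proof (cases rule: strat_transE)
        case (1 p' V)
        then show False using q Nil_local_view \<open>p \<in> procs C\<close> by auto
      next
        case (2 a u s s')
        then obtain n where n: "n \<in> node_post (Event a (joint_past a u))"
          "code (Sys_Place p (trace C [])) = code n" using q by (auto simp del: node_post.simps)
        then have "n = Sys_Place p (trace C [])"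
          using event_post_nodes[OF 2(1)] Nil_local_view[OF \<open>p \<in> procs C\<close>] by (metis code_eq nodes_simps(1) subsetD)
        then show False using event_post_rank[OF 2(1) n(1)] by simp
      qed
    qed
    then show ?thesis by (auto simp: place_pre_def simp del: strat_simps)
  qed
  moreover have "q \<in> init_marking strat" if q: "q \<in> places strat" "place_pre strat q = {}" for q
  proof -
    obtain p V where V: "(p, V) \<in> local_views" "q = code (Sys_Place p V) \<or> q = code (Env_Place p V)"
      using q(1) strat_places by blast
    have np: "q \<notin> post strat t" if "t \<in> transitions strat" for t
      using q(2) that by (auto simp: place_pre_def simp del: strat_simps)
    have "q \<noteq> code (Env_Place p V)"
      using np[of "code (Commit p V)"] V(1) by (auto simp: strat_transitions)
    then have qS: "q = code (Sys_Place p V)" using V by blast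
    from V(1) show ?thesis
    proof (cases rule: sys_place_cases)
      case 1
      then show ?thesis using qS V(1) by (auto elim: local_viewsE)
    next
      case (2 a W)
      then have "q \<in> post strat (code (Event a W))" using qS by auto
      then show ?thesis using np[of "code (Event a W)"] 2 strat_transitions by blast
    qed
  qed
  ultimately show "init_marking strat = {q \<in> places strat. place_pre strat q = {}}"
    using Nil_local_view by (fastforce simp: strat_places)
qed

section \<open>Markings of the unfolded net given by plays\<close>

definition play_marking :: "'a list \<Rightarrow> 'p set \<Rightarrow> nat set" where
  "play_marking u Q = (\<lambda>p. code (Env_Place p (lview u p))) ` Q \<union> (\<lambda>p. code (Sys_Place p (lview u p))) ` (procs C - Q)"

lemma play_marking_Nil: "play_marking [] {} = init_marking strat"
  by (simp add: play_marking_def view_trace)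

lemma plab_play_marking:
  assumes u: "ctrl_exec C \<rho> u s" and Q: "Q \<subseteq> procs C"
  shows "plab strat ` play_marking u Q = game_marking C s (\<lambda>p. choice p (lview u p)) Q"
proof -
  have "place_label (decode (code (Env_Place p (lview u p)))) = Env (s p) (choice p (lview u p))"
    if "p \<in> Q" for p
    using that Q local_viewsI[OF _ u] state_of_lview[OF u] by (auto simp: subset_iff)
  moreover have "place_label (decode (code (Sys_Place p (lview u p)))) = Sys (s p)"
    if "p \<in> procs C - Q" for p
    using that local_viewsI[OF _ u] state_of_lview[OF u] by auto
  ultimately show ?thesis by (simp add: play_marking_def game_marking_def image_Un image_image)
qed

text \<open>A label reveals the local state, committed or not, and the local state reveals the
  process.\<close>

lemma inj_on_play_marking:
  assumes u: "ctrl_exec C \<rho> u s" and Q: "Q \<subseteq> procs C"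
  shows "inj_on (plab strat) (play_marking u Q)"
proof (rule inj_onI)
  fix x y assume xy: "x \<in> play_marking u Q" "y \<in> play_marking u Q" "plab strat x = plab strat y"
  define f where "f p = (if p \<in> Q then Env_Place p (lview u p) else Sys_Place p (lview u p))" for p
  have zeta: "zeta (plab strat (code (f p))) = s p" if "p \<in> procs C" for p
    using that local_viewsI[OF that u] state_of_lview[OF u] by (simp add: f_def)
  obtain p p' where p: "p \<in> procs C" "x = code (f p)" "p' \<in> procs C" "y = code (f p')"
  proof -
    have "\<exists>p\<in>procs C. q = code (f p)" if "q \<in> play_marking u Q" for q
      using that Q by (auto simp: play_marking_def f_def subset_iff intro: bexI)
    then show thesis using xy(1,2) that by metis
  qed
  then have "s p = s p'" using zeta xy(3) by metis
  then have "p = p'"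
    using global_state_eq_iff[OF ctrl_exec_global[OF u] ctrl_exec_global[OF u]] p by blast
  then show "x = y" using p by simp
qed

lemma play_marking_tau:
  assumes u: "ctrl_exec C \<rho> u s" and Q: "Q \<subseteq> procs C" and p: "p \<in> procs C - Q"
  shows "enabled strat (play_marking u Q) (code (Commit p (lview u p)))"
    "fire strat (play_marking u Q) (code (Commit p (lview u p))) = play_marking u (insert p Q)"
proof -
  have lv: "(p', lview u p') \<in> local_views" if "p' \<in> procs C" for p'
    using that u by (rule local_viewsI)
  show "enabled strat (play_marking u Q) (code (Commit p (lview u p)))"
    using p lv by (auto simp: enabled_def strat_transitions play_marking_def)
  show "fire strat (play_marking u Q) (code (Commit p (lview u p))) = play_marking u (insert p Q)"
    using p Q lv by (auto simp: fire_def play_marking_def subset_iff)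
qed

lemma play_marking_act:
  assumes u: "ctrl_exec C \<rho> u s" "ctrl_exec C \<rho> (u @ [a]) s'"
    and Q: "Q \<subseteq> procs C" and D: "dmn C a \<subseteq> Q"
  shows "enabled strat (play_marking u Q) (code (Event a (joint_past a u)))"
    "fire strat (play_marking u Q) (code (Event a (joint_past a u))) = play_marking (u @ [a]) (Q - dmn C a)"
proof -
  have lv: "(p, lview u p) \<in> local_views" if "p \<in> procs C" for p
    using that u(1) by (rule local_viewsI)
  have ev: "(a, joint_past a u) \<in> events" using u(2) by (rule eventsI)
  have acts: "set u \<subseteq> acts C" "set (u @ [a]) \<subseteq> acts C" using u ctrl_exec_acts by blast+
  define e where "e p = code (Env_Place p (lview u p))" for p
  have pr: "pre strat (code (Event a (joint_past a u))) = e ` dmn C a"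
    using ev node_pre_event[OF acts(1)] by (simp add: image_image e_def del: node_pre.simps)
  have po: "post strat (code (Event a (joint_past a u))) =
      (\<lambda>p. code (Sys_Place p (lview (u @ [a]) p))) ` dmn C a"
    using ev node_post_event[OF acts(2)] by (simp add: image_image del: node_post.simps)
  show "enabled strat (play_marking u Q) (code (Event a (joint_past a u)))"
    using ev D unfolding enabled_def pr by (auto simp: strat_transitions play_marking_def e_def)
  have out: "lview u p = lview (u @ [a]) p" if "p \<notin> dmn C a" for p
    using view_snoc_outside[OF acts(2) that] by simp
  have "play_marking u Q - e ` dmn C a =
      e ` (Q - dmn C a) \<union> (\<lambda>p. code (Sys_Place p (lview u p))) ` (procs C - Q)"
    using D Q lv by (auto simp: play_marking_def e_def subset_iff)
  also have "\<dots> = (\<lambda>p. code (Env_Place p (lview (u @ [a]) p))) ` (Q - dmn C a)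
      \<union> (\<lambda>p. code (Sys_Place p (lview (u @ [a]) p))) ` (procs C - Q)"
  proof -
    have "e p = code (Env_Place p (lview (u @ [a]) p))" if "p \<in> Q - dmn C a" for p
    proof -
      have "p \<notin> dmn C a" using that by blast
      from out[OF this] show ?thesis by (simp only: e_def)
    qed
    moreover have "code (Sys_Place p (lview u p)) = code (Sys_Place p (lview (u @ [a]) p))"
      if "p \<in> procs C - Q" for p
    proof -
      have "p \<notin> dmn C a" using that D by blast
      from out[OF this] show ?thesis by (simp only:)
    qed
    ultimately show ?thesis by (intro arg_cong2[of _ _ _ _ "(\<union>)"] image_cong refl)
  qed
  also have "\<dots> \<union> post strat (code (Event a (joint_past a u))) = play_marking (u @ [a]) (Q - dmn C a)"
  proof -
    have "procs C - (Q - dmn C a) = (procs C - Q) \<union> dmn C a" using D Q by blast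
    then show ?thesis unfolding play_marking_def po by (simp only: image_Un Un_assoc)
  qed
  finally show "fire strat (play_marking u Q) (code (Event a (joint_past a u))) = play_marking (u @ [a]) (Q - dmn C a)"
    unfolding fire_def pr .
qed

lemma play_marking_tau_steps:
  assumes u: "ctrl_exec C \<rho> u s" and Q: "Q \<subseteq> procs C" and Q0: "Q0 \<subseteq> procs C"
    and "play_marking u Q0 \<in> reachable strat"
  shows "play_marking u (Q0 \<union> Q) \<in> reachable strat \<and> (obs_step strat None)\<^sup>*\<^sup>* (play_marking u Q0) (play_marking u (Q0 \<union> Q))"
proof -
  have "finite Q" using Q finite_procs finite_subset by blast
  then show ?thesis using Q
  proof (induction Q rule: finite_induct)
    case (insert p Q)
    show ?case
    proof (cases "p \<in> Q0")
      case False
      then have p: "p \<in> procs C - (Q0 \<union> Q)" and sub: "Q0 \<union> Q \<subseteq> procs C" using insert Q0 by auto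
      note tau = play_marking_tau[OF u sub p]
      have "(p, lview u p) \<in> local_views" using p local_viewsI[OF _ u] by blast
      then have "obs (tlab strat (code (Commit p (lview u p)))) = None" by simp
      then have "obs_step strat None (play_marking u (Q0 \<union> Q)) (play_marking u (insert p (Q0 \<union> Q)))"
        using tau unfolding obs_step_def by metis
      moreover have "play_marking u (insert p (Q0 \<union> Q)) \<in> reachable strat"
        using insert tau reachable.fire by (metis insert_subset)
      ultimately show ?thesis using insert by (auto intro: rtranclp.rtrancl_into_rtrancl)
    qed (use insert in \<open>auto simp: insert_absorb\<close>)
  qed (use assms(4) in simp)
qed

lemma play_marking_reachable:
  assumes "ctrl_exec C \<rho> u s" "Q \<subseteq> procs C" shows "play_marking u Q \<in> reachable strat"
  using assms
proof (induction arbitrary: Q rule: ctrl_exec.induct)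
  case ctrl_exec_Nil
  have "play_marking [] ({} \<union> Q) \<in> reachable strat"
    using play_marking_tau_steps[OF ctrl_exec.ctrl_exec_Nil ctrl_exec_Nil, of "{}"] play_marking_Nil reachable.init[of strat]
    by simp
  then show ?case by simp
next
  case (ctrl_exec_snoc u s a s')
  have u: "ctrl_exec C \<rho> (u @ [a]) s'" using ctrl_exec_snoc ctrl_exec.ctrl_exec_snoc by metis
  have D: "dmn C a \<subseteq> procs C" using ctrl_exec_snoc dmn_subset by (auto simp: step_def)
  have "play_marking (u @ [a]) {} \<in> reachable strat"
    using play_marking_act[OF ctrl_exec_snoc(1) u D order_refl] ctrl_exec_snoc(4)[OF D] reachable.fire
    by (metis Diff_cancel)
  then show ?case using play_marking_tau_steps[OF u ctrl_exec_snoc(5), of "{}"] by simp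
qed

text \<open>An enabled event may have been created from a different play \<open>v\<close>. Its
  preset forces the views of its participants in \<open>u\<close> and \<open>v\<close> to agree, and
  with them the joint past, the local states and the permissions; so it extends \<open>u\<close> as
  well.\<close>

lemma enabled_play_marking_cases:
  assumes u: "ctrl_exec C \<rho> u s" and Q: "Q \<subseteq> procs C" and t: "enabled strat (play_marking u Q) t"
  obtains (act) a s' where "t = code (Event a (joint_past a u))" "ctrl_exec C \<rho> (u @ [a]) s'"
      "dmn C a \<subseteq> Q"
    | (tau) p where "p \<in> procs C - Q" "t = code (Commit p (lview u p))"
proof -
  have tt: "t \<in> transitions strat" "pre strat t \<subseteq> play_marking u Q" using t by (auto simp: enabled_def)
  have lv: "(p, lview u p) \<in> local_views" if "p \<in> procs C" for p
    using that u by (rule local_viewsI)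
  from tt(1) show thesis
  proof (cases rule: strat_transE)
    case (1 p V)
    then have "p \<in> procs C - Q \<and> V = lview u p" using tt(2) lv Q by (auto simp: play_marking_def subset_iff)
    then show thesis using 1 tau by blast
  next
    case (2 a v sv sv')
    have v: "set v \<subseteq> acts C" using 2 ctrl_exec_acts by blast
    have *: "p \<in> Q \<and> lview v p = lview u p" if p: "p \<in> dmn C a" for p
    proof -
      have "code (Env_Place p (lview v p)) \<in> pre strat t"
        using 2 p node_pre_event[OF v] by (auto simp del: node_pre.simps)
      then have "code (Env_Place p (lview v p)) \<in> play_marking u Q" using tt(2) by blast
      moreover have "(p, lview v p) \<in> local_views" using 2 p local_viewsI by blast
      ultimately show ?thesis using lv Q by (auto simp: play_marking_def subset_iff)
    qed
    have W: "joint_past a v = joint_past a u"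
      using * 2 v u by (intro joint_past_eqI) (auto dest: ctrl_exec_acts)
    have "s p = sv p" if "p \<in> dmn C a" for p
      using *[OF that] state_of_lview[OF u, of p] state_of_lview[OF 2(3), of p] by simp
    then have "restrict s (dmn C a) = restrict sv (dmn C a)" by (auto simp: restrict_def)
    then obtain s' where s': "step C s a s'"
      using delta_step[OF ctrl_exec_global[OF u]] 2(5,7) by (fastforce simp: step_def)
    moreover have "allowed C \<rho> u a" using 2(6) * by (auto simp: allowed_def)
    ultimately have "ctrl_exec C \<rho> (u @ [a]) s'" using u by (blast intro: ctrl_exec_snoc)
    then show thesis using act[of a s'] 2(2) W * by auto
  qed
qed

lemma reachable_play_marking:
  assumes "M \<in> reachable strat"
  shows "\<exists>u s Q. ctrl_exec C \<rho> u s \<and> Q \<subseteq> procs C \<and> M = play_marking u Q"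
  using assms
proof (induction rule: reachable.induct)
  case init
  then show ?case using play_marking_Nil ctrl_exec_Nil by (metis empty_subsetI)
next
  case (fire M t)
  then obtain u s Q where M: "ctrl_exec C \<rho> u s" "Q \<subseteq> procs C" "M = play_marking u Q" by blast
  show ?case
  proof (rule enabled_play_marking_cases[OF M(1,2) fire(2)[unfolded M(3)]])
    fix a s' assume act: "t = code (Event a (joint_past a u))" "ctrl_exec C \<rho> (u @ [a]) s'" "dmn C a \<subseteq> Q"
    then show ?thesis
      using play_marking_act(2)[OF M(1) act(2) M(2) act(3)] M
      by (intro exI[of _ "u @ [a]"] exI[of _ s'] exI[of _ "Q - dmn C a"]) auto
  next
    fix p assume tau: "p \<in> procs C - Q" "t = code (Commit p (lview u p))"
    then show ?thesis
      using play_marking_tau(2)[OF M(1,2) tau(1)] M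
      by (intro exI[of _ u] exI[of _ s] exI[of _ "insert p Q"]) auto
  qed
qed

text \<open>Each transition was created from a play, and the marking of that play, with the
  appropriate processes committed, enables it.\<close>

lemma transition_enabled:
  assumes "t \<in> transitions strat" shows "\<exists>M\<in>reachable strat. enabled strat M t"
  using assms
proof (cases rule: strat_transE)
  case (1 p V)
  obtain u s where u: "p \<in> procs C" "ctrl_exec C \<rho> u s" "V = lview u p" using 1(1) by (rule local_viewsE)
  then show ?thesis using play_marking_tau(1)[OF u(2), of "{}" p] play_marking_reachable[OF u(2), of "{}"] 1 by auto
next
  case (2 a u s s')
  then show ?thesis using play_marking_act(1)[OF 2(3,4,8) order_refl] play_marking_reachable[OF 2(3,8)] by blast
qed

lemma no_self_conflict: "t \<in> transitions strat \<Longrightarrow> \<not> conflict strat (Inr t) (Inr t)"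
  using transition_enabled enabled_no_self_conflict by blast

lemma strat_occurrence_net: "occurrence_net strat"
  unfolding occurrence_net_def
proof (intro conjI ballI)
  show "t1 = t2" if "t1 \<in> place_pre strat q" "t2 \<in> place_pre strat q" for q t1 t2
    using that unique_producer[of t1 t2 q] by (simp add: place_pre_def del: strat_simps)
qed (fact pre_places post_places wf_flow no_self_conflict init_eq)+

section \<open>The unfolded controller as a branching process\<close>

lemma event_label_mem:
  assumes u: "ctrl_exec C \<rho> u s" and a: "step C s a s'" "allowed C \<rho> u a"
  shows "trans_label (Event a (joint_past a u)) \<in> transitions (game_of C)"
  unfolding trans_label_event[OF u a(1)]
proof (rule family_mem[OF a(1)])
  show "choice p (lview u p) \<in> commitments C (s p)" if "p \<in> dmn C a" for p
    using that choice_commitment[OF u] dmn_subset a by (auto simp: step_def)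
qed (use allowed_iff_choice[OF u a(1)] a(2) in simp)

lemma commit_label:
  assumes "p \<in> procs C" "ctrl_exec C \<rho> u s"
  shows "trans_label (Commit p (lview u p)) = Tau (s p) (choice p (lview u p))"
    "Tau (s p) (choice p (lview u p)) \<in> transitions (game_of C)"
    "place_label (Sys_Place p (lview u p)) = Sys (s p)"
    "place_label (Env_Place p (lview u p)) = Env (s p) (choice p (lview u p))"
  using assms choice_commitment[OF assms(2,1)] global_state_lstates[OF ctrl_exec_global] state_of_lview
  by (auto simp: tau_mem all_lstates_def)

lemma event_bij:
  assumes u: "ctrl_exec C \<rho> u s" and a: "ctrl_exec C \<rho> (u @ [a]) s'"
  shows "bij_betw (plab strat) (pre strat (code (Event a (joint_past a u))))
      (gpre C (tlab strat (code (Event a (joint_past a u)))))"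
    "bij_betw (plab strat) (post strat (code (Event a (joint_past a u))))
      (gpost C (tlab strat (code (Event a (joint_past a u)))))"
proof -
  have ev: "(a, joint_past a u) \<in> events" using a by (rule eventsI)
  have st: "step C s a s'" using a u ctrl_exec_snoc_iff ctrl_exec_determ by metis
  have aC: "a \<in> acts C" using st by (simp add: step_def)
  have D: "dmn C a \<subseteq> procs C" using dmn_subset[OF aC] .
  note s = ctrl_exec_global[OF u] and s' = ctrl_exec_global[OF a]
  have pr: "pre strat (code (Event a (joint_past a u))) =
      (\<lambda>p. code (Env_Place p (lview u p))) ` dmn C a"
    using ev node_pre_event[OF ctrl_exec_acts[OF u]] by (simp add: image_image del: node_pre.simps)
  have po: "post strat (code (Event a (joint_past a u))) =
      (\<lambda>p. code (Sys_Place p (lview (u @ [a]) p))) ` dmn C a"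
    using ev node_post_event[OF ctrl_exec_acts[OF a]] by (simp add: image_image del: node_post.simps)
  have lab: "tlab strat (code (Event a (joint_past a u))) =
      Act a (restrict s (dmn C a)) (family a s (\<lambda>p. choice p (lview u p)))"
    using ev trans_label_event[OF u st] by (simp del: trans_label.simps)
  show "bij_betw (plab strat) (pre strat (code (Event a (joint_past a u))))
      (gpre C (tlab strat (code (Event a (joint_past a u)))))"
    unfolding pr lab gpre_family[OF s aC]
  proof (rule bij_betw_image_comp)
    show "inj_on (\<lambda>p. Env (s p) (choice p (lview u p)) :: ('p, 'a, 's) gplace) (dmn C a)"
      using global_state_eq_iff[OF s s] D by (auto intro!: inj_onI)
    show "plab strat (code (Env_Place p (lview u p))) = Env (s p) (choice p (lview u p))"
      if "p \<in> dmn C a" for p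
      using local_viewsI[OF _ u] that D commit_label(4)[OF _ u] by (auto simp del: place_label.simps)
  qed
  have "gpost C (tlab strat (code (Event a (joint_past a u)))) = (\<lambda>p. Sys (s' p)) ` dmn C a"
    unfolding lab using step_delta[OF st] by (simp add: image_image cong: image_cong)
  moreover have "bij_betw (plab strat) ((\<lambda>p. code (Sys_Place p (lview (u @ [a]) p))) ` dmn C a)
      ((\<lambda>p. Sys (s' p)) ` dmn C a)"
  proof (rule bij_betw_image_comp)
    show "inj_on (\<lambda>p. Sys (s' p) :: ('p, 'a, 's) gplace) (dmn C a)"
      using global_state_eq_iff[OF s' s'] D by (auto intro!: inj_onI)
    show "plab strat (code (Sys_Place p (lview (u @ [a]) p))) = Sys (s' p)" if "p \<in> dmn C a" for p
      using local_viewsI[OF _ a] that D commit_label(3)[OF _ a] by (auto simp del: place_label.simps)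
  qed
  ultimately show "bij_betw (plab strat) (post strat (code (Event a (joint_past a u))))
      (gpost C (tlab strat (code (Event a (joint_past a u)))))"
    unfolding po by simp
qed

lemma commit_bij:
  assumes "(p, V) \<in> local_views"
  shows "bij_betw (plab strat) (pre strat (code (Commit p V))) (gpre C (tlab strat (code (Commit p V))))"
    "bij_betw (plab strat) (post strat (code (Commit p V))) (gpost C (tlab strat (code (Commit p V))))"
  using assms by (simp_all add: bij_betw_def)

lemma init_bij: "bij_betw (plab strat) (init_marking strat) (init_marking (game_of C))"
proof -
  have "bij_betw (plab strat) ((\<lambda>p. code (Sys_Place p (trace C []))) ` procs C)
      ((\<lambda>p. Sys (init_state C p)) ` procs C)"
  proof (rule bij_betw_image_comp)
    show "inj_on (\<lambda>p. Sys (init_state C p) :: ('p, 'a, 's) gplace) (procs C)"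
      using global_state_eq_iff[OF init_state init_state] by (auto intro!: inj_onI)
    show "plab strat (code (Sys_Place p (trace C []))) = Sys (init_state C p)" if "p \<in> procs C" for p
      using that Nil_local_view state_of_trace[OF exec_Nil] by simp
  qed
  then show ?thesis by (simp add: image_image)
qed

lemma event_pre_inj:
  assumes ev: "(a, W) \<in> events" "(a, W') \<in> events"
    and eq: "pre strat (code (Event a W)) = pre strat (code (Event a W'))"
  shows "W = W'"
proof -
  obtain u s where u: "ctrl_exec C \<rho> u s" "W = joint_past a u" "a \<in> acts C" "dmn C a \<subseteq> procs C"
    using ev(1) by (rule eventsE)
  obtain v s' where v: "ctrl_exec C \<rho> v s'" "W' = joint_past a v" using ev(2) by (rule eventsE)
  have "lview u p = lview v p" if p: "p \<in> dmn C a" for p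
  proof -
    have "code (Env_Place p (lview u p)) \<in> code ` node_pre (Event a W)"
      using p node_pre_event[OF ctrl_exec_acts[OF u(1)]] u(2) by (simp del: node_pre.simps)
    then have "code (Env_Place p (lview u p)) \<in> code ` node_pre (Event a W')"
      using eq ev by (simp del: node_pre.simps)
    then obtain n where n: "n \<in> node_pre (Event a W')" "code (Env_Place p (lview u p)) = code n"
      by (auto simp del: node_pre.simps)
    moreover have "Env_Place p (lview u p) \<in> nodes" using p u local_viewsI by auto
    ultimately have "n = Env_Place p (lview u p)" using event_pre_nodes[OF ev(2)] code_eq by blast
    then show ?thesis using n(1) node_pre_event[OF ctrl_exec_acts[OF v(1)]] v(2)
      by (auto simp del: node_pre.simps)
  qed
  then show ?thesis
    using joint_past_eqI[of u v a] ctrl_exec_acts[OF u(1)] ctrl_exec_acts[OF v(1)] u v by simp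
qed

lemma strat_branching: "branching_process_of (game_of C) strat"
  unfolding branching_process_of_def
proof (intro conjI ballI impI)
  show "occurrence_net strat" by (rule strat_occurrence_net)
  show "plab strat ` places strat \<subseteq> places (game_of C)"
  proof (rule image_subsetI)
    fix q assume "q \<in> places strat"
    then obtain p V where V: "(p, V) \<in> local_views" "q = code (Sys_Place p V) \<or> q = code (Env_Place p V)"
      using strat_places by blast
    obtain u s where u: "p \<in> procs C" "ctrl_exec C \<rho> u s" "V = lview u p" using V(1) by (rule local_viewsE)
    have "s p \<in> all_lstates C"
      using u global_state_lstates[OF ctrl_exec_global] by (auto simp: all_lstates_def)
    then show "plab strat q \<in> places (game_of C)"
      using V u commit_label[OF u(1,2)] choice_commitment[OF u(2,1)]
      by (auto simp: places_game_of commitment_places_def)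
  qed
  show "tlab strat ` transitions strat \<subseteq> transitions (game_of C)"
  proof (rule image_subsetI)
    fix t assume "t \<in> transitions strat"
    then show "tlab strat t \<in> transitions (game_of C)"
    proof (cases rule: strat_transE)
      case (1 p V)
      obtain u s where u: "p \<in> procs C" "ctrl_exec C \<rho> u s" "V = lview u p" using 1(1) by (rule local_viewsE)
      then show ?thesis using 1 commit_label[OF u(1,2)] by simp
    next
      case (2 a u s s')
      then show ?thesis using event_label_mem[OF 2(3,5,6)] by (simp del: trans_label.simps)
    qed
  qed
  show "bij_betw (plab strat) (init_marking strat) (init_marking (game_of C))" by (rule init_bij)
next
  fix t assume "t \<in> transitions strat"
  then show "bij_betw (plab strat) (pre strat t) (pre (game_of C) (tlab strat t))"
    unfolding game_of_simps
    by (cases rule: strat_transE) (blast intro: commit_bij, blast intro: event_bij)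
next
  fix t assume "t \<in> transitions strat"
  then show "bij_betw (plab strat) (post strat t) (post (game_of C) (tlab strat t))"
    unfolding game_of_simps
    by (cases rule: strat_transE) (blast intro: commit_bij, blast intro: event_bij)
next
  fix t t' assume t: "t \<in> transitions strat" "t' \<in> transitions strat"
    and eq: "pre strat t = pre strat t' \<and> tlab strat t = tlab strat t'"
  from t(1) show "t = t'"
  proof (cases rule: strat_transE)
    case t: (1 p V)
    from \<open>t' \<in> transitions strat\<close> show ?thesis
      by (cases rule: strat_transE) (use eq t in auto)
  next
    case t: (2 a u s s')
    from \<open>t' \<in> transitions strat\<close> show ?thesis
    proof (cases rule: strat_transE)
      case (2 b v)
      then have "b = a" using t eq by simp
      then show ?thesis using event_pre_inj[of a "joint_past a u" "joint_past b v"] 2 t eq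
        by (simp del: strat_simps)
    qed (use eq t in auto)
  qed
qed

lemma finite_strat_pre: "t \<in> transitions strat \<Longrightarrow> finite (pre strat t)"
  by (erule strat_transE) (auto intro!: finite_imageI finite_dmn)

section \<open>Justified refusal and the winning conditions for the unfolded controller\<close>

lemma no_deadlock:
  assumes "ctrl_exec C \<rho> u s" "\<not> final_state C s"
  shows "\<exists>a s'. ctrl_exec C \<rho> (u @ [a]) s'"
proof -
  have "u \<in> trace C u" by (simp add: mem_trace)
  moreover have "trace C u \<in> plays C \<rho>" using assms(1) ctrl_exec_plays by blast
  ultimately obtain a where "snoc C (trace C u) a \<in> plays C \<rho>"
    using winning assms ctrl_exec_exec
    unfolding winning_controller_def controller_deadlock_avoiding_def by blast
  then show ?thesis using trace_plays by (auto simp: snoc_trace)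
qed

text \<open>\<open>M\<close> would be the full marking of a non-final state. There a
  deadlock-avoiding controller permits some action, and the label of its event is enabled in
  \<open>M\<close>, although \<open>M\<close> is final in the base game.\<close>

lemma play_marking_not_deadlock:
  assumes u: "ctrl_exec C \<rho> u s" and Q: "Q \<subseteq> procs C"
    and M: "M \<in> deadlock_markings C"
  shows "\<not> M \<subseteq> plab strat ` play_marking u Q"
proof
  assume "M \<subseteq> plab strat ` play_marking u Q"
  then have sub: "M \<subseteq> game_marking C s (\<lambda>p. choice p (lview u p)) Q" unfolding plab_play_marking[OF u Q] .
  note dl = deadlock_pre_subset[OF M sub ctrl_exec_global[OF u] Q]
  obtain a s' where a: "ctrl_exec C \<rho> (u @ [a]) s'" using no_deadlock[OF u dl(3)] by blast
  then have st: "step C s a s'" "allowed C \<rho> u a"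
    using u ctrl_exec_snoc_iff ctrl_exec_determ by metis+
  have aC: "a \<in> acts C" using st by (simp add: step_def)
  define t where "t = trans_label (Event a (joint_past a u))"
  have t: "t = Act a (restrict s (dmn C a)) (family a s (\<lambda>p. choice p (lview u p)))"
    unfolding t_def by (rule trans_label_event[OF u st(1)])
  have "t \<in> transitions (base_game C)"
    using event_label_mem[OF u st] t unfolding t_def[symmetric] base_mem by simp
  moreover have "gpre C t \<subseteq> M"
    unfolding t gpre_family[OF ctrl_exec_global[OF u] aC] dl(2)
    using dmn_subset[OF aC] dl(1) by (auto simp: game_marking_def)
  ultimately show False using dl(4) by (auto simp: final_marking_def enabled_def)
qed

lemma strat_justified_refusal: "justified_refusal (game_of C) strat"
  unfolding justified_refusal_def
proof (intro allI impI, elim conjE)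
  fix D t
  assume D: "D \<subseteq> places strat" "\<forall>q\<in>D. \<forall>q'\<in>D. q \<noteq> q' \<longrightarrow> concurrent strat (Inl q) (Inl q')"
    and t: "t \<in> transitions (game_of C)" and lab: "plab strat ` D = pre (game_of C) t"
  \<comment> \<open>\<open>D\<close> is not known to be finite. Applied to pairs, this claim gives
    injectivity of labels on \<open>D\<close>; as the preset of \<open>t\<close> is finite, so is
    \<open>D\<close>, and the claim then applies to \<open>D\<close> itself.\<close>
  have sub: "\<exists>u s Q. ctrl_exec C \<rho> u s \<and> Q \<subseteq> procs C \<and> E \<subseteq> play_marking u Q" if "finite E" "E \<subseteq> D" for E
  proof -
    have "\<exists>M\<in>reachable strat. E \<subseteq> M"
      using that D by (intro concurrent_subset_reachable finite_strat_pre no_self_conflict) auto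
    then show ?thesis using reachable_play_marking by blast
  qed
  have "inj_on (plab strat) D"
  proof (rule inj_onI)
    fix q q' assume q: "q \<in> D" "q' \<in> D" "plab strat q = plab strat q'"
    obtain u s Q where "ctrl_exec C \<rho> u s" "Q \<subseteq> procs C" "{q, q'} \<subseteq> play_marking u Q"
      using sub[of "{q, q'}"] q by auto
    then show "q = q'" using inj_on_play_marking q(3) by (meson inj_onD insert_subset)
  qed
  moreover have "finite (plab strat ` D)" unfolding lab using gpre_finite[OF t] by simp
  ultimately have "finite D" using finite_imageD by blast
  then obtain u s Q where u: "ctrl_exec C \<rho> u s" and Q: "Q \<subseteq> procs C" and DM: "D \<subseteq> play_marking u Q"
    using sub[OF _ order_refl] by blast
  note s = ctrl_exec_global[OF u]
  have gsub: "gpre C t \<subseteq> game_marking C s (\<lambda>p. choice p (lview u p)) Q"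
    using image_mono[OF DM, of "plab strat"] lab plab_play_marking[OF u Q] by simp
  have lv: "(p, lview u p) \<in> local_views" if "p \<in> procs C" for p
    using that u by (rule local_viewsI)
  have eqD: "D = E" if "E \<subseteq> play_marking u Q" "plab strat ` E = gpre C t" for E
    using inj_on_image_eq_iff[OF inj_on_play_marking[OF u Q] DM that(1)] lab that(2) by simp
  show "(\<exists>t'\<in>transitions strat. tlab strat t' = t \<and> pre strat t' = D) \<or>
      (\<exists>q\<in>D. plab strat q \<in> sys_places (game_of C) \<and> t \<notin> tlab strat ` place_post strat q)"
  proof (cases t)
    case (Tau x A)
    then have "Sys x \<in> game_marking C s (\<lambda>p. choice p (lview u p)) Q" using gsub by simp
    then obtain p where p: "p \<in> procs C - Q" "x = s p" by (auto simp: game_marking_def)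
    define q where "q = code (Sys_Place p (lview u p))"
    define t' where "t' = code (Commit p (lview u p))"
    have qlab: "plab strat q = Sys x"
      using commit_label(3)[OF _ u, of p] p lv by (simp add: q_def del: place_label.simps)
    have t': "t' \<in> transitions strat" "tlab strat t' = Tau x (choice p (lview u p))" "pre strat t' = {q}"
      using p lv commit_label(1)[OF _ u, of p]
      by (auto simp: t'_def q_def strat_transitions simp del: trans_label.simps)
    have Dq: "D = {q}"
      using p qlab Tau by (intro eqD) (auto simp: q_def play_marking_def simp del: strat_simps)
    show ?thesis
    proof (cases "A = choice p (lview u p)")
      case True
      then show ?thesis using t' Dq Tau by blast
    next
      case False
      \<comment> \<open>A system place has no consumer besides its own \<open>Commit\<close>, so it
        refuses every commitment set other than the chosen one.\<close>
      have "t'' = t'" if "t'' \<in> place_post strat q" for t''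
      proof -
        have t'': "t'' \<in> transitions strat" "q \<in> pre strat t''"
          using that by (auto simp: place_post_def simp del: strat_simps)
        from t''(1) show ?thesis
        proof (cases rule: strat_transE)
          case (1 p' V)
          then show ?thesis using t''(2) p lv by (auto simp: q_def t'_def)
        next
          case (2 a v s1)
          then have "q \<in> code ` node_pre (Event a (joint_past a v))" using t''(2) by (simp del: node_pre.simps)
          then obtain n where n: "n \<in> node_pre (Event a (joint_past a v))" "q = code n" by blast
          then have "n \<in> nodes" using event_pre_nodes[OF 2(1)] by blast
          then have "n = Sys_Place p (lview u p)" using n(2) p lv by (auto simp: q_def)
          then show ?thesis using n(1) by auto
        qed
      qed
      then have "t \<notin> tlab strat ` place_post strat q"
        using t'(2) False Tau by (auto simp del: strat_simps)
      moreover have "x \<in> all_lstates C"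
        using p global_state_lstates[OF s] by (auto simp: all_lstates_def)
      ultimately show ?thesis using Dq qlab by (auto simp del: strat_simps)
    qed
  next
    case (Act a B A)
    note mem = t[unfolded Act] and gs = gsub[unfolded Act]
    note BA = act_eq_family[OF mem gs s Q]
    have dQ: "dmn C a \<subseteq> Q" using act_pre_subset[OF mem gs s Q] by blast
    have aC: "a \<in> acts C" and "delta C a B \<noteq> None" using mem by (auto simp: act_mem)
    then obtain s' where st: "step C s a s'" using delta_step[OF s aC] BA(1) by blast
    have "a \<in> env_acts C \<or> a \<in> sys_acts C \<and> (\<forall>p\<in>dmn C a. a \<in> choice p (lview u p))"
      using mem family_apply[OF s aC] unfolding BA by (simp add: act_mem)
    then have al: "allowed C \<rho> u a" using allowed_iff_choice[OF u st] by blast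
    then have u': "ctrl_exec C \<rho> (u @ [a]) s'" using u st by (blast intro: ctrl_exec_snoc)
    then have ev: "(a, joint_past a u) \<in> events" by (rule eventsI)
    define t' where "t' = code (Event a (joint_past a u))"
    have t': "t' \<in> transitions strat" using ev by (auto simp: t'_def strat_transitions)
    have tl: "tlab strat t' = t"
      using ev trans_label_event[OF u st] Act BA by (simp add: t'_def del: trans_label.simps)
    have "D = pre strat t'"
    proof (rule eqD)
      show "pre strat t' \<subseteq> play_marking u Q"
        using play_marking_act(1)[OF u u' Q dQ] by (simp add: enabled_def t'_def del: strat_simps)
      show "plab strat ` pre strat t' = gpre C t"
        using event_bij(1)[OF u u'] tl by (simp add: bij_betw_def t'_def del: strat_simps)
    qed
    then show ?thesis using t' tl by blast
  next
    case (DL M)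
    then have "M \<in> deadlock_markings C" using t DL_mem by blast
    then show ?thesis using play_marking_not_deadlock[OF u Q] gsub DL plab_play_marking[OF u Q] by simp
  qed
qed

lemma strat_commits: "always_commits (game_of C) strat"
  unfolding always_commits_def
proof (intro ballI impI)
  fix q assume q: "q \<in> places strat" "plab strat q \<in> sys_places (game_of C)"
  then obtain p V where V: "(p, V) \<in> local_views" "q = code (Sys_Place p V)"
    by (auto simp: strat_places)
  show "\<exists>!t. t \<in> place_post strat q"
  proof
    show "code (Commit p V) \<in> place_post strat q" using V by (auto simp: place_post_def strat_transitions)
    show "t = code (Commit p V)" if "t \<in> place_post strat q" for t
    proof -
      have t: "t \<in> transitions strat" "q \<in> pre strat t"
        using that by (auto simp: place_post_def simp del: strat_simps)
      from t(1) show ?thesis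
      proof (cases rule: strat_transE)
        case (1 p' V')
        then show ?thesis using t(2) V by auto
      next
        case (2 a v)
        then have "q \<in> code ` node_pre (Event a (joint_past a v))" using t(2) by (simp del: node_pre.simps)
        then obtain n where n: "n \<in> node_pre (Event a (joint_past a v))" "q = code n" by blast
        then have "n \<in> nodes" using event_pre_nodes[OF 2(1)] by blast
        then have "n = Sys_Place p V" using n(2) V by auto
        then show ?thesis using n(1) by auto
      qed
    qed
  qed
qed

text \<open>In a final marking all processes have committed, so it has environment places only. A
  game transition enabled at its labels could not be refused, and justified refusal would supply an
  enabled transition of the strategy.\<close>

lemma strat_deadlock_avoiding: "strategy_deadlock_avoiding (game_of C) strat"
  unfolding strategy_deadlock_avoiding_def
proof (intro ballI impI)
  fix M assume M: "M \<in> reachable strat" and fin: "final_marking strat M"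
  obtain u s Q where u: "ctrl_exec C \<rho> u s" and Q: "Q \<subseteq> procs C" and MQ: "M = play_marking u Q"
    using reachable_play_marking[OF M] by blast
  have "Q = procs C"
    using play_marking_tau(1)[OF u Q] fin Q MQ by (auto simp: final_marking_def)
  show "final_marking (game_of C) (plab strat ` M)"
    unfolding final_marking_def
  proof
    assume "\<exists>t. enabled (game_of C) (plab strat ` M) t"
    then obtain t where t: "t \<in> transitions (game_of C)" "gpre C t \<subseteq> plab strat ` M"
      by (auto simp: enabled_def simp del: strat_simps)
    define D where "D = {q \<in> M. plab strat q \<in> gpre C t}"
    have lab: "plab strat ` D = gpre C t" using t(2) by (auto simp: D_def simp del: strat_simps)
    have lv: "(p, lview u p) \<in> local_views" if "p \<in> procs C" for p
      using that u by (rule local_viewsI)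
    have "D \<subseteq> places strat"
      using lv unfolding D_def MQ \<open>Q = procs C\<close> play_marking_def by (auto simp only: strat_places) blast
    then have "(\<exists>t'\<in>transitions strat. tlab strat t' = t \<and> pre strat t' = D) \<or>
      (\<exists>q\<in>D. plab strat q \<in> sys_places (game_of C) \<and> t \<notin> tlab strat ` place_post strat q)"
      using strat_justified_refusal[unfolded justified_refusal_def, rule_format, of D t]
        reachable_concurrent[OF M] t(1) lab
      by (simp add: D_def del: strat_simps)
    moreover have "plab strat q \<notin> sys_places (game_of C)" if "q \<in> D" for q
      using that lv by (auto simp: D_def MQ \<open>Q = procs C\<close> play_marking_def)
    ultimately obtain t' where "t' \<in> transitions strat" "pre strat t' = D" by blast
    then have "enabled strat M t'" by (auto simp: enabled_def D_def simp del: strat_simps)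
    then show False using fin by (auto simp: final_marking_def)
  qed
qed

lemma strat_safe:
  assumes M: "M \<in> reachable strat" and q: "q \<in> M" shows "plab strat q \<notin> bad_places (game_of C)"
proof
  assume bad: "plab strat q \<in> bad_places (game_of C)"
  obtain u s Q where u: "ctrl_exec C \<rho> u s" and Q: "Q \<subseteq> procs C" and MQ: "M = play_marking u Q"
    using reachable_play_marking[OF M] by blast
  have "plab strat q \<in> game_marking C s (\<lambda>p. choice p (lview u p)) Q"
    using q plab_play_marking[OF u Q] MQ by blast
  then obtain p p' where p: "p \<in> procs C" "p' \<in> procs C" "s p \<in> losing C p'"
    using bad by (auto simp: game_marking_def simp del: strat_simps)
  then have "p = p'"
    using losing_subset global_state_lstates[OF ctrl_exec_global[OF u]] lstates_unique by blast
  then have "visits_losing C (trace C u)"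
    unfolding visits_losing_def using p ctrl_exec_exec[OF u]
    by (intro exI[of _ u] exI[of _ "[]"] exI[of _ s] exI[of _ p]) (simp add: mem_trace)
  then show False using winning ctrl_exec_plays[OF u] by (auto simp: winning_controller_def)
qed

lemma strat_winning: "winning_strategy (game_of C) strat"
  using strat_branching strat_justified_refusal strat_deadlock_avoiding strat_safe
  by (simp add: winning_strategy_def strategy_def del: strat_simps)

lemma strat_bisimilar: "bisimilar C strat \<rho>"
proof -
  \<comment> \<open>The set \<open>Q\<close> is left free: internal steps enlarge \<open>Q\<close>
    and keep the play.\<close>
  define R where "R = {(play_marking u Q, trace C u) | u s Q. ctrl_exec C \<rho> u s \<and> Q \<subseteq> procs C}"
  have R: "(play_marking u Q, trace C u) \<in> R" if "ctrl_exec C \<rho> u s" "Q \<subseteq> procs C" for u s Q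
    using that by (auto simp: R_def)
  have RE: "\<exists>u s Q. M = play_marking u Q \<and> T = trace C u \<and> ctrl_exec C \<rho> u s \<and> Q \<subseteq> procs C"
    if "(M, T) \<in> R" for M T
    using that by (auto simp: R_def)
  have obs_commit: "obs (tlab strat (code (Commit p (lview u p)))) = None"
    if "ctrl_exec C \<rho> u s" "p \<in> procs C" for u s p
    using local_viewsI[OF that(2,1)] by simp
  have obs_event: "obs (tlab strat (code (Event a (joint_past a u)))) = Some a"
    if "ctrl_exec C \<rho> (u @ [a]) s" for u s a
    using eventsI[OF that] by simp
  show ?thesis
    unfolding bisimilar_def
  proof (intro exI[of _ R] conjI allI impI)
    show "R \<subseteq> reachable strat \<times> plays C \<rho>"
      unfolding R_def using play_marking_reachable ctrl_exec_plays by blast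
    show "(init_marking strat, trace C []) \<in> R"
      using R[OF ctrl_exec_Nil, of "{}"] play_marking_Nil by simp
  next
    fix M T a M' assume "(M, T) \<in> R \<and> obs_step strat (Some a) M M'"
    then obtain u s Q t where M: "M = play_marking u Q" "T = trace C u" and u: "ctrl_exec C \<rho> u s"
      and Q: "Q \<subseteq> procs C" and t: "enabled strat (play_marking u Q) t" "obs (tlab strat t) = Some a" "M' = fire strat M t"
      using RE unfolding obs_step_def by blast
    obtain s' where st: "t = code (Event a (joint_past a u))" "ctrl_exec C \<rho> (u @ [a]) s'" "dmn C a \<subseteq> Q"
      using enabled_play_marking_cases[OF u Q t(1)] t(2) obs_event obs_commit[OF u]
      by (metis Diff_iff option.distinct(1) option.inject)
    have "M' = play_marking (u @ [a]) (Q - dmn C a)" using play_marking_act(2)[OF u st(2) Q st(3)] M t st by simp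
    then show "(M', snoc C T a) \<in> R" using R[OF st(2), of "Q - dmn C a"] Q M by (auto simp: snoc_trace)
    show "snoc C T a \<in> plays C \<rho>"
      using ctrl_exec_plays[OF st(2)] M by (simp add: snoc_trace)
  next
    fix M T M' assume "(M, T) \<in> R \<and> obs_step strat None M M'"
    then obtain u s Q t where M: "M = play_marking u Q" "T = trace C u" and u: "ctrl_exec C \<rho> u s"
      and Q: "Q \<subseteq> procs C" and t: "enabled strat (play_marking u Q) t" "obs (tlab strat t) = None" "M' = fire strat M t"
      using RE unfolding obs_step_def by blast
    obtain p where p: "p \<in> procs C - Q" "t = code (Commit p (lview u p))"
      using enabled_play_marking_cases[OF u Q t(1)] t(2) obs_event by (metis option.distinct(1))
    then have "M' = play_marking u (insert p Q)" using play_marking_tau(2)[OF u Q] M t by simp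
    then show "(M', T) \<in> R" using R[OF u, of "insert p Q"] p Q M by auto
  next
    fix M T a assume "(M, T) \<in> R \<and> snoc C T a \<in> plays C \<rho>"
    then obtain u s Q where M: "M = play_marking u Q" "T = trace C u" and u: "ctrl_exec C \<rho> u s"
      and Q: "Q \<subseteq> procs C" and "trace C (u @ [a]) \<in> plays C \<rho>"
      using RE snoc_trace by metis
    then obtain s' where u': "ctrl_exec C \<rho> (u @ [a]) s'" using trace_plays by blast
    have D: "dmn C a \<subseteq> procs C"
      using ctrl_exec_acts[OF u'] dmn_subset by simp
    have "(obs_step strat None)\<^sup>*\<^sup>* M (play_marking u (procs C))"
      using play_marking_tau_steps[OF u order_refl Q play_marking_reachable[OF u Q]] Q M(1) by (simp add: Un_absorb1)
    moreover have "obs_step strat (Some a) (play_marking u (procs C)) (play_marking (u @ [a]) (procs C - dmn C a))"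
      using play_marking_act[OF u u' order_refl D] obs_event[OF u'] unfolding obs_step_def by metis
    ultimately have "weak_step strat a M (play_marking (u @ [a]) (procs C - dmn C a))"
      unfolding weak_step_def by blast
    then show "\<exists>M'. weak_step strat a M M' \<and> (M', snoc C T a) \<in> R"
      using R[OF u', of "procs C - dmn C a"] M(2) by (auto simp: snoc_trace)
  qed
qed

end

theorem theorem6:
  fixes C :: "('p, 'a, 's) control_game"
  assumes "control_game C"
  shows "strategy_equivalent_committing TYPE('q) TYPE('u) C (game_of C)"
  unfolding strategy_equivalent_committing_def
proof (intro conjI allI impI)
  fix \<sigma> :: "('q, 'u, ('p, 'a, 's) gplace, ('p, 'a, 's) gtrans) branching_process"
  assume "winning_strategy (game_of C) \<sigma> \<and> always_commits (game_of C) \<sigma>"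
  then interpret committing_strategy C \<sigma>
    using assms by (simp add: committing_strategy_def committing_strategy_axioms_def)
  show "\<exists>\<rho>. winning_controller C \<rho> \<and> bisimilar C \<sigma> \<rho>"
    using induced_controller_winning induced_controller_bisimilar by blast
next
  fix \<rho> :: "('p, 'a) controller"
  assume "winning_controller C \<rho>"
  then interpret winning_control C \<rho>
    using assms by (simp add: winning_control_def winning_control_axioms_def)
  show "\<exists>\<sigma> :: (nat, nat, ('p, 'a, 's) gplace, ('p, 'a, 's) gtrans) branching_process.
      winning_strategy (game_of C) \<sigma> \<and> always_commits (game_of C) \<sigma> \<and> bisimilar C \<sigma> \<rho>"
    using strat_winning strat_commits strat_bisimilar by blast
qed

end
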